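(* Let $k\ge 1$ and let $Q=\bigotimes^k_{BP_*}BP_*(B\mathbb{Z}/2)$ with its decreasing filtration by $BP_*$-submodules $F_s$ ($s\ge 0$). For $0\le j\le k-1$ and $s\ge0$, the action of $v_j$ from $F_s/F_{s+1}$ to $F_{s+1}/F_{s+2}$ is multiplication by $\sum_{\ell\ge k}v_\ell\, p_{\ell,j}$, where $$p_{\ell,j}=\frac{m_{2^0,\ldots,\widehat{2^j},\ldots,2^{k-1},2^\ell}}{m_{2^0,\ldots,2^{k-1}}}$$ (the hat denotes omission, and the ratio is taken over $\mathbb{F}_2$ in variables $x_1,\ldots,x_k$). Moreover, $p_{\ell,j}$ is a symmetric polynomial, i.e. this ratio is an element of $\mathbb{F}_2[x_1,\ldots,x_k]$ and is symmetric.
   Context: $BP_*(-)$ is Brown-Peterson homology localized at $2$, with coefficients $BP_*=\mathbb{Z}_{(2)}[v_1,v_2,\ldots]$, $|v_j|=2(2^j-1)$, and $v_0=2$. $BP_*(B\mathbb{Z}/2)$ has $BP_*$-generators $z_i\in BP_{2i-1}(B\mathbb{Z}/2)$, $i\ge1$, with only relations $\sum_{j\ge0}a_jz_{i-j}=0$ ($z_n=0$ for $n\le 0$), where $a_j\in BP_{2j}$ are the coefficients of the $[2]$-series; modulo $(v_0,v_1,\ldots)^2$, $a_{2^i-1}\equiv v_i$ for $i\ge 0$, and $a_j\equiv0$ if $j+1$ is not a $2$-power. The integer $k$ is fixed. $Q$ is spanned over $BP_*$ by the classes $z_I=z_{i_1}\otimes\cdots\otimes z_{i_k}$ with $I=(i_1,\ldots,i_k)$,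 $i_j\ge1$; $Z_k$ is the set of these classes. $F_s=(v_0,v_1,\ldots)^sQ$. It is known that $F_s/F_{s+1}$ is an $\mathbb{F}_2$-vector space with basis all $(v_k^{t_k}v_{k+1}^{t_{k+1}}\cdots)z_I$ with $z_I\in Z_k$, $t_i\ge0$, $\sum t_i=s$. The polynomial ring $\mathbb{F}_2[x_1,\ldots,x_k]$ acts on the $\mathbb{F}_2$-vector space with basis $Z_k$ by $x_1^{e_1}\cdots x_k^{e_k}\cdot z_I=z_{I-E}$, where $I-E=(i_1-e_1,\ldots,i_k-e_k)$ and $z_J=0$ if any entry of $J$ is $\le0$. Multiplication by $\sum_{\ell\ge k} v_\ell p_{\ell,j}$ sends $v^Tz_I$ (with $v^T$ a monomial in $v_k,v_{k+1},\ldots$) to $\sum_{\ell\ge k}v_\ell v^T(p_{\ell,j}\cdot z_I)$. For positive integers $t_1,\ldots,t_r$, $m_{t_1,\ldots,t_r}$ is the monomial symmetric polynomial in $x_1,\ldots,x_k$, i.e. the smallest symmetric polynomial containing the monomial $x_1^{t_1}\cdots x_r^{t_r}$ (the sum of all distinct monomials obtained from it by permuting the variables). All polynomials are over $\mathbb{F}_2$. *)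

theory Defs
  imports
    "HOL-Library.Poly_Mapping"
    "HOL-Library.Z2"
    "HOL-Library.Set_Algebras"
    "HOL-Library.Multiset"
    "HOL-Library.Cardinality"
    "HOL-Computational_Algebra.Formal_Power_Series"
    "HOL-Computational_Algebra.Fraction_Field"
begin

section \<open>The coefficient ring and its two-series\<close>

typedef z2loc = "{r :: rat. \<exists>a b :: int. odd b \<and> r = of_int a / of_int b}"
  morphisms rat_of_z2loc z2loc_of_rat
  by (rule exI[of _ 0], rule CollectI, rule exI[of _ 0], rule exI[of _ 1]) simp

setup_lifting type_definition_z2loc

instantiation z2loc :: comm_ring_1
begin

lift_definition zero_z2loc :: z2loc is 0
  by (rule exI[of _ 0], rule exI[of _ 1]) simp

lift_definition one_z2loc :: z2loc is 1
  by (rule exI[of _ 1], rule exI[of _ 1]) simp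

lift_definition plus_z2loc :: "z2loc \<Rightarrow> z2loc \<Rightarrow> z2loc" is "(+)"
proof -
  fix r s :: rat
  assume "\<exists>a b::int. odd b \<and> r = of_int a / of_int b" "\<exists>a b::int. odd b \<and> s = of_int a / of_int b"
  then obtain a b c d :: int
    where *: "odd b" "r = of_int a / of_int b" "odd d" "s = of_int c / of_int d" by blast
  then have "b \<noteq> 0" "d \<noteq> 0" by auto
  with * have "odd (b * d) \<and> r + s = of_int (a * d + c * b) / of_int (b * d)"
    by (simp add: add_frac_eq)
  then show "\<exists>a b::int. odd b \<and> r + s = of_int a / of_int b" by blast
qed

lift_definition uminus_z2loc :: "z2loc \<Rightarrow> z2loc" is uminus
  by (metis minus_divide_left of_int_minus)

lift_definition minus_z2loc :: "z2loc \<Rightarrow> z2loc \<Rightarrow> z2loc" is "(-)"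
proof -
  fix r s :: rat
  assume "\<exists>a b::int. odd b \<and> r = of_int a / of_int b" "\<exists>a b::int. odd b \<and> s = of_int a / of_int b"
  then obtain a b c d :: int
    where *: "odd b" "r = of_int a / of_int b" "odd d" "s = of_int c / of_int d" by blast
  then have "b \<noteq> 0" "d \<noteq> 0" by auto
  with * have "odd (b * d) \<and> r - s = of_int (a * d - c * b) / of_int (b * d)"
    by (simp add: diff_frac_eq)
  then show "\<exists>a b::int. odd b \<and> r - s = of_int a / of_int b" by blast
qed

lift_definition times_z2loc :: "z2loc \<Rightarrow> z2loc \<Rightarrow> z2loc" is "(*)"
proof -
  fix r s :: rat
  assume "\<exists>a b::int. odd b \<and> r = of_int a / of_int b" "\<exists>a b::int. odd b \<and> s = of_int a / of_int b"
  then obtain a b c d :: int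
    where *: "odd b" "r = of_int a / of_int b" "odd d" "s = of_int c / of_int d" by blast
  then have "odd (b * d) \<and> r * s = of_int (a * c) / of_int (b * d)"
    by simp
  then show "\<exists>a b::int. odd b \<and> r * s = of_int a / of_int b" by blast
qed

instance
  by standard (transfer; simp add: algebra_simps)+

end

text \<open>Both polynomial rings have their variables indexed by \<open>nat\<close>, and the variable with
  index \<open>n\<close> stands for \<open>v\<^sub>n\<^sub>+\<^sub>1\<close>.\<close>

type_synonym BP = "(nat \<Rightarrow>\<^sub>0 nat) \<Rightarrow>\<^sub>0 z2loc"
type_synonym BPQ = "(nat \<Rightarrow>\<^sub>0 nat) \<Rightarrow>\<^sub>0 rat"

definition BP_to_BPQ :: "BP \<Rightarrow> BPQ" where
  "BP_to_BPQ = Poly_Mapping.map rat_of_z2loc"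

definition v_gen :: "nat \<Rightarrow> BP" where
  "v_gen n = (case n of 0 \<Rightarrow> 2 | Suc m \<Rightarrow> Poly_Mapping.single (Poly_Mapping.single m 1) 1)"

text \<open>The logarithm of the Brown-Peterson formal group law is \<open>\<Sum>\<^sub>n \<ell>\<^sub>n x^(2^n)\<close>, and the
  \<open>v\<^sub>n\<close> are the Hazewinkel generators:
  \<open>\<ell>\<^sub>0 = 1\<close> and \<open>2 \<ell>\<^sub>n = \<Sum>\<^sub>i\<^sub><\<^sub>n \<ell>\<^sub>i v\<^sub>n\<^sub>-\<^sub>i^(2^i)\<close>.\<close>

fun log_coeff :: "nat \<Rightarrow> BPQ" where
  "log_coeff n = (if n = 0 then 1
     else Poly_Mapping.single 0 (1 / 2) * (\<Sum>i<n. log_coeff i * BP_to_BPQ (v_gen (n - i)) ^ (2 ^ i)))"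

declare log_coeff.simps [simp del]

definition BP_log :: "BPQ fps" where
  "BP_log = Abs_fps (\<lambda>m. \<Sum>n | m = 2 ^ n. log_coeff n)"

text \<open>The formal group law is \<open>F(x, y) = log\<^sup>-\<^sup>1 (log x + log y)\<close>, so that \<open>[2](x) = F(x, x)\<close> is the
  series with \<open>log ([2](x)) = 2 log x\<close>. Its coefficients lie in \<open>BP\<close>.\<close>

definition two_series :: "BP fps" where
  "two_series = (THE G. fps_nth G 0 = 0 \<and>
     BP_log oo Abs_fps (\<lambda>n. BP_to_BPQ (fps_nth G n)) = 2 * BP_log)"

definition two_coeff :: "nat \<Rightarrow> BP" where
  "two_coeff j = fps_nth two_series (j + 1)"


section \<open>Free modules and their quotients\<close>

definition free_scale :: "BP \<Rightarrow> ('i \<Rightarrow>\<^sub>0 BP) \<Rightarrow> ('i \<Rightarrow>\<^sub>0 BP)" where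
  "free_scale r = Poly_Mapping.map ((*) r)"

lemma lookup_free_scale [simp]:
  "Poly_Mapping.lookup (free_scale r p) i = r * Poly_Mapping.lookup p i"
  by (simp add: free_scale_def Poly_Mapping.map.rep_eq when_def)

lemma module_free_scale: "module free_scale"
  by unfold_locales (auto intro!: poly_mapping_eqI simp: lookup_add algebra_simps)

abbreviation free_span :: "('i \<Rightarrow>\<^sub>0 BP) set \<Rightarrow> ('i \<Rightarrow>\<^sub>0 BP) set" where
  "free_span \<equiv> module.span free_scale"

definition congruent_mod :: "('i \<Rightarrow>\<^sub>0 BP) set \<Rightarrow> ('i \<Rightarrow>\<^sub>0 BP) \<Rightarrow> ('i \<Rightarrow>\<^sub>0 BP) \<Rightarrow> bool" where
  "congruent_mod S x y \<longleftrightarrow> x - y \<in> free_span S"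

context
  fixes S :: "('i \<Rightarrow>\<^sub>0 BP) set"
begin

interpretation module "free_scale :: BP \<Rightarrow> ('i \<Rightarrow>\<^sub>0 BP) \<Rightarrow> _"
  by (rule module_free_scale)

lemma equivp_congruent_mod: "equivp (congruent_mod S)"
proof (rule equivpI)
  show "reflp (congruent_mod S)"
    by (simp add: reflp_def congruent_mod_def span_zero)
  show "symp (congruent_mod S)"
    unfolding symp_def congruent_mod_def by (metis minus_diff_eq span_neg)
  show "transp (congruent_mod S)"
    unfolding transp_def congruent_mod_def
  proof (intro allI impI)
    fix x y w :: "'i \<Rightarrow>\<^sub>0 BP"
    assume "x - y \<in> free_span S" "y - w \<in> free_span S"
    from span_add[OF this] show "x - w \<in> free_span S" by simp
  qed
qed

lemma congruent_mod_add:
  "congruent_mod S x x' \<Longrightarrow> congruent_mod S y y' \<Longrightarrow> congruent_mod S (x + y) (x' + y')"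
  unfolding congruent_mod_def
  using span_add[of "x - x'" S "y - y'"] by (simp add: algebra_simps)

lemma congruent_mod_diff:
  "congruent_mod S x x' \<Longrightarrow> congruent_mod S y y' \<Longrightarrow> congruent_mod S (x - y) (x' - y')"
  unfolding congruent_mod_def
  using span_diff[of "x - x'" S "y - y'"] by (simp add: algebra_simps)

lemma congruent_mod_minus:
  "congruent_mod S x x' \<Longrightarrow> congruent_mod S (- x) (- x')"
  unfolding congruent_mod_def using span_neg[of "x - x'" S] by simp

lemma congruent_mod_scale:
  "congruent_mod S x x' \<Longrightarrow> congruent_mod S (free_scale r x) (free_scale r x')"
  unfolding congruent_mod_def using span_scale[of "x - x'" S r] by (simp add: scale_right_diff_distrib)

end


section \<open>The Brown-Peterson homology of the classifying space\<close>

definition BZ2_relators :: "(nat \<Rightarrow>\<^sub>0 BP) set" where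
  "BZ2_relators = insert (Poly_Mapping.single 0 1)
     (range (\<lambda>n. \<Sum>j\<le>n. Poly_Mapping.single (n - j) (two_coeff j)))"

quotient_type BP_BZ2 = "nat \<Rightarrow>\<^sub>0 BP" / "congruent_mod BZ2_relators"
  by (rule equivp_congruent_mod)

instantiation BP_BZ2 :: ab_group_add
begin

lift_definition zero_BP_BZ2 :: BP_BZ2 is 0 .
lift_definition plus_BP_BZ2 :: "BP_BZ2 \<Rightarrow> BP_BZ2 \<Rightarrow> BP_BZ2" is "(+)"
  by (rule congruent_mod_add)
lift_definition minus_BP_BZ2 :: "BP_BZ2 \<Rightarrow> BP_BZ2 \<Rightarrow> BP_BZ2" is "(-)"
  by (rule congruent_mod_diff)
lift_definition uminus_BP_BZ2 :: "BP_BZ2 \<Rightarrow> BP_BZ2" is uminus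
  by (rule congruent_mod_minus)

instance
  by standard (transfer; simp add: algebra_simps equivp_reflp[OF equivp_congruent_mod])+

end

lift_definition BZ2_scale :: "BP \<Rightarrow> BP_BZ2 \<Rightarrow> BP_BZ2" is free_scale
  by (rule congruent_mod_scale)

lemma module_BZ2_scale: "module BZ2_scale"
proof -
  interpret F: module "free_scale :: BP \<Rightarrow> (nat \<Rightarrow>\<^sub>0 BP) \<Rightarrow> _"
    by (rule module_free_scale)
  show ?thesis
    by unfold_locales
      (transfer; simp add: F.scale_right_distrib F.scale_left_distrib
        equivp_reflp[OF equivp_congruent_mod])+
qed

text \<open>The generator \<open>z\<^sub>i\<close> for \<open>i \<ge> 1\<close>; the relators force \<open>z\<^sub>0 = 0\<close>.\<close>

lift_definition z_gen :: "nat \<Rightarrow> BP_BZ2" is "\<lambda>i. Poly_Mapping.single i 1" .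


section \<open>The tensor power\<close>

text \<open>The tensor factors, and the variables \<open>x\<^sub>1, \<dots>, x\<^sub>k\<close> below, are indexed by a finite type
  \<open>'k\<close>, so that \<open>k = CARD('k)\<close>.\<close>

definition multilinear_relators :: "(('k \<Rightarrow> BP_BZ2) \<Rightarrow>\<^sub>0 BP) set" where
  "multilinear_relators =
     {Poly_Mapping.single (f(m := x + y)) 1
        - Poly_Mapping.single (f(m := x)) 1 - Poly_Mapping.single (f(m := y)) 1 | f m x y. True}
     \<union> {Poly_Mapping.single (f(m := BZ2_scale r x)) 1
        - Poly_Mapping.single (f(m := x)) r | f m r x. True}"

quotient_type 'k Q = "('k::finite \<Rightarrow> BP_BZ2) \<Rightarrow>\<^sub>0 BP" / "congruent_mod multilinear_relators"
  by (rule equivp_congruent_mod)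

instantiation Q :: (finite) ab_group_add
begin

lift_definition zero_Q :: "'a Q" is 0 .
lift_definition plus_Q :: "'a Q \<Rightarrow> 'a Q \<Rightarrow> 'a Q" is "(+)"
  by (rule congruent_mod_add)
lift_definition minus_Q :: "'a Q \<Rightarrow> 'a Q \<Rightarrow> 'a Q" is "(-)"
  by (rule congruent_mod_diff)
lift_definition uminus_Q :: "'a Q \<Rightarrow> 'a Q" is uminus
  by (rule congruent_mod_minus)

instance
  by standard (transfer; simp add: algebra_simps equivp_reflp[OF equivp_congruent_mod])+

end

lift_definition Q_scale :: "BP \<Rightarrow> 'k::finite Q \<Rightarrow> 'k Q" (infixr \<open>\<bullet>\<close> 75) is free_scale
  by (rule congruent_mod_scale)

lemma module_Q_scale: "module (Q_scale :: BP \<Rightarrow> 'k::finite Q \<Rightarrow> 'k Q)"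
proof -
  interpret F: module "free_scale :: BP \<Rightarrow> (('k \<Rightarrow> BP_BZ2) \<Rightarrow>\<^sub>0 BP) \<Rightarrow> _"
    by (rule module_free_scale)
  show ?thesis
    by unfold_locales
      (transfer; simp add: F.scale_right_distrib F.scale_left_distrib
        equivp_reflp[OF equivp_congruent_mod])+
qed

definition tensor :: "('k::finite \<Rightarrow> BP_BZ2) \<Rightarrow> 'k Q" where
  "tensor f = abs_Q (Poly_Mapping.single f 1)"

definition zI :: "('k::finite \<Rightarrow> nat) \<Rightarrow> 'k Q" where
  "zI I = tensor (\<lambda>m. z_gen (I m))"


section \<open>The filtration and its associated graded groups\<close>

text \<open>\<open>F\<^sub>s = (v\<^sub>0, v\<^sub>1, \<dots>)\<^sup>s Q\<close>, through \<open>I\<^sup>s\<^sup>+\<^sup>1 Q = I (I\<^sup>s Q)\<close>.\<close>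

primrec Filt :: "nat \<Rightarrow> 'k::finite Q set" where
  "Filt 0 = UNIV"
| "Filt (Suc s) = module.span Q_scale {v_gen i \<bullet> x | i x. x \<in> Filt s}"

definition gr_class :: "nat \<Rightarrow> 'k::finite Q \<Rightarrow> 'k Q set" where
  "gr_class s x = {y. y - x \<in> Filt (Suc s)}"

definition gr :: "nat \<Rightarrow> 'k::finite Q set set" where
  "gr s = gr_class s ` Filt s"

text \<open>The map \<open>F\<^sub>s/F\<^sub>s\<^sub>+\<^sub>1 \<rightarrow> F\<^sub>s\<^sub>+\<^sub>1/F\<^sub>s\<^sub>+\<^sub>2\<close> induced by \<open>v\<^sub>j\<close>: it sends the coset of \<open>x\<close> to the
  coset of \<open>v\<^sub>j x\<close>, because \<open>v\<^sub>j F\<^sub>s\<^sub>+\<^sub>1 \<subseteq> F\<^sub>s\<^sub>+\<^sub>2\<close>.\<close>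

definition v_action :: "nat \<Rightarrow> nat \<Rightarrow> 'k::finite Q set \<Rightarrow> 'k Q set" where
  "v_action s j C = {v_gen j \<bullet> x + y | x y. x \<in> C \<and> y \<in> Filt (s + 2)}"


section \<open>Polynomials over the field with two elements\<close>

type_synonym 'k F2poly = "('k \<Rightarrow>\<^sub>0 nat) \<Rightarrow>\<^sub>0 bit"

text \<open>The sum of all distinct monomials whose exponents are, up to order,
  \<open>t\<^sub>1, \<dots>, t\<^sub>r, 0, \<dots>, 0\<close>.\<close>

definition mono_sym :: "nat list \<Rightarrow> 'k::finite F2poly" where
  "mono_sym ts =
     (\<Sum>E | image_mset (Poly_Mapping.lookup E) (mset_set UNIV)
            = mset ts + replicate_mset (CARD('k) - length ts) 0.
        Poly_Mapping.single E 1)"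

definition symmetric_poly :: "'k F2poly \<Rightarrow> bool" where
  "symmetric_poly p \<longleftrightarrow> (\<forall>\<pi>. bij \<pi> \<longrightarrow>
     (\<forall>E. Poly_Mapping.lookup p (Poly_Mapping.map_key \<pi> E) = Poly_Mapping.lookup p E))"

definition p_denominator :: "'k::finite F2poly" where
  "p_denominator = mono_sym (map (\<lambda>i. 2 ^ i) [0..<CARD('k)])"

definition p_numerator :: "nat \<Rightarrow> nat \<Rightarrow> 'k::finite F2poly" where
  "p_numerator l j = mono_sym (map (\<lambda>i. 2 ^ i) (filter (\<lambda>i. i \<noteq> j) [0..<CARD('k)]) @ [2 ^ l])"

definition p_ratio :: "nat \<Rightarrow> nat \<Rightarrow> ('k::{finite,linorder}) F2poly fract" where
  "p_ratio l j = Fract (p_numerator l j) p_denominator"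


section \<open>Multiplication operators\<close>

text \<open>The vector space with basis \<open>Z\<^sub>k\<close> is modelled by formal sums of index tuples with positive
  entries. Subtraction on \<open>nat\<close> is truncated, which sends every negative entry to \<open>0\<close>, and a
  tuple with an entry \<open>0\<close> contributes nothing.\<close>

definition basis_elem :: "('k \<Rightarrow> nat) \<Rightarrow> ('k \<Rightarrow> nat) \<Rightarrow>\<^sub>0 bit" where
  "basis_elem I = (if \<forall>m. I m \<ge> 1 then Poly_Mapping.single I 1 else 0)"

definition poly_act :: "'k F2poly \<Rightarrow> (('k \<Rightarrow> nat) \<Rightarrow>\<^sub>0 bit) \<Rightarrow> (('k \<Rightarrow> nat) \<Rightarrow>\<^sub>0 bit)" where
  "poly_act p w = (\<Sum>E\<in>Poly_Mapping.keys p. \<Sum>I\<in>Poly_Mapping.keys w.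
     basis_elem (\<lambda>m. I m - Poly_Mapping.lookup E m))"

text \<open>A representative in \<open>Q\<close>: the nonzero coefficients of \<open>w\<close> are all \<open>1\<close>.\<close>

definition realize :: "(('k \<Rightarrow> nat) \<Rightarrow>\<^sub>0 bit) \<Rightarrow> 'k::finite Q" where
  "realize w = (\<Sum>I\<in>Poly_Mapping.keys w. zI I)"

text \<open>\<open>\<phi> : F\<^sub>s/F\<^sub>s\<^sub>+\<^sub>1 \<rightarrow> F\<^sub>s\<^sub>+\<^sub>1/F\<^sub>s\<^sub>+\<^sub>2\<close> is multiplication by \<open>\<Sum>\<^sub>\<ell>\<^sub>\<ge>\<^sub>k v\<^sub>\<ell> p\<^sub>\<ell>\<close>, i.e. the linear map
  (additivity suffices over the field with two elements; \<open>C + D\<close> is the sum of cosets) with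
  \<open>v\<^sup>T z\<^sub>I \<mapsto> \<Sum>\<^sub>\<ell>\<^sub>\<ge>\<^sub>k v\<^sub>\<ell> v\<^sup>T (p\<^sub>\<ell> z\<^sub>I)\<close> for all monomials \<open>v\<^sup>T\<close> of degree \<open>s\<close> in
  \<open>v\<^sub>k, v\<^sub>k\<^sub>+\<^sub>1, \<dots>\<close>. A monomial is given by the multiset \<open>T\<close> of its indices. The sum over \<open>\<ell>\<close> is
  restricted to its nonzero terms, and these are required to be finite in number.\<close>

definition is_multiplication ::
    "nat \<Rightarrow> (nat \<Rightarrow> 'k F2poly) \<Rightarrow> ('k::finite Q set \<Rightarrow> 'k Q set) \<Rightarrow> bool" where
  "is_multiplication s p \<phi> \<longleftrightarrow>
     (\<forall>C\<in>gr s. \<phi> C \<in> gr (s + 1)) \<and>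
     (\<forall>C\<in>gr s. \<forall>D\<in>gr s. \<phi> (C + D) = \<phi> C + \<phi> D) \<and>
     (\<forall>T I. size T = s \<and> set_mset T \<subseteq> {CARD('k)..} \<and> (\<forall>m. I m \<ge> 1) \<longrightarrow>
        finite {l. l \<ge> CARD('k) \<and> poly_act (p l) (basis_elem I) \<noteq> 0} \<and>
        \<phi> (gr_class s (prod_mset (image_mset v_gen T) \<bullet> zI I)) =
        gr_class (s + 1)
          (\<Sum>l | l \<ge> CARD('k) \<and> poly_act (p l) (basis_elem I) \<noteq> 0.
             (v_gen l * prod_mset (image_mset v_gen T)) \<bullet> realize (poly_act (p l) (basis_elem I))))"

end

theory Submission
  imports Defs
begin

text \<open>
Write \<open>k = CARD('k)\<close> and let \<open>J = (v\<^sub>0, v\<^sub>1, \<dots>)\<close>. The coefficients of the two-series satisfy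
\<open>two_coeff (2^l - 1) \<equiv> v\<^sub>l\<close> modulo \<open>J\<^sup>2\<close>, and all its other coefficients lie in \<open>J\<^sup>2\<close>. Hence the
relations that define the \<open>m\<close>-th tensor factor say, in \<open>F\<^sub>1/F\<^sub>2\<close>, that \<open>\<Sum>\<^sub>l v\<^sub>l x\<^sub>m^(2^l)\<close> annihilates
every \<open>z\<^sub>I\<close> (\<open>zI_relation_mod_Filt_2\<close>). These are \<open>k\<close> linear equations, one for every variable
\<open>x\<^sub>m\<close>, and they are solved for \<open>v\<^sub>0, \<dots>, v\<^sub>k\<^sub>-\<^sub>1\<close> by Cramer's rule: multiply the equation of \<open>m\<close> by the
cofactor of \<open>x\<^sub>m^(2^j)\<close> in the matrix with entries \<open>x\<^sub>m^(2^i)\<close>, \<open>i < k\<close>, and add over \<open>m\<close>. Signs do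
not matter in characteristic two, so all determinants are sums over bijections. The coefficient of
\<open>v\<^sub>l\<close> becomes the determinant in which column \<open>j\<close> is replaced by the entries \<open>x\<^sub>m^(2^l)\<close>
(\<open>cofactor_expansion\<close>). For \<open>l = j\<close> this is the polynomial \<open>D = p_denominator\<close>, for other \<open>l < k\<close>
there are two equal columns and the result is \<open>0\<close>, and for \<open>l \<ge> k\<close> it is \<open>p_numerator l j\<close>. So
\<open>D v\<^sub>j = \<Sum>\<^sub>l\<^sub>\<ge>\<^sub>k p_numerator l j v\<^sub>l\<close> as operators.

Two facts allow the division by \<open>D\<close>. The numerators are multiples of \<open>D\<close>: the polynomial
\<open>\<Prod>\<^sub>a (T + a)\<close> over all sums \<open>a\<close> of distinct variables involves only the powers \<open>T^(2^i)\<close>, so every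
\<open>x\<^sub>m^(2^l)\<close> is a combination of the \<open>x\<^sub>m^(2^i)\<close> with \<open>i < k\<close>, with the same coefficients for all \<open>m\<close>
(\<open>dickson_relation_higher\<close>); substituting this into column \<open>j\<close> gives
\<open>p_numerator l j = p l j * D\<close>. And \<open>D\<close> acts surjectively on the span of the index tuples, because
its lexicographically least monomial can be inverted up to terms that are smaller in the
lexicographic order (\<open>poly_act_surjective\<close>); so it suffices to know the action of \<open>v\<^sub>j\<close> on elements
\<open>D w\<close>. Symmetry of \<open>p l j\<close> follows from that of the numerator and \<open>D\<close> by cancelling \<open>D\<close>.

The two-series is given by \<open>log (G(x)) = 2 log x\<close>, an equation over the rational polynomial ring.
That \<open>G\<close> has coefficients in \<open>BP\<close> is Hazewinkel's functional equation argument. Let \<open>\<phi>\<close> be the ring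
endomorphism with \<open>v\<^sub>i \<mapsto> v\<^sub>i\<^sup>2\<close> and \<open>x \<mapsto> x\<^sup>2\<close>, which is a lift of Frobenius. Then
\<open>2 log = 2 x + \<Sum>\<^sub>i\<^sub>\<ge>\<^sub>1 v\<^sub>i \<phi>\<^sup>i(log)\<close>, and \<open>G^(2^i)\<close> may be replaced by \<open>\<phi>\<^sup>i(G)\<close> up to integral terms; this
gives \<open>log G - G \<equiv> 2 log x - 2 x\<close> modulo integral series, one coefficient at a time. For the
coefficients modulo \<open>J\<^sup>2\<close>, rescale by \<open>v\<^sub>i \<mapsto> 2 v\<^sub>i\<close>. This turns \<open>log\<close> into an integral series with
coefficient \<open>\<equiv> v\<^sub>n\<close> modulo \<open>2\<close> at \<open>x^(2^n)\<close> for \<open>n \<ge> 1\<close>, and turns membership in \<open>J\<^sup>2\<close> into divisibility by \<open>4\<close>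
(\<open>rescale_two_coeff\<close>, \<open>rescale_four_dvd_induct\<close>).
\<close>

section \<open>Homomorphisms out of monomial rings\<close>

locale ring_morphism =
  fixes h :: "'a::comm_ring_1 \<Rightarrow> 'b::comm_ring_1"
  assumes hom_add: "h (x + y) = h x + h y"
    and hom_mult: "h (x * y) = h x * h y"
    and hom_one: "h 1 = 1"
begin

lemma hom_zero: "h 0 = 0"
  using hom_add[of 0 0] by simp

lemma hom_minus: "h (- x) = - h x"
  using hom_add[of x "- x"] hom_zero by (simp add: eq_neg_iff_add_eq_0 add.commute)

lemma hom_diff: "h (x - y) = h x - h y"
  using hom_add[of x "- y"] by (simp add: hom_minus)

lemma hom_sum: "h (sum g A) = (\<Sum>a\<in>A. h (g a))"
  by (induction A rule: infinite_finite_induct) (simp_all add: hom_zero hom_add)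

lemma hom_power: "h (x ^ n) = h x ^ n"
  by (induction n) (simp_all add: hom_one hom_mult)

lemma hom_of_nat: "h (of_nat n) = of_nat n"
  by (induction n) (simp_all add: hom_zero hom_one hom_add)

lemma hom_numeral: "h (numeral n) = numeral n"
  using hom_of_nat[of "numeral n"] by simp

end

lemma ring_morphism_comp: "ring_morphism g \<Longrightarrow> ring_morphism h \<Longrightarrow> ring_morphism (g \<circ> h)"
  by (simp add: ring_morphism_def)

lemma ring_morphism_funpow: "ring_morphism (h :: 'a::comm_ring_1 \<Rightarrow> 'a) \<Longrightarrow> ring_morphism (h ^^ n)"
  by (induction n) (auto intro: ring_morphism_comp ring_morphism.intro)

lemma poly_mapping_sum_single:
  "(p :: 'a \<Rightarrow>\<^sub>0 'b::comm_monoid_add)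
     = (\<Sum>k\<in>Poly_Mapping.keys p. Poly_Mapping.single k (Poly_Mapping.lookup p k))"
proof (rule poly_mapping_eqI)
  fix i
  have "(\<Sum>k\<in>Poly_Mapping.keys p.
      Poly_Mapping.lookup (Poly_Mapping.single k (Poly_Mapping.lookup p k)) i)
    = (\<Sum>k\<in>Poly_Mapping.keys p. if k = i then Poly_Mapping.lookup p k else 0)"
    by (rule sum.cong) (auto simp: lookup_single when_def)
  also have "\<dots> = Poly_Mapping.lookup p i"
    by (auto simp: in_keys_iff)
  finally show "Poly_Mapping.lookup p i = Poly_Mapping.lookup
    (\<Sum>k\<in>Poly_Mapping.keys p. Poly_Mapping.single k (Poly_Mapping.lookup p k)) i"
    by (simp add: lookup_sum)
qed

lemma poly_mapping_additive_induct [case_names zero single add]: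
  fixes p :: "'a \<Rightarrow>\<^sub>0 'b::comm_monoid_add"
  assumes "P 0" "\<And>k c. P (Poly_Mapping.single k c)" "\<And>p q. P p \<Longrightarrow> P q \<Longrightarrow> P (p + q)"
  shows "P p"
proof -
  have "P (\<Sum>k\<in>A. Poly_Mapping.single k (Poly_Mapping.lookup p k))" for A
    by (induction A rule: infinite_finite_induct) (auto intro: assms)
  then show ?thesis using poly_mapping_sum_single[of p] by metis
qed

text \<open>All ring homomorphisms used below, and also the bilinear action of polynomials on index tuples, are
given by their values on monomials; this is the additive extension of such a prescription.\<close>

definition monomial_ext :: "('a \<Rightarrow> 'b::zero \<Rightarrow> 'c::comm_monoid_add) \<Rightarrow> ('a \<Rightarrow>\<^sub>0 'b) \<Rightarrow> 'c" where
  "monomial_ext f p = (\<Sum>k\<in>Poly_Mapping.keys p. f k (Poly_Mapping.lookup p k))"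

lemma monomial_ext_single:
  "f k 0 = 0 \<Longrightarrow> monomial_ext f (Poly_Mapping.single k c) = f k c"
  by (cases "c = 0") (simp_all add: monomial_ext_def)

lemma monomial_ext_add:
  assumes "\<And>k. f k 0 = 0" "\<And>k a b. f k (a + b) = f k a + f k b"
  shows "monomial_ext f (p + q) = monomial_ext f p + monomial_ext f q"
  unfolding monomial_ext_def by (rule setsum_keys_plus_distrib) (use assms in auto)

lemma ring_morphism_monomial_ext:
  fixes f :: "'a::comm_monoid_add \<Rightarrow> 'b::comm_ring_1 \<Rightarrow> 'c::comm_ring_1"
  assumes add: "\<And>k a b. f k (a + b) = f k a + f k b"
    and mult: "\<And>k l a b. f (k + l) (a * b) = f k a * f l b"
    and one: "f 0 1 = 1"
  shows "ring_morphism (monomial_ext f)"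
proof
  have zero: "f k 0 = 0" for k using add[of k 0 0] by simp
  show ext_add: "monomial_ext f (p + q) = monomial_ext f p + monomial_ext f q" for p q
    by (rule monomial_ext_add) (use zero add in auto)
  show "monomial_ext f 1 = 1"
    using monomial_ext_single[of f 0 1] zero one by simp
  show "monomial_ext f (p * q) = monomial_ext f p * monomial_ext f q" for p q
  proof (induction p rule: poly_mapping_additive_induct)
    case zero
    then show ?case by (simp add: monomial_ext_def)
  next
    case (single k c)
    show ?case
    proof (induction q rule: poly_mapping_additive_induct)
      case zero
      then show ?case by (simp add: monomial_ext_def)
    next
      case (single l d)
      then show ?case by (simp add: mult_single monomial_ext_single zero mult)
    next
      case (add p q)
      then show ?case by (simp add: distrib_left ext_add)
    qed
  next
    case (add p q)
    then show ?case by (simp add: distrib_right ext_add)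
  qed
qed

section \<open>Integral elements, the Frobenius lift and the rescaling\<close>

lemma rat_of_z2loc_1: "rat_of_z2loc 1 = 1" and rat_of_z2loc_0: "rat_of_z2loc 0 = 0"
  and rat_of_z2loc_add: "rat_of_z2loc (a + b) = rat_of_z2loc a + rat_of_z2loc b"
  and rat_of_z2loc_mult: "rat_of_z2loc (a * b) = rat_of_z2loc a * rat_of_z2loc b"
  by (simp_all add: one_z2loc.rep_eq zero_z2loc.rep_eq plus_z2loc.rep_eq times_z2loc.rep_eq)

lemma lookup_BP_to_BPQ:
  "Poly_Mapping.lookup (BP_to_BPQ p) E = rat_of_z2loc (Poly_Mapping.lookup p E)"
  by (simp add: BP_to_BPQ_def Poly_Mapping.map.rep_eq when_def rat_of_z2loc_0)

lemma BP_to_BPQ_single: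
  "BP_to_BPQ (Poly_Mapping.single E c) = Poly_Mapping.single E (rat_of_z2loc c)"
  by (rule poly_mapping_eqI) (simp add: lookup_BP_to_BPQ lookup_single when_def rat_of_z2loc_0)

lemma inj_BP_to_BPQ: "inj BP_to_BPQ"
  by (rule injI, rule poly_mapping_eqI) (metis lookup_BP_to_BPQ rat_of_z2loc_inject)

lemma BP_to_BPQ_eq_iff: "BP_to_BPQ p = BP_to_BPQ q \<longleftrightarrow> p = q"
  using inj_BP_to_BPQ by (simp add: inj_eq)

interpretation BPQ: ring_morphism BP_to_BPQ
proof -
  have add: "BP_to_BPQ (p + q) = BP_to_BPQ p + BP_to_BPQ q" for p q
    by (rule poly_mapping_eqI) (simp add: lookup_BP_to_BPQ lookup_add rat_of_z2loc_add)
  have eq: "BP_to_BPQ = monomial_ext (\<lambda>E c. Poly_Mapping.single E (rat_of_z2loc c))"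
  proof
    fix p show "BP_to_BPQ p = monomial_ext (\<lambda>E c. Poly_Mapping.single E (rat_of_z2loc c)) p"
    proof (induction p rule: poly_mapping_additive_induct)
      case zero
      then show ?case using BP_to_BPQ_single[of 0 0] by (simp add: monomial_ext_def rat_of_z2loc_0)
    next
      case (single k c)
      then show ?case by (simp add: BP_to_BPQ_single monomial_ext_single rat_of_z2loc_0)
    next
      case (add p q)
      then show ?case
        by (simp add: \<open>\<And>q p. BP_to_BPQ (p + q) = BP_to_BPQ p + BP_to_BPQ q\<close>
            monomial_ext_add rat_of_z2loc_0 rat_of_z2loc_add single_add)
    qed
  qed
  show "ring_morphism BP_to_BPQ"
    unfolding eq
    by (rule ring_morphism_monomial_ext)
      (simp_all add: rat_of_z2loc_add rat_of_z2loc_mult rat_of_z2loc_1 single_add mult_single)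
qed

text \<open>For \<open>c = a / b\<close> the difference is \<open>a (a - b) / b\<^sup>2\<close>, whose numerator is even because \<open>b\<close> is odd.\<close>

lemma two_dvd_square_diff_z2loc: "2 dvd (c::z2loc)\<^sup>2 - c"
proof -
  from rat_of_z2loc[of c] obtain a b :: int where ab: "odd b" "rat_of_z2loc c = of_int a / of_int b"
    by blast
  then have b0: "b \<noteq> 0" by auto
  from ab have "even (a * (a - b))" by simp
  then obtain d where d: "a * (a - b) = 2 * d" by (rule evenE)
  define e where "e = z2loc_of_rat (of_int d / of_int (b * b))"
  have e: "rat_of_z2loc e = of_int d / of_int (b * b)"
    unfolding e_def
    by (rule z2loc_of_rat_inverse, rule CollectI, rule exI[of _ d], rule exI[of _ "b * b"])
      (use ab in simp)
  have d': "(of_int a * (of_int a - of_int b) :: rat) = 2 * of_int d"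
    using d by (metis of_int_diff of_int_mult of_int_numeral)
  have two: "rat_of_z2loc 2 = 2"
    using rat_of_z2loc_add[of 1 1] by (simp add: rat_of_z2loc_1)
  have "rat_of_z2loc (c\<^sup>2 - c) = rat_of_z2loc (2 * e)"
    using b0 d'
    by (simp add: power2_eq_square minus_z2loc.rep_eq times_z2loc.rep_eq two ab e field_simps)
  then show ?thesis by (metis rat_of_z2loc_inject dvd_triv_left)
qed

type_synonym 'c vpoly = "(nat \<Rightarrow>\<^sub>0 nat) \<Rightarrow>\<^sub>0 'c"

text \<open>The endomorphism \<open>v\<^sub>i \<mapsto> v\<^sub>i\<^sup>2\<close>; the coefficient ring is a parameter because it is used on \<open>BP\<close> and on
its rationalization.\<close>

definition frob :: "'c::comm_ring_1 vpoly \<Rightarrow> 'c vpoly" where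
  "frob = monomial_ext (\<lambda>E c. Poly_Mapping.single (E + E) c)"

definition mono_deg :: "(nat \<Rightarrow>\<^sub>0 nat) \<Rightarrow> nat" where
  "mono_deg = monomial_ext (\<lambda>_ e. e)"

text \<open>The endomorphism \<open>v\<^sub>i \<mapsto> 2 v\<^sub>i\<close>. An element of \<open>BP\<close> lies in \<open>(2, v\<^sub>1, v\<^sub>2, \<dots>)\<^sup>d\<close> exactly when its image is
divisible by \<open>2\<^sup>d\<close>, so that the filtration by powers of this ideal becomes the \<open>2\<close>-adic one.\<close>

definition rescale :: "'c::comm_ring_1 vpoly \<Rightarrow> 'c vpoly" where
  "rescale = monomial_ext (\<lambda>E c. Poly_Mapping.single E (2 ^ mono_deg E * c))"

lemma mono_deg_add: "mono_deg (E + F) = mono_deg E + mono_deg F"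
  and mono_deg_0: "mono_deg 0 = 0"
  and mono_deg_single: "mono_deg (Poly_Mapping.single m e) = e"
  by (simp_all add: mono_deg_def monomial_ext_add monomial_ext_single)
    (simp add: monomial_ext_def)

interpretation frob: ring_morphism "frob :: 'c::comm_ring_1 vpoly \<Rightarrow> 'c vpoly"
  unfolding frob_def
  by (rule ring_morphism_monomial_ext) (simp_all add: single_add mult_single algebra_simps)

interpretation frob_funpow: ring_morphism "(frob :: 'c::comm_ring_1 vpoly \<Rightarrow> 'c vpoly) ^^ i" for i
  by (rule ring_morphism_funpow) (rule frob.ring_morphism_axioms)

interpretation rescale: ring_morphism "rescale :: 'c::comm_ring_1 vpoly \<Rightarrow> 'c vpoly"
  unfolding rescale_def
  by (rule ring_morphism_monomial_ext)
    (simp_all add: single_add mult_single mono_deg_add mono_deg_0 algebra_simps power_add)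

lemma frob_single: "frob (Poly_Mapping.single E c) = Poly_Mapping.single (E + E) c"
  by (simp add: frob_def monomial_ext_single)

lemma rescale_single:
  "rescale (Poly_Mapping.single E c) = Poly_Mapping.single E (2 ^ mono_deg E * c)"
  by (simp add: rescale_def monomial_ext_single)

lemma BP_to_BPQ_frob: "BP_to_BPQ (frob p) = frob (BP_to_BPQ p)"
  by (induction p rule: poly_mapping_additive_induct)
    (simp_all add: BPQ.hom_zero frob.hom_zero frob_single BP_to_BPQ_single BPQ.hom_add frob.hom_add)

interpretation z2loc: ring_morphism rat_of_z2loc
  by standard (simp_all add: rat_of_z2loc_add rat_of_z2loc_mult rat_of_z2loc_1)

lemma BP_to_BPQ_rescale: "BP_to_BPQ (rescale p) = rescale (BP_to_BPQ p)"
  by (induction p rule: poly_mapping_additive_induct)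
    (simp_all add: BPQ.hom_zero rescale.hom_zero rescale_single BP_to_BPQ_single BPQ.hom_add
      rescale.hom_add z2loc.hom_mult z2loc.hom_power z2loc.hom_numeral)

lemma lookup_rescale:
  "Poly_Mapping.lookup (rescale p) E = 2 ^ mono_deg E * Poly_Mapping.lookup p E"
  by (induction p rule: poly_mapping_additive_induct)
    (simp_all add: rescale.hom_zero rescale.hom_add rescale_single lookup_single when_def
      lookup_add algebra_simps)

text \<open>Squaring is additive modulo \<open>2\<close>, so it is enough to look at one monomial, where only the
coefficient matters.\<close>

lemma frob_cong_square: "2 dvd frob (p::BP) - p\<^sup>2"
proof (induction p rule: poly_mapping_additive_induct)
  case zero
  then show ?case by (simp add: frob.hom_zero)
next
  case (single E c)
  from two_dvd_square_diff_z2loc[of c] obtain d where d: "c\<^sup>2 - c = 2 * d" by (rule dvdE)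
  have "frob (Poly_Mapping.single E c) - (Poly_Mapping.single E c)\<^sup>2 =
    - Poly_Mapping.single (E + E) (c\<^sup>2 - c)"
    unfolding frob_single power2_eq_square mult_single single_diff by simp
  also have "\<dots> = 2 * (- Poly_Mapping.single (E + E) d)"
    unfolding d mult_2 single_add by simp
  finally show ?case by (metis dvd_triv_left)
next
  case (add p q)
  have "frob (p + q) - (p + q)\<^sup>2 = (frob p - p\<^sup>2) + (frob q - q\<^sup>2) + 2 * (- (p * q))"
    by (simp add: frob.hom_add power2_eq_square algebra_simps)
  then show ?case using add by (simp only:) (intro dvd_add dvd_triv_left)
qed

lemma frob_v_gen: "n \<ge> 1 \<Longrightarrow> frob (v_gen n) = (v_gen n)\<^sup>2"
  by (cases n) (simp_all add: v_gen_def frob_single power2_eq_square mult_single)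

lemma rescale_v_gen: "n \<ge> 1 \<Longrightarrow> rescale (v_gen n) = 2 * v_gen n"
  by (cases n) (simp_all add: v_gen_def rescale_single mono_deg_single mult_2 flip: single_add)

lemma frob_funpow_v_gen: "n \<ge> 1 \<Longrightarrow> (frob ^^ i) (v_gen n) = v_gen n ^ (2 ^ i)"
  by (induction i) (simp_all add: frob.hom_power frob_v_gen mult.commute flip: power_mult)

lemma BP_to_BPQ_frob_funpow: "BP_to_BPQ ((frob ^^ i) p) = (frob ^^ i) (BP_to_BPQ p)"
  by (induction i) (simp_all add: BP_to_BPQ_frob)

section \<open>The logarithm\<close>

lemma BPQ_two_cancel: "2 * (a::BPQ) = 2 * b \<Longrightarrow> a = b"
proof -
  assume *: "2 * a = 2 * b"
  have "Poly_Mapping.single 0 (1/2) * (2::BPQ) = 1"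
    unfolding single_numeral[symmetric] mult_single by simp
  moreover have "Poly_Mapping.single 0 (1/2) * (2 * a) = Poly_Mapping.single 0 (1/2) * (2 * b)"
    using * by simp
  ultimately show "a = b" by (simp only: mult.assoc[symmetric] mult_1)
qed

lemma log_coeff_0: "log_coeff 0 = 1"
  by (simp add: log_coeff.simps[of 0])

lemma log_coeff_rec:
  assumes "n \<ge> 1"
  shows "2 * log_coeff n = (\<Sum>i<n. log_coeff i * BP_to_BPQ (v_gen (n - i)) ^ (2 ^ i))"
proof -
  have "2 * (Poly_Mapping.single 0 (1/2) :: BPQ) = 1"
    unfolding single_numeral[symmetric] mult_single by simp
  then show ?thesis
    using assms by (subst log_coeff.simps) (simp add: mult.assoc[symmetric])
qed

text \<open>Both recursions express \<open>log_coeff n\<close> as the sum over all compositions \<open>n = i\<^sub>1 + \<dots> + i\<^sub>r\<close> of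
\<open>v\<^sub>i\<^sub>1 v\<^sub>i\<^sub>2^(2^i\<^sub>1) \<cdots> / 2\<^sup>r\<close>: the defining one splits off the last part, this one the first part.\<close>

lemma log_coeff_left_rec:
  assumes "n \<ge> 1"
  shows "2 * log_coeff n = (\<Sum>i=1..n. BP_to_BPQ (v_gen i) * (frob ^^ i) (log_coeff (n - i)))"
  using assms
proof (induction n rule: less_induct)
  case (less n)
  define V where "V i = BP_to_BPQ (v_gen i)" for i
  have V: "(frob ^^ a) (V i ^ (2 ^ b)) = V i ^ (2 ^ (a + b))" if "i \<ge> 1" for a b i
  proof -
    have "(frob ^^ a) (V i) = V i ^ (2 ^ a)"
      unfolding V_def BP_to_BPQ_frob_funpow[symmetric] frob_funpow_v_gen[OF that] BPQ.hom_power ..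
    then show ?thesis unfolding frob_funpow.hom_power power_add power_mult by simp
  qed
  \<comment> \<open>Apply the induction hypothesis to \<open>2 * log_coeff i\<close>, exchange the two sums, and recognize the
    inner sum as the defining recursion for \<open>n - a\<close>.\<close>
  have "(\<Sum>i=1..<n. 2 * log_coeff i * V (n - i) ^ (2 ^ i))
    = (\<Sum>i\<in>{1..<n}. \<Sum>a | a \<in> {1..<n} \<and> a \<le> i.
        V a * (frob ^^ a) (log_coeff (i - a) * V (n - i) ^ (2 ^ (i - a))))"
  proof (rule sum.cong)
    fix i assume i: "i \<in> {1..<n}"
    then have "2 * log_coeff i = (\<Sum>a=1..i. V a * (frob ^^ a) (log_coeff (i - a)))"
      using less.IH[of i] by (simp add: V_def)
    then have "2 * log_coeff i * V (n - i) ^ (2 ^ i)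
      = (\<Sum>a=1..i. V a * (frob ^^ a) (log_coeff (i - a)) * V (n - i) ^ (2 ^ i))"
      by (simp add: sum_distrib_right)
    also have "\<dots> = (\<Sum>a=1..i. V a * (frob ^^ a) (log_coeff (i - a) * V (n - i) ^ (2 ^ (i - a))))"
    proof (rule sum.cong)
      fix a assume a: "a \<in> {1..i}"
      have "(frob ^^ a) (V (n - i) ^ (2 ^ (i - a))) = V (n - i) ^ (2 ^ i)"
        using V[of "n - i" a "i - a"] i a by simp
      then show "V a * (frob ^^ a) (log_coeff (i - a)) * V (n - i) ^ (2 ^ i)
        = V a * (frob ^^ a) (log_coeff (i - a) * V (n - i) ^ (2 ^ (i - a)))"
        by (simp add: frob_funpow.hom_mult mult.assoc)
    qed simp
    also have "{1..i} = {a. a \<in> {1..<n} \<and> a \<le> i}" using i by auto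
    finally show "2 * log_coeff i * V (n - i) ^ (2 ^ i) = (\<Sum>a | a \<in> {1..<n} \<and> a \<le> i.
        V a * (frob ^^ a) (log_coeff (i - a) * V (n - i) ^ (2 ^ (i - a))))" .
  qed simp
  also have "\<dots> = (\<Sum>a\<in>{1..<n}. \<Sum>i | i \<in> {1..<n} \<and> a \<le> i.
        V a * (frob ^^ a) (log_coeff (i - a) * V (n - i) ^ (2 ^ (i - a))))"
    by (rule sum.swap_restrict) simp_all
  also have "\<dots> = (\<Sum>a\<in>{1..<n}. 2 * (V a * (frob ^^ a) (log_coeff (n - a))))"
  proof (rule sum.cong[OF refl])
    fix a assume a: "a \<in> {1..<n}"
    have "2 * log_coeff (n - a) = (\<Sum>b<n - a. log_coeff b * V (n - a - b) ^ (2 ^ b))"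
      unfolding V_def by (rule log_coeff_rec) (use a in auto)
    also have "\<dots> = (\<Sum>i | i \<in> {1..<n} \<and> a \<le> i. log_coeff (i - a) * V (n - i) ^ (2 ^ (i - a)))"
      by (rule sum.reindex_bij_witness[of _ "\<lambda>i. i - a" "\<lambda>b. b + a"])
        (use a in \<open>auto simp: add.commute\<close>)
    finally have "(frob ^^ a) (2 * log_coeff (n - a)) = (frob ^^ a) (\<Sum>i | i \<in> {1..<n} \<and> a \<le> i.
        log_coeff (i - a) * V (n - i) ^ (2 ^ (i - a)))"
      by (rule arg_cong)
    then have "2 * (frob ^^ a) (log_coeff (n - a)) = (\<Sum>i | i \<in> {1..<n} \<and> a \<le> i.
        (frob ^^ a) (log_coeff (i - a) * V (n - i) ^ (2 ^ (i - a))))"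
      by (simp only: frob_funpow.hom_mult[where x = 2] frob_funpow.hom_numeral frob_funpow.hom_sum)
    then show "(\<Sum>i | i \<in> {1..<n} \<and> a \<le> i.
        V a * (frob ^^ a) (log_coeff (i - a) * V (n - i) ^ (2 ^ (i - a))))
      = 2 * (V a * (frob ^^ a) (log_coeff (n - a)))"
      by (simp only: sum_distrib_left[symmetric] mult.left_commute)
  qed
  finally have inner: "(\<Sum>i=1..<n. 2 * log_coeff i * V (n - i) ^ (2 ^ i))
    = (\<Sum>a\<in>{1..<n}. 2 * (V a * (frob ^^ a) (log_coeff (n - a))))" .
  have "2 * (2 * log_coeff n) = (\<Sum>i<n. 2 * log_coeff i * V (n - i) ^ (2 ^ i))"
    using log_coeff_rec[OF less.prems]
    by (simp add: sum_distrib_left V_def mult.assoc)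
  also have "\<dots> = 2 * V n + (\<Sum>i=1..<n. 2 * log_coeff i * V (n - i) ^ (2 ^ i))"
    using less.prems
    by (simp add: lessThan_atLeast0 sum.atLeast_Suc_lessThan log_coeff_0)
  also have "\<dots> = 2 * (\<Sum>i=1..n. V i * (frob ^^ i) (log_coeff (n - i)))"
  proof -
    have "{1..n} = insert n {1..<n}" using less.prems by auto
    then have "(\<Sum>i=1..n. V i * (frob ^^ i) (log_coeff (n - i)))
      = V n + (\<Sum>i=1..<n. V i * (frob ^^ i) (log_coeff (n - i)))"
      by (simp add: log_coeff_0 frob_funpow.hom_one)
    then show ?thesis by (simp only: inner sum_distrib_left distrib_left)
  qed
  finally show ?case unfolding V_def by (rule BPQ_two_cancel)
qed

text \<open>The denominators of the logarithm grow slowly enough to be absorbed by the congruences modulo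
\<open>2^(k+1)\<close> between \<open>2^k\<close>-th powers.\<close>

lemma two_power_log_coeff_integral: "\<exists>L. BP_to_BPQ L = 2 ^ n * log_coeff n"
proof (induction n rule: less_induct)
  case (less n)
  show ?case
  proof (cases "n = 0")
    case True
    then show ?thesis by (metis BPQ.hom_one log_coeff_0 mult_1 power_0)
  next
    case False
    from less obtain L where L: "\<And>i. i < n \<Longrightarrow> BP_to_BPQ (L i) = 2 ^ i * log_coeff i" by metis
    have "2 ^ n * log_coeff n = 2 ^ (n - 1) * (2 * log_coeff n)"
      using False by (cases n) (simp_all add: mult.assoc mult.left_commute)
    also have "\<dots> = (\<Sum>i<n. 2 ^ (n - 1) * log_coeff i * BP_to_BPQ (v_gen (n - i)) ^ (2 ^ i))"
      using False by (simp add: log_coeff_rec sum_distrib_left mult.assoc)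
    also have "\<dots> = (\<Sum>i<n. BP_to_BPQ (2 ^ (n - 1 - i) * L i * v_gen (n - i) ^ (2 ^ i)))"
    proof (rule sum.cong)
      fix i assume i: "i \<in> {..<n}"
      then have "(2::BPQ) ^ (n - 1) = 2 ^ (n - 1 - i) * 2 ^ i"
        by (simp flip: power_add)
      then show "2 ^ (n - 1) * log_coeff i * BP_to_BPQ (v_gen (n - i)) ^ (2 ^ i)
        = BP_to_BPQ (2 ^ (n - 1 - i) * L i * v_gen (n - i) ^ (2 ^ i))"
        using L[of i] i by (simp add: BPQ.hom_mult BPQ.hom_power BPQ.hom_numeral mult.assoc)
    qed simp
    also have "\<dots> = BP_to_BPQ (\<Sum>i<n. 2 ^ (n - 1 - i) * L i * v_gen (n - i) ^ (2 ^ i))"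
      by (rule BPQ.hom_sum[symmetric])
    finally show ?thesis by - (rule exI, erule sym)
  qed
qed

text \<open>After rescaling, the term of index \<open>i\<close> in the recursion contains the factor \<open>2^(2^i)\<close>; halving it
leaves an integer, which is even for all \<open>i \<ge> 1\<close>. Only the term \<open>v\<^sub>n\<close> of index \<open>0\<close> survives modulo \<open>2\<close>.\<close>

lemma rescale_log_coeff:
  "\<exists>M. BP_to_BPQ M = rescale (log_coeff n) \<and> (n \<ge> 1 \<longrightarrow> 2 dvd M - v_gen n)"
proof (induction n rule: less_induct)
  case (less n)
  show ?case
  proof (cases "n = 0")
    case True
    then show ?thesis by (metis BPQ.hom_one log_coeff_0 rescale.hom_one not_one_le_zero)
  next
    case False
    from less obtain M where M: "\<And>i. i < n \<Longrightarrow> BP_to_BPQ (M i) = rescale (log_coeff i)" by metis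
    \<comment> \<open>The term of index \<open>i \<ge> 1\<close>, divided by \<open>2\<close>.\<close>
    define d where "d i = 2 * (M i * 2 ^ (2 ^ i - 2) * v_gen (n - i) ^ (2 ^ i))" for i
    have "2 * rescale (log_coeff n)
      = (\<Sum>i<n. rescale (log_coeff i) * (2 * BP_to_BPQ (v_gen (n - i))) ^ (2 ^ i))"
    proof -
      have "2 * rescale (log_coeff n) = rescale (2 * log_coeff n)"
        by (simp add: rescale.hom_mult rescale.hom_numeral)
      also have "\<dots> = (\<Sum>i<n. rescale (log_coeff i) * (rescale (BP_to_BPQ (v_gen (n - i)))) ^ (2 ^ i))"
        using False by (simp add: log_coeff_rec rescale.hom_sum rescale.hom_mult rescale.hom_power)
      also have "\<dots> = (\<Sum>i<n. rescale (log_coeff i) * (2 * BP_to_BPQ (v_gen (n - i))) ^ (2 ^ i))"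
        by (rule sum.cong)
          (simp_all add: BPQ.hom_mult BPQ.hom_numeral rescale_v_gen flip: BP_to_BPQ_rescale)
      finally show ?thesis .
    qed
    also have "\<dots> = 2 * BP_to_BPQ (v_gen n)
        + (\<Sum>i=1..<n. rescale (log_coeff i) * (2 * BP_to_BPQ (v_gen (n - i))) ^ (2 ^ i))"
      using False
      by (simp add: lessThan_atLeast0 sum.atLeast_Suc_lessThan log_coeff_0 rescale.hom_one)
    also have "(\<Sum>i=1..<n. rescale (log_coeff i) * (2 * BP_to_BPQ (v_gen (n - i))) ^ (2 ^ i))
      = (\<Sum>i=1..<n. 2 * BP_to_BPQ (d i))"
    proof (rule sum.cong)
      fix i assume i: "i \<in> {1..<n}"
      then have "(2::nat) ^ 1 \<le> 2 ^ i" by (intro power_increasing) auto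
      then have "(2::nat) ^ i = Suc (Suc (2 ^ i - 2))" by simp
      then have "(2::BPQ) ^ (2 ^ i) = 2 * (2 * 2 ^ (2 ^ i - 2))"
        by (metis power_Suc)
      then show "rescale (log_coeff i) * (2 * BP_to_BPQ (v_gen (n - i))) ^ (2 ^ i) = 2 * BP_to_BPQ (d i)"
        using M[of i] i
        by (simp add: d_def BPQ.hom_mult BPQ.hom_power BPQ.hom_numeral power_mult_distrib mult_ac)
    qed simp
    also have "2 * BP_to_BPQ (v_gen n) + \<dots> = 2 * BP_to_BPQ (v_gen n + (\<Sum>i=1..<n. d i))"
      by (simp add: BPQ.hom_add BPQ.hom_sum sum_distrib_left distrib_left)
    finally have "rescale (log_coeff n) = BP_to_BPQ (v_gen n + (\<Sum>i=1..<n. d i))"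
      by (rule BPQ_two_cancel)
    moreover have "2 dvd (\<Sum>i=1..<n. d i)" by (rule dvd_sum) (simp add: d_def)
    ultimately show ?thesis by (intro exI[of _ "v_gen n + (\<Sum>i=1..<n. d i)"]) simp
  qed
qed

section \<open>The Frobenius lift on power series\<close>

lemma dvd_power_two_power_diff:
  fixes a b :: "'a::comm_ring_1"
  assumes "2 dvd a - b"
  shows "2 ^ Suc k dvd a ^ (2 ^ k) - b ^ (2 ^ k)"
proof (induction k)
  case 0
  then show ?case using assms by simp
next
  case (Suc k)
  define u w where "u = a ^ (2 ^ k)" and "w = b ^ (2 ^ k)"
  from Suc obtain c where c: "u - w = 2 ^ Suc k * c" unfolding u_def w_def by (rule dvdE)
  have "a ^ (2 ^ Suc k) - b ^ (2 ^ Suc k) = u\<^sup>2 - w\<^sup>2"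
    unfolding u_def w_def power_Suc2 power_mult ..
  also have "\<dots> = (u - w) * ((u - w) + 2 * w)"
    by (simp add: power2_eq_square algebra_simps)
  also have "\<dots> = 2 ^ Suc (Suc k) * (c * (2 ^ k * c + w))"
    unfolding c by (simp add: algebra_simps)
  finally show ?case by (metis dvd_triv_left)
qed

definition fps_map :: "('a \<Rightarrow> 'b) \<Rightarrow> 'a fps \<Rightarrow> 'b fps" where
  "fps_map h f = Abs_fps (\<lambda>n. h (fps_nth f n))"

lemma fps_map_nth: "fps_nth (fps_map h f) n = h (fps_nth f n)"
  by (simp add: fps_map_def)

lemma ring_morphism_fps_map:
  assumes "ring_morphism h" shows "ring_morphism (fps_map h)"
proof -
  interpret ring_morphism h by (rule assms)
  show ?thesis
    by standard
      (auto intro!: fps_ext simp: fps_map_nth fps_mult_nth hom_add hom_mult hom_sum hom_one hom_zero)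
qed

text \<open>The Frobenius lift \<open>f(x) \<mapsto> (frob f)(x\<^sup>2)\<close> on power series.\<close>

definition fps_frob :: "BP fps \<Rightarrow> BP fps" where
  "fps_frob f = Abs_fps (\<lambda>n. if even n then frob (fps_nth f (n div 2)) else 0)"

lemma fps_frob_nth:
  "fps_nth (fps_frob f) n = (if even n then frob (fps_nth f (n div 2)) else 0)"
  by (simp add: fps_frob_def)

lemma fps_frob_funpow_nth:
  "fps_nth ((fps_frob ^^ i) f) n = (if 2 ^ i dvd n then (frob ^^ i) (fps_nth f (n div 2 ^ i)) else 0)"
proof (induction i arbitrary: n)
  case 0
  then show ?case by simp
next
  case (Suc i)
  have eq: "2 ^ Suc i dvd n \<longleftrightarrow> even n \<and> 2 ^ i dvd n div 2"
    by (auto elim!: evenE dvdE simp: dvd_def mult.assoc mult.left_commute)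
  show ?case
    unfolding eq by (simp add: fps_frob_nth Suc frob.hom_zero div_mult2_eq)
qed

lemma fps_two_dvd_iff: "2 dvd (f::'a::comm_ring_1 fps) \<longleftrightarrow> (\<forall>n. 2 dvd fps_nth f n)"
proof
  assume "2 dvd f"
  then show "\<forall>n. 2 dvd fps_nth f n"
    by (auto elim!: dvdE simp: fps_numeral_fps_const)
next
  assume "\<forall>n. 2 dvd fps_nth f n"
  then obtain g where "\<And>n. fps_nth f n = 2 * g n" unfolding dvd_def by metis
  then have "f = 2 * Abs_fps g" by (intro fps_ext) (simp add: fps_numeral_fps_const)
  then show "2 dvd f" by simp
qed

text \<open>The coefficients of a square modulo \<open>2\<close>: the summands of index \<open>i\<close> and \<open>N - i\<close> are equal.\<close>

lemma sum_symmetric_products: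
  fixes a :: "nat \<Rightarrow> 'a::comm_ring_1"
  shows "(\<Sum>i=0..N. a i * a (N - i))
    = (if even N then (a (N div 2))\<^sup>2 else 0) + 2 * (\<Sum>i | 2 * i < N. a i * a (N - i))"
proof -
  have fin: "finite {i. 2 * i < N}" by (rule finite_subset[of _ "{..N}"]) auto
  have fin2: "finite {i. i \<le> N \<and> 2 * i > N}" by simp
  have fin3: "finite {i. 2 * i = N}" by (rule finite_subset[of _ "{..N}"]) auto
  have "{0..N} = ({i. 2 * i < N} \<union> {i. i \<le> N \<and> 2 * i > N}) \<union> {i. 2 * i = N}" by auto
  then have "(\<Sum>i=0..N. a i * a (N - i)) = (\<Sum>i | 2 * i < N. a i * a (N - i))
    + (\<Sum>i | i \<le> N \<and> 2 * i > N. a i * a (N - i)) + (\<Sum>i | 2 * i = N. a i * a (N - i))"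
    using fin fin2 fin3 by (simp add: sum.union_disjoint disjoint_iff)
  also have "(\<Sum>i | i \<le> N \<and> 2 * i > N. a i * a (N - i)) = (\<Sum>i | 2 * i < N. a i * a (N - i))"
    by (rule sum.reindex_bij_witness[of _ "\<lambda>i. N - i" "\<lambda>i. N - i"]) (auto simp: mult.commute)
  also have "(\<Sum>i | 2 * i = N. a i * a (N - i)) = (if even N then (a (N div 2))\<^sup>2 else 0)"
  proof (cases "even N")
    case True
    then have "{i. 2 * i = N} = {N div 2}" by auto
    moreover have "N - N div 2 = N div 2" using True by (auto elim!: evenE)
    ultimately show ?thesis using True by (simp add: power2_eq_square)
  next
    case False
    then have "{i. 2 * i = N} = {}" by auto
    then show ?thesis using False by simp
  qed
  finally show ?thesis by (simp only: mult_2 add_ac)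
qed

lemma fps_frob_cong_square: "2 dvd fps_frob f - f\<^sup>2"
  unfolding fps_two_dvd_iff
proof
  fix N
  have "fps_nth (fps_frob f - f\<^sup>2) N
    = (if even N then frob (fps_nth f (N div 2)) - (fps_nth f (N div 2))\<^sup>2 else 0)
      + 2 * (- (\<Sum>i | 2 * i < N. fps_nth f i * fps_nth f (N - i)))"
    by (simp add: fps_frob_def power2_eq_square[of f] fps_mult_nth sum_symmetric_products)
  moreover have "2 dvd (if even N then frob (fps_nth f (N div 2)) - (fps_nth f (N div 2))\<^sup>2 else 0)"
    using frob_cong_square by simp
  ultimately show "2 dvd fps_nth (fps_frob f - f\<^sup>2) N"
    by (simp only:) (intro dvd_add dvd_triv_left)
qed

lemma fps_frob_funpow_cong: "2 dvd (fps_frob ^^ i) f - f ^ (2 ^ i)"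
proof (induction i)
  case 0
  then show ?case by simp
next
  case (Suc i)
  define g where "g = (fps_frob ^^ i) f"
  have "2 ^ Suc 1 dvd g ^ (2 ^ 1) - (f ^ (2 ^ i)) ^ (2 ^ 1)"
    by (rule dvd_power_two_power_diff) (use Suc in \<open>simp add: g_def\<close>)
  then have "2 dvd g ^ (2 ^ 1) - (f ^ (2 ^ i)) ^ (2 ^ 1)"
    unfolding power_Suc by (rule dvd_mult_left)
  then have "2 dvd g\<^sup>2 - (f ^ (2 ^ i))\<^sup>2"
    unfolding power_one_right .
  then have "2 dvd (fps_frob g - g\<^sup>2) + (g\<^sup>2 - (f ^ (2 ^ i))\<^sup>2)"
    using fps_frob_cong_square by (rule dvd_add[rotated])
  then have "2 dvd fps_frob g - (f ^ (2 ^ i))\<^sup>2" by simp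
  moreover have "(f ^ (2 ^ i))\<^sup>2 = f ^ (2 ^ Suc i)" unfolding power_Suc2 power_mult ..
  ultimately show ?case by (simp add: g_def)
qed

section \<open>The two-series\<close>

lemma fps_power_nth_cong:
  fixes f g :: "'a::comm_ring_1 fps"
  assumes "\<And>i. i \<le> M \<Longrightarrow> fps_nth f i = fps_nth g i"
  shows "fps_nth (f ^ n) M = fps_nth (g ^ n) M"
  using assms
proof (induction n arbitrary: M)
  case 0
  then show ?case by simp
next
  case (Suc n)
  have "fps_nth f i * fps_nth (f ^ n) (M - i) = fps_nth g i * fps_nth (g ^ n) (M - i)"
    if "i \<in> {0..M}" for i
    using Suc.IH[of "M - i"] Suc.prems that by auto
  then show ?case by (simp add: fps_mult_nth)
qed

text \<open>Without constant terms, the coefficient of \<open>x^M\<close> in a power with exponent at least \<open>2\<close> depends only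
on earlier coefficients. This is what makes \<open>log (G(x)) = 2 log x\<close> a recursion for the coefficients
of \<open>G\<close>.\<close>

lemma fps_power_nth_cong_strict:
  fixes f g :: "'a::comm_ring_1 fps"
  assumes "fps_nth f 0 = 0" "fps_nth g 0 = 0" and "\<And>i. i < M \<Longrightarrow> fps_nth f i = fps_nth g i"
    and "n \<ge> 2"
  shows "fps_nth (f ^ n) M = fps_nth (g ^ n) M"
proof -
  obtain m where n: "n = Suc m" and m: "m \<ge> 1" using \<open>n \<ge> 2\<close> by (cases n) auto
  have zero: "fps_nth (f ^ m) 0 = 0" "fps_nth (g ^ m) 0 = 0"
    using assms m by (simp_all add: fps_nth_power_0 power_0_left)
  have "fps_nth f i * fps_nth (f ^ m) (M - i) = fps_nth g i * fps_nth (g ^ m) (M - i)"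
    if i: "i \<in> {0..M}" for i
  proof -
    consider "i = 0" | "i = M" | "0 < i" "i < M" using i by (cases "i = 0"; cases "i = M") auto
    then show ?thesis
    proof cases
      case 3
      have "fps_nth (f ^ m) (M - i) = fps_nth (g ^ m) (M - i)"
        by (rule fps_power_nth_cong) (use 3 assms in auto)
      then show ?thesis using 3 assms by simp
    qed (use assms zero in auto)
  qed
  then show ?thesis by (simp add: n fps_mult_nth)
qed

lemma fps_power_nth_eq_0:
  fixes f :: "'a::comm_ring_1 fps"
  assumes "fps_nth f 0 = 0" "M < n"
  shows "fps_nth (f ^ n) M = 0"
  using assms startsby_zero_power_prefix by blast

lemma BP_log_nth: "fps_nth BP_log M = (\<Sum>n | M = 2 ^ n. log_coeff n)"
  by (simp add: BP_log_def)

lemma BP_log_nth_power_two: "fps_nth BP_log (2 ^ n) = log_coeff n"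
proof -
  have "{m. (2::nat) ^ n = 2 ^ m} = {n}" by auto
  then show ?thesis by (simp add: BP_log_nth)
qed

lemma BP_log_nth_other: "(\<And>n. M \<noteq> 2 ^ n) \<Longrightarrow> fps_nth BP_log M = 0"
  by (simp add: BP_log_nth)

lemma BP_log_compose_nth:
  assumes "fps_nth f 0 = 0" "M \<le> B"
  shows "fps_nth (BP_log oo f) M = (\<Sum>n\<le>B. log_coeff n * fps_nth (f ^ (2 ^ n)) M)"
proof -
  have "fps_nth (BP_log oo f) M = (\<Sum>i=0..M. fps_nth BP_log i * fps_nth (f ^ i) M)"
    by (simp add: fps_compose_nth)
  also have "\<dots> = (\<Sum>i \<in> (\<lambda>n. 2 ^ n) ` {n. 2 ^ n \<le> M}. fps_nth BP_log i * fps_nth (f ^ i) M)"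
  proof (rule sum.mono_neutral_right)
    show "\<forall>i\<in>{0..M} - (\<lambda>n. 2 ^ n) ` {n. 2 ^ n \<le> M}. fps_nth BP_log i * fps_nth (f ^ i) M = 0"
    proof
      fix i assume i: "i \<in> {0..M} - (\<lambda>n. 2 ^ n) ` {n. 2 ^ n \<le> M}"
      have "i \<noteq> 2 ^ n" for n using i by auto
      then show "fps_nth BP_log i * fps_nth (f ^ i) M = 0" by (simp add: BP_log_nth_other)
    qed
  qed auto
  also have "\<dots> = (\<Sum>n | 2 ^ n \<le> M. log_coeff n * fps_nth (f ^ (2 ^ n)) M)"
    by (subst sum.reindex) (auto simp: inj_on_def BP_log_nth_power_two)
  also have "\<dots> = (\<Sum>n\<le>B. log_coeff n * fps_nth (f ^ (2 ^ n)) M)"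
  proof (rule sum.mono_neutral_left)
    show "{n. 2 ^ n \<le> M} \<subseteq> {..B}"
    proof
      fix n :: nat assume "n \<in> {n. 2 ^ n \<le> M}"
      then have "n < M" using less_exp[of n] by (simp only: mem_Collect_eq)
      then show "n \<in> {..B}" using assms by simp
    qed
    show "\<forall>n\<in>{..B} - {n. 2 ^ n \<le> M}. log_coeff n * fps_nth (f ^ (2 ^ n)) M = 0"
      using assms by (auto simp: fps_power_nth_eq_0)
  qed simp
  finally show ?thesis .
qed

lemma BP_log_compose_nth_split:
  assumes "fps_nth f 0 = 0" "M \<le> B"
  shows "fps_nth (BP_log oo f) M
    = fps_nth f M + (\<Sum>n=1..B. log_coeff n * fps_nth (f ^ (2 ^ n)) M)"
proof -
  have "{..B} = insert 0 {1..B}" by auto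
  then show ?thesis by (simp add: BP_log_compose_nth[OF assms] log_coeff_0)
qed

abbreviation BP_fps_to_BPQ :: "BP fps \<Rightarrow> BPQ fps" where
  "BP_fps_to_BPQ \<equiv> fps_map BP_to_BPQ"

interpretation BPQ_fps: ring_morphism BP_fps_to_BPQ
  by (rule ring_morphism_fps_map) (rule BPQ.ring_morphism_axioms)

lemma ring_morphism_fps_frob: "ring_morphism fps_frob"
proof
  show "fps_frob (x * y) = fps_frob x * fps_frob y" for x y
  proof (rule fps_ext)
    fix n
    show "fps_nth (fps_frob (x * y)) n = fps_nth (fps_frob x * fps_frob y) n"
    proof (cases "even n")
      case True
      then obtain m where n: "n = 2 * m" by (rule evenE)
      have "fps_nth (fps_frob x * fps_frob y) n
        = (\<Sum>i\<in>{0..n}. fps_nth (fps_frob x) i * fps_nth (fps_frob y) (n - i))"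
        by (simp add: fps_mult_nth)
      also have "\<dots> = (\<Sum>i\<in>(\<lambda>j. 2 * j) ` {0..m}.
          fps_nth (fps_frob x) i * fps_nth (fps_frob y) (n - i))"
      proof (rule sum.mono_neutral_right)
        show "\<forall>i\<in>{0..n} - (\<lambda>j. 2 * j) ` {0..m}.
            fps_nth (fps_frob x) i * fps_nth (fps_frob y) (n - i) = 0"
          by (auto simp: n fps_frob_nth elim!: evenE)
      qed (auto simp: n)
      also have "\<dots> = (\<Sum>j\<in>{0..m}. frob (fps_nth x j) * frob (fps_nth y (m - j)))"
        by (subst sum.reindex)
          (auto simp: inj_on_def n fps_frob_nth right_diff_distrib'[symmetric] intro!: sum.cong)
      also have "\<dots> = fps_nth (fps_frob (x * y)) n"
        by (simp add: n fps_frob_nth fps_mult_nth frob.hom_sum frob.hom_mult)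
      finally show ?thesis by simp
    next
      case False
      then have "fps_nth (fps_frob x) i * fps_nth (fps_frob y) (n - i) = 0" if "i \<le> n" for i
        using that by (simp add: fps_frob_nth)
      then show ?thesis using False by (simp add: fps_frob_nth fps_mult_nth)
    qed
  qed
qed (auto intro!: fps_ext simp: fps_frob_nth frob.hom_add frob.hom_one frob.hom_zero elim!: evenE)

lemma fps_frob_power_cong: "2 ^ Suc k dvd g ^ (2 ^ (i + k)) - ((fps_frob ^^ i) g) ^ (2 ^ k)"
proof -
  have "2 dvd g ^ (2 ^ i) - (fps_frob ^^ i) g"
    using fps_frob_funpow_cong[of i g] by (subst dvd_minus_iff[symmetric]) simp
  then have "2 ^ Suc k dvd (g ^ (2 ^ i)) ^ (2 ^ k) - ((fps_frob ^^ i) g) ^ (2 ^ k)"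
    by (rule dvd_power_two_power_diff)
  then show ?thesis unfolding power_add power_mult .
qed

interpretation fps_frob_funpow: ring_morphism "fps_frob ^^ i" for i
  by (rule ring_morphism_funpow) (rule ring_morphism_fps_frob)

text \<open>The functional equation \<open>2 log = 2 x + \<Sum>\<^sub>i\<^sub>\<ge>\<^sub>1 v\<^sub>i \<phi>\<^sup>i(log)\<close>, coefficient by coefficient, with \<open>\<phi>\<close> the
Frobenius lift. It is \<open>log_coeff_left_rec\<close> at the exponents \<open>2^n\<close> and \<open>0 = 0\<close> elsewhere.\<close>

lemma BP_log_functional_equation:
  assumes N: "N \<ge> 1"
  shows "(\<Sum>i=1..N. BP_to_BPQ (v_gen i)
      * (if 2 ^ i dvd N then (frob ^^ i) (fps_nth BP_log (N div 2 ^ i)) else 0))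
    = 2 * fps_nth BP_log N - (if N = 1 then 2 else 0)"
proof (cases "\<exists>n. N = 2 ^ n")
  case False
  then have no: "N \<noteq> 2 ^ n" for n by blast
  have "(if 2 ^ i dvd N then (frob ^^ i) (fps_nth BP_log (N div 2 ^ i)) else 0) = 0" for i
  proof (cases "2 ^ i dvd N")
    case True
    then obtain M where M: "N = 2 ^ i * M" by (rule dvdE)
    have "M \<noteq> 2 ^ n" for n using no[of "i + n"] M by (simp add: power_add)
    then have "fps_nth BP_log (N div 2 ^ i) = 0" using M by (simp add: BP_log_nth_other)
    then show ?thesis by (simp add: frob_funpow.hom_zero)
  qed simp
  then show ?thesis using no[of 0] no by (simp add: BP_log_nth_other)
next
  case True
  then obtain n where n: "N = 2 ^ n" by blast
  have nN: "n \<le> N" unfolding n using less_exp[of n] by (rule less_imp_le)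
  have summand: "(if 2 ^ i dvd N then (frob ^^ i) (fps_nth BP_log (N div 2 ^ i)) else 0)
      = (if i \<le> n then (frob ^^ i) (log_coeff (n - i)) else 0)" for i
  proof (cases "i \<le> n")
    case True
    then have "N div 2 ^ i = 2 ^ (n - i)" "2 ^ i dvd N" by (auto simp: n power_diff le_imp_power_dvd)
    then show ?thesis using True by (simp add: BP_log_nth_power_two)
  next
    case False
    then have "\<not> 2 ^ i dvd N" by (auto simp: n dest!: dvd_imp_le)
    then show ?thesis using False by simp
  qed
  have "(\<Sum>i=1..N. BP_to_BPQ (v_gen i) * (if i \<le> n then (frob ^^ i) (log_coeff (n - i)) else 0))
    = (\<Sum>i=1..n. BP_to_BPQ (v_gen i) * (frob ^^ i) (log_coeff (n - i)))"
    by (rule sum.mono_neutral_cong_right) (use nN in auto)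
  also have "\<dots> = 2 * fps_nth BP_log N - (if N = 1 then 2 else 0)"
  proof (cases "n = 0")
    case True
    then show ?thesis using BP_log_nth_power_two[of 0] by (simp add: n log_coeff_0)
  next
    case False
    then have "n \<ge> 1" by simp
    then show ?thesis
      using log_coeff_left_rec[of n] False by (simp add: n BP_log_nth_power_two)
  qed
  finally show ?thesis unfolding summand .
qed

text \<open>Suppose that the integral series \<open>g\<close> solves \<open>log (g(x)) = 2 log x\<close> below degree \<open>N\<close>. Then the value that the
coefficient of degree \<open>N\<close> must have is integral. Expand twice the sum by the left recursion:
it is the sum over \<open>i\<close> of \<open>v\<^sub>i\<close> times \<open>\<Sum>\<^sub>k (frob\<^sup>i (log_coeff k)) g^(2^(i+k))\<close>. Replacing \<open>g^(2^(i+k))\<close> by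
\<open>(\<phi>\<^sup>i g)^(2^k)\<close> costs \<open>2^(k+1)\<close> times an integral term, which outweighs the denominator \<open>2^k\<close> and
leaves a factor \<open>2\<close>. What remains is the coefficient of degree \<open>N\<close> in \<open>v\<^sub>i \<phi>\<^sup>i(log g)\<close>, which involves only
the coefficient of \<open>log g\<close> in degree \<open>N / 2^i\<close>, known to agree with that of \<open>2 log x\<close>. The functional
equation evaluates the sum over \<open>i\<close>.\<close>

lemma functional_equation_step:
  fixes g :: "BP fps"
  assumes g0: "fps_nth g 0 = 0" and N: "N \<ge> 1"
    and below: "\<And>M. M < N \<Longrightarrow>
      fps_nth (BP_log oo BP_fps_to_BPQ g) M = 2 * fps_nth BP_log M"
  shows "\<exists>r. BP_to_BPQ r = 2 * fps_nth BP_log N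
    - (\<Sum>n=1..N. log_coeff n * fps_nth (BP_fps_to_BPQ g ^ (2 ^ n)) N)"
proof -
  define h where "h = BP_fps_to_BPQ g"
  have h0: "fps_nth h 0 = 0" by (simp add: h_def fps_map_nth g0 BPQ.hom_zero)
  have h_power: "fps_nth (h ^ m) M = BP_to_BPQ (fps_nth (g ^ m) M)" for m M
    unfolding h_def BPQ_fps.hom_power[symmetric] by (rule fps_map_nth)
  define V where "V i = BP_to_BPQ (v_gen i)" for i
  obtain L where L: "\<And>n. BP_to_BPQ (L n) = 2 ^ n * log_coeff n"
    using two_power_log_coeff_integral by metis
  have "\<exists>c. g ^ (2 ^ (i + k)) - ((fps_frob ^^ i) g) ^ (2 ^ k) = 2 ^ Suc k * c" for i k
    using fps_frob_power_cong[of k g i] by (rule dvdE) (rule exI)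
  then obtain c where c: "\<And>i k. g ^ (2 ^ (i + k)) - ((fps_frob ^^ i) g) ^ (2 ^ k) = 2 ^ Suc k * c i k"
    by metis
  \<comment> \<open>The coefficient of degree \<open>N\<close> in \<open>\<phi>\<^sup>i(log g)\<close>.\<close>
  define tw where "tw i = (if 2 ^ i dvd N then (frob ^^ i) (fps_nth (BP_log oo h) (N div 2 ^ i)) else 0)" for i
  have twist: "(\<Sum>k\<le>N - i. (frob ^^ i) (log_coeff k) * BP_to_BPQ (fps_nth (((fps_frob ^^ i) g) ^ (2 ^ k)) N)) = tw i"
    if i: "i \<in> {1..N}" for i
  proof (cases "2 ^ i dvd N")
    case False
    then show ?thesis
      by (simp add: tw_def fps_frob_funpow.hom_power[symmetric] fps_frob_funpow_nth BPQ.hom_zero)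
  next
    case True
    from True obtain M where M: "N = 2 ^ i * M" by (rule dvdE)
    \<comment> \<open>The sum up to \<open>N - i\<close> reaches all terms that contribute in degree \<open>M\<close>.\<close>
    have "M + i \<le> N"
    proof -
      have M1: "M \<ge> 1" using N M by (cases M) auto
      have "i < 2 ^ i" by (rule less_exp)
      then have "i + 1 \<le> 2 ^ i" by (simp only: Suc_eq_plus1[symmetric] Suc_le_eq)
      then have "(i + 1) * M \<le> 2 ^ i * M" by (rule mult_le_mono1)
      moreover have "i \<le> i * M" using M1 by simp
      ultimately have "i + M \<le> 2 ^ i * M" by (simp only: distrib_right mult_1)
      then show ?thesis using M by (simp only: add.commute)
    qed
    then have "fps_nth (BP_log oo h) M = (\<Sum>k\<le>N - i. log_coeff k * fps_nth (h ^ (2 ^ k)) M)"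
      by (intro BP_log_compose_nth h0) simp
    then show ?thesis
      using True M
      by (simp add: tw_def fps_frob_funpow.hom_power[symmetric] fps_frob_funpow_nth
          frob_funpow.hom_sum frob_funpow.hom_mult h_power BP_to_BPQ_frob_funpow)
  qed
  have tw_log: "tw i = (if 2 ^ i dvd N then 2 * (frob ^^ i) (fps_nth BP_log (N div 2 ^ i)) else 0)"
    if i: "i \<in> {1..N}" for i
  proof -
    have "(1::nat) < 2 ^ i" using i by (intro one_less_power) auto
    then have "N div 2 ^ i < N" using N by (intro div_less_dividend) auto
    then show ?thesis
      using below unfolding tw_def h_def by (simp add: frob_funpow.hom_mult frob_funpow.hom_numeral)
  qed
  have main: "2 * (\<Sum>n=1..N. log_coeff n * fps_nth (h ^ (2 ^ n)) N)
    = (\<Sum>i=1..N. V i * tw i)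
      + 2 * BP_to_BPQ (\<Sum>i=1..N. v_gen i * (\<Sum>k\<le>N - i. (frob ^^ i) (L k) * fps_nth (c i k) N))"
  proof -
    have "2 * (\<Sum>n=1..N. log_coeff n * fps_nth (h ^ (2 ^ n)) N)
      = (\<Sum>n\<in>{1..N}. \<Sum>i | i \<in> {1..N} \<and> i \<le> n.
          V i * (frob ^^ i) (log_coeff (n - i)) * fps_nth (h ^ (2 ^ n)) N)"
    proof -
      have "2 * (log_coeff n * fps_nth (h ^ (2 ^ n)) N) = (\<Sum>i | i \<in> {1..N} \<and> i \<le> n.
          V i * (frob ^^ i) (log_coeff (n - i)) * fps_nth (h ^ (2 ^ n)) N)"
        if n: "n \<in> {1..N}" for n
      proof -
        have "{1..n} = {i. i \<in> {1..N} \<and> i \<le> n}" using n by auto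
        then show ?thesis
          using log_coeff_left_rec[of n] n
          by (simp only: mult.assoc[symmetric] sum_distrib_right V_def atLeastAtMost_iff)
      qed
      then show ?thesis by (simp only: sum_distrib_left cong: sum.cong)
    qed
    also have "\<dots> = (\<Sum>i\<in>{1..N}. \<Sum>n | n \<in> {1..N} \<and> i \<le> n.
          V i * (frob ^^ i) (log_coeff (n - i)) * fps_nth (h ^ (2 ^ n)) N)"
      by (rule sum.swap_restrict) simp_all
    also have "\<dots> = (\<Sum>i\<in>{1..N}. V i * tw i + 2 * BP_to_BPQ (v_gen i * (\<Sum>k\<le>N - i. (frob ^^ i) (L k) * fps_nth (c i k) N)))"
    proof (rule sum.cong[OF refl])
      fix i assume i: "i \<in> {1..N}"
      have "(\<Sum>n | n \<in> {1..N} \<and> i \<le> n. V i * (frob ^^ i) (log_coeff (n - i)) * fps_nth (h ^ (2 ^ n)) N)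
        = (\<Sum>k\<le>N - i. V i * (frob ^^ i) (log_coeff k) * fps_nth (h ^ (2 ^ (i + k))) N)"
        by (rule sum.reindex_bij_witness[of _ "\<lambda>k. i + k" "\<lambda>n. n - i"]) (use i in auto)
      also have "\<dots> = (\<Sum>k\<le>N - i. V i * ((frob ^^ i) (log_coeff k) * BP_to_BPQ (fps_nth (((fps_frob ^^ i) g) ^ (2 ^ k)) N)
          + 2 * BP_to_BPQ ((frob ^^ i) (L k) * fps_nth (c i k) N)))"
      proof (rule sum.cong[OF refl])
        fix k
        \<comment> \<open>The denominator \<open>2^k\<close> of the logarithm is absorbed and one factor \<open>2\<close> is left.\<close>
        have "g ^ (2 ^ (i + k)) = ((fps_frob ^^ i) g) ^ (2 ^ k) + 2 ^ Suc k * c i k"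
          unfolding c[symmetric] by simp
        moreover have "fps_nth (2 ^ Suc k * c i k) N = 2 ^ Suc k * fps_nth (c i k) N"
          by (simp only: fps_numeral_fps_const fps_const_power fps_mult_left_const_nth)
        ultimately have "fps_nth (h ^ (2 ^ (i + k))) N
          = BP_to_BPQ (fps_nth (((fps_frob ^^ i) g) ^ (2 ^ k)) N)
            + 2 ^ Suc k * BP_to_BPQ (fps_nth (c i k) N)"
          by (simp only: h_power fps_add_nth BPQ.hom_add BPQ.hom_mult BPQ.hom_power BPQ.hom_numeral)
        moreover have "(frob ^^ i) (log_coeff k) * (2 ^ Suc k * BP_to_BPQ (fps_nth (c i k) N))
          = 2 * BP_to_BPQ ((frob ^^ i) (L k) * fps_nth (c i k) N)"
          by (simp only: BPQ.hom_mult BP_to_BPQ_frob_funpow L frob_funpow.hom_mult frob_funpow.hom_power frob_funpow.hom_numeral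
              power_Suc mult_ac)
        ultimately show "V i * (frob ^^ i) (log_coeff k) * fps_nth (h ^ (2 ^ (i + k))) N
          = V i * ((frob ^^ i) (log_coeff k) * BP_to_BPQ (fps_nth (((fps_frob ^^ i) g) ^ (2 ^ k)) N)
          + 2 * BP_to_BPQ ((frob ^^ i) (L k) * fps_nth (c i k) N))"
          by (simp only: mult.assoc distrib_left)
      qed
      also have "\<dots> = V i * tw i + 2 * BP_to_BPQ (v_gen i * (\<Sum>k\<le>N - i. (frob ^^ i) (L k) * fps_nth (c i k) N))"
      proof -
        have "(\<Sum>k\<le>N - i. V i * ((frob ^^ i) (log_coeff k) * BP_to_BPQ (fps_nth (((fps_frob ^^ i) g) ^ (2 ^ k)) N)
            + 2 * BP_to_BPQ ((frob ^^ i) (L k) * fps_nth (c i k) N)))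
          = V i * (tw i + 2 * (\<Sum>k\<le>N - i. BP_to_BPQ ((frob ^^ i) (L k) * fps_nth (c i k) N)))"
          unfolding twist[OF i, symmetric] by (simp only: sum_distrib_left[symmetric] sum.distrib)
        then show ?thesis
          by (simp only: BPQ.hom_mult[of "v_gen i"] BPQ.hom_sum V_def distrib_left mult.left_commute[of 2])
      qed
      finally show "(\<Sum>n | n \<in> {1..N} \<and> i \<le> n. V i * (frob ^^ i) (log_coeff (n - i)) * fps_nth (h ^ (2 ^ n)) N)
        = V i * tw i + 2 * BP_to_BPQ (v_gen i * (\<Sum>k\<le>N - i. (frob ^^ i) (L k) * fps_nth (c i k) N))" .
    qed
    also have "\<dots> = (\<Sum>i=1..N. V i * tw i)
      + 2 * BP_to_BPQ (\<Sum>i=1..N. v_gen i * (\<Sum>k\<le>N - i. (frob ^^ i) (L k) * fps_nth (c i k) N))"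
      by (simp only: sum.distrib BPQ.hom_sum sum_distrib_left[symmetric])
    finally show ?thesis .
  qed
  have log_twist: "(\<Sum>i=1..N. V i * tw i) = 2 * (2 * fps_nth BP_log N - (if N = 1 then 2 else 0))"
    unfolding BP_log_functional_equation[OF N, symmetric] sum_distrib_left V_def
    by (rule sum.cong[OF refl]) (simp add: tw_log)
  define r where "r = (if N = 1 then 2 else 0)
    - (\<Sum>i=1..N. v_gen i * (\<Sum>k\<le>N - i. (frob ^^ i) (L k) * fps_nth (c i k) N))"
  have "2 * (\<Sum>n=1..N. log_coeff n * fps_nth (h ^ (2 ^ n)) N)
    = 2 * (2 * fps_nth BP_log N - BP_to_BPQ r)"
    unfolding main log_twist distrib_left[symmetric] r_def
    by (simp add: BPQ.hom_diff BPQ.hom_numeral BPQ.hom_zero algebra_simps)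
  then have "(\<Sum>n=1..N. log_coeff n * fps_nth (h ^ (2 ^ n)) N) = 2 * fps_nth BP_log N - BP_to_BPQ r"
    by (rule BPQ_two_cancel)
  then show ?thesis unfolding h_def by (intro exI[of _ r]) simp
qed

text \<open>The coefficient of degree \<open>N\<close> that \<open>log (g(x)) = 2 log x\<close> forces on \<open>g\<close>; it exists whenever
\<open>functional_equation_step\<close> applies.\<close>

definition next_coeff :: "nat \<Rightarrow> BP fps \<Rightarrow> BP" where
  "next_coeff N g = (SOME r. BP_to_BPQ r = 2 * fps_nth BP_log N
    - (\<Sum>n=1..N. log_coeff n * fps_nth (BP_fps_to_BPQ g ^ (2 ^ n)) N))"

primrec two_series_approx :: "nat \<Rightarrow> BP fps" where
  "two_series_approx 0 = 0"
| "two_series_approx (Suc N) = two_series_approx N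
     + fps_const (next_coeff (Suc N) (two_series_approx N)) * fps_X ^ Suc N"

lemma two_series_approx_Suc_nth:
  "fps_nth (two_series_approx (Suc N)) i = fps_nth (two_series_approx N) i
     + (if i = Suc N then next_coeff (Suc N) (two_series_approx N) else 0)"
  by (simp add: fps_X_power_nth del: power_Suc)

lemma two_series_approx_nth_beyond: "M > N \<Longrightarrow> fps_nth (two_series_approx N) M = 0"
  by (induction N) (simp_all add: two_series_approx_Suc_nth del: two_series_approx.simps(2))

lemma two_series_approx_nth_0: "fps_nth (two_series_approx N) 0 = 0"
  by (induction N) (simp_all add: two_series_approx_Suc_nth del: two_series_approx.simps(2))

lemma two_series_approx_stable:
  "i \<le> N \<Longrightarrow> fps_nth (two_series_approx N) i = fps_nth (two_series_approx i) i"
proof (induction N)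
  case (Suc N)
  then show ?case
    by (cases "i = Suc N") (simp_all add: two_series_approx_Suc_nth del: two_series_approx.simps(2))
qed simp

lemma BP_log_compose_nth_cong:
  assumes "fps_nth f 0 = 0" "\<And>i. i \<le> M \<Longrightarrow> fps_nth f i = fps_nth g i"
  shows "fps_nth (BP_log oo BP_fps_to_BPQ f) M = fps_nth (BP_log oo BP_fps_to_BPQ g) M"
proof -
  have "fps_nth g 0 = 0" using assms(1) assms(2)[of 0] by simp
  moreover have "fps_nth (BP_fps_to_BPQ f ^ m) M = fps_nth (BP_fps_to_BPQ g ^ m) M" for m
    by (rule fps_power_nth_cong) (simp add: fps_map_nth assms)
  ultimately show ?thesis
    by (simp add: BP_log_compose_nth[OF _ order_refl] fps_map_nth assms(1) BPQ.hom_zero)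
qed

lemma two_series_approx_log:
  "M \<le> N \<Longrightarrow> fps_nth (BP_log oo BP_fps_to_BPQ (two_series_approx N)) M = 2 * fps_nth BP_log M"
proof (induction N arbitrary: M)
  case 0
  then show ?case by (simp add: BP_log_nth_other)
next
  case (Suc N)
  define g g' where "g = two_series_approx N" and "g' = two_series_approx (Suc N)"
  have g0: "fps_nth g 0 = 0" "fps_nth g' 0 = 0" by (simp_all only: g_def g'_def two_series_approx_nth_0)
  have eq: "fps_nth g' i = fps_nth g i" if "i < Suc N" for i
    using that unfolding g_def g'_def two_series_approx_Suc_nth by simp
  show ?case
  proof (cases "M = Suc N")
    case False
    then have "fps_nth (BP_log oo BP_fps_to_BPQ g') M = fps_nth (BP_log oo BP_fps_to_BPQ g) M"
      using Suc.prems by (intro BP_log_compose_nth_cong g0 eq) auto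
    then show ?thesis using Suc False by (simp only: g_def g'_def le_Suc_eq)
  next
    case True
    have "\<exists>r. BP_to_BPQ r = 2 * fps_nth BP_log (Suc N)
      - (\<Sum>n=1..Suc N. log_coeff n * fps_nth (BP_fps_to_BPQ g ^ (2 ^ n)) (Suc N))"
      by (rule functional_equation_step) (use g0 Suc.IH in \<open>simp_all add: g_def\<close>)
    then have "BP_to_BPQ (next_coeff (Suc N) g) = 2 * fps_nth BP_log (Suc N)
      - (\<Sum>n=1..Suc N. log_coeff n * fps_nth (BP_fps_to_BPQ g ^ (2 ^ n)) (Suc N))"
      unfolding next_coeff_def by (rule someI_ex)
    moreover have "fps_nth g' (Suc N) = next_coeff (Suc N) g"
      unfolding g_def g'_def two_series_approx_Suc_nth by (simp add: two_series_approx_nth_beyond)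
    moreover have "fps_nth (BP_fps_to_BPQ g ^ (2 ^ n)) (Suc N) = fps_nth (BP_fps_to_BPQ g' ^ (2 ^ n)) (Suc N)"
      if "n \<in> {1..Suc N}" for n
    proof (rule fps_power_nth_cong_strict)
      have "(2::nat) ^ 1 \<le> 2 ^ n" using that by (intro power_increasing) auto
      then show "(2::nat) \<le> 2 ^ n" by simp
    qed (simp_all add: fps_map_nth g0 eq BPQ.hom_zero)
    then have "(\<Sum>n=1..Suc N. log_coeff n * fps_nth (BP_fps_to_BPQ g ^ (2 ^ n)) (Suc N))
      = (\<Sum>n=1..Suc N. log_coeff n * fps_nth (BP_fps_to_BPQ g' ^ (2 ^ n)) (Suc N))"
      by (intro sum.cong refl) simp
    moreover have "fps_nth (BP_log oo BP_fps_to_BPQ g') (Suc N) = BP_to_BPQ (fps_nth g' (Suc N))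
      + (\<Sum>n=1..Suc N. log_coeff n * fps_nth (BP_fps_to_BPQ g' ^ (2 ^ n)) (Suc N))"
      using BP_log_compose_nth_split[of "BP_fps_to_BPQ g'" "Suc N" "Suc N"]
      by (simp add: fps_map_nth g0 BPQ.hom_zero)
    ultimately have "fps_nth (BP_log oo BP_fps_to_BPQ g') (Suc N) = 2 * fps_nth BP_log (Suc N)"
      by (simp only: diff_add_cancel)
    then show ?thesis by (simp only: True g'_def)
  qed
qed

lemma fps_two_times_nth: "fps_nth (2 * f) n = 2 * fps_nth (f :: 'a::comm_ring_1 fps) n"
  by (simp only: fps_numeral_fps_const fps_mult_left_const_nth)

lemma two_series_exists:
  "\<exists>G. fps_nth G 0 = 0 \<and> BP_log oo BP_fps_to_BPQ G = 2 * BP_log"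
proof -
  define G where "G = Abs_fps (\<lambda>n. fps_nth (two_series_approx n) n)"
  have G0: "fps_nth G 0 = 0"
    unfolding G_def fps_nth_Abs_fps by (rule two_series_approx_nth_0)
  have "BP_log oo BP_fps_to_BPQ G = 2 * BP_log"
  proof (rule fps_ext)
    fix M
    have "fps_nth (BP_log oo BP_fps_to_BPQ G) M
      = fps_nth (BP_log oo BP_fps_to_BPQ (two_series_approx M)) M"
      by (rule BP_log_compose_nth_cong[OF G0])
        (unfold G_def fps_nth_Abs_fps, rule two_series_approx_stable[symmetric])
    then show "fps_nth (BP_log oo BP_fps_to_BPQ G) M = fps_nth (2 * BP_log) M"
      by (simp only: two_series_approx_log[OF order_refl] fps_two_times_nth)
  qed
  with G0 show ?thesis by blast
qed

lemma BP_log_compose_inject: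
  assumes "fps_nth G 0 = 0" "fps_nth H 0 = 0"
    and "BP_log oo BP_fps_to_BPQ G = BP_log oo BP_fps_to_BPQ H"
  shows "G = H"
proof (rule fps_ext)
  fix N show "fps_nth G N = fps_nth H N"
  proof (induction N rule: less_induct)
    case (less N)
    define g h where "g = BP_fps_to_BPQ G" and "h = BP_fps_to_BPQ H"
    have gh: "fps_nth g 0 = 0" "fps_nth h 0 = 0" "\<And>i. i < N \<Longrightarrow> fps_nth g i = fps_nth h i"
      using assms less by (simp_all add: g_def h_def fps_map_nth BPQ.hom_zero)
    have "fps_nth (g ^ (2 ^ n)) N = fps_nth (h ^ (2 ^ n)) N" if "n \<in> {1..N}" for n
    proof (rule fps_power_nth_cong_strict)
      have "(2::nat) ^ 1 \<le> 2 ^ n" using that by (intro power_increasing) auto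
      then show "(2::nat) \<le> 2 ^ n" by simp
    qed (use gh in auto)
    then have "(\<Sum>n=1..N. log_coeff n * fps_nth (g ^ (2 ^ n)) N)
      = (\<Sum>n=1..N. log_coeff n * fps_nth (h ^ (2 ^ n)) N)"
      by (intro sum.cong refl) simp
    moreover have "fps_nth (BP_log oo g) N = fps_nth (BP_log oo h) N"
      using assms by (simp add: g_def h_def)
    ultimately have "fps_nth g N = fps_nth h N"
      using BP_log_compose_nth_split[OF gh(1), of N N] BP_log_compose_nth_split[OF gh(2), of N N]
      by simp
    then show ?case by (simp add: g_def h_def fps_map_nth BP_to_BPQ_eq_iff)
  qed
qed

lemma two_series_spec:
  "fps_nth two_series 0 = 0 \<and> BP_log oo BP_fps_to_BPQ two_series = 2 * BP_log"
proof -
  have "\<exists>!G. fps_nth G 0 = 0 \<and> BP_log oo BP_fps_to_BPQ G = 2 * BP_log"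
  proof (rule ex_ex1I)
    show "\<exists>G. fps_nth G 0 = 0 \<and> BP_log oo BP_fps_to_BPQ G = 2 * BP_log"
      by (rule two_series_exists)
    fix G H
    assume "fps_nth G 0 = 0 \<and> BP_log oo BP_fps_to_BPQ G = 2 * BP_log"
      "fps_nth H 0 = 0 \<and> BP_log oo BP_fps_to_BPQ H = 2 * BP_log"
    then show "G = H" by (intro BP_log_compose_inject) simp_all
  qed
  then show ?thesis unfolding two_series_def fps_map_def by (rule theI')
qed

section \<open>The two-series modulo the square of the ideal\<close>

text \<open>Let \<open>\<gamma>\<close> be the rescaled two-series. In its recursion
\<open>\<gamma>\<^sub>N = 2 \<mu>\<^sub>N - \<Sum>\<^sub>n\<^sub>\<ge>\<^sub>1 M\<^sub>n (\<gamma>^(2^n))\<^sub>N\<close> all \<open>M\<^sub>n\<close> are integral. If the earlier coefficients of \<open>\<gamma>\<close> are even, then the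
powers contribute multiples of \<open>4\<close>, so inductively \<open>\<gamma>\<^sub>N \<equiv> 2 \<mu>\<^sub>N\<close> modulo \<open>4\<close>. Since
\<open>M\<^sub>n \<equiv> v\<^sub>n\<close> modulo \<open>2\<close> for \<open>n \<ge> 1\<close>, this is the rescaling of \<open>v\<^sub>n\<close> when \<open>N = 2^n\<close>. For \<open>n = 0\<close>, where \<open>v\<^sub>0 = 2\<close> is not
rescaled, one has \<open>M\<^sub>0 = 1\<close>.\<close>

lemma rescale_two_coeff:
  "4 dvd rescale (two_coeff j - (\<Sum>n | j + 1 = 2 ^ n. v_gen n))"
proof -
  have "\<exists>M. \<forall>n. BP_to_BPQ (M n) = rescale (log_coeff n) \<and> (n \<ge> 1 \<longrightarrow> 2 dvd M n - v_gen n)"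
    by (rule choice, rule allI, rule rescale_log_coeff)
  then obtain M where M: "\<And>n. BP_to_BPQ (M n) = rescale (log_coeff n)"
    and Mv: "\<And>n. n \<ge> 1 \<Longrightarrow> 2 dvd M n - v_gen n"
    by blast
  define \<mu> where "\<mu> N = (\<Sum>n | N = 2 ^ n. M n)" for N :: nat
  define \<gamma> where "\<gamma> = fps_map rescale two_series"
  interpret R: ring_morphism "fps_map rescale :: BP fps \<Rightarrow> BP fps"
    by (rule ring_morphism_fps_map) (rule rescale.ring_morphism_axioms)
  have G0: "fps_nth two_series 0 = 0" using two_series_spec by simp
  have \<gamma>0: "fps_nth \<gamma> 0 = 0" by (simp add: \<gamma>_def fps_map_nth G0 rescale.hom_zero)
  have \<gamma>_power: "rescale (fps_nth (BP_fps_to_BPQ two_series ^ m) N) = BP_to_BPQ (fps_nth (\<gamma> ^ m) N)" for m N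
    unfolding \<gamma>_def R.hom_power[symmetric] BPQ_fps.hom_power[symmetric] fps_map_nth
    by (rule BP_to_BPQ_rescale[symmetric])
  have rec: "fps_nth \<gamma> N = 2 * \<mu> N - (\<Sum>n=1..N. M n * fps_nth (\<gamma> ^ (2 ^ n)) N)" for N
  proof -
    define S where "S = (\<Sum>n=1..N. log_coeff n * fps_nth (BP_fps_to_BPQ two_series ^ (2 ^ n)) N)"
    have "fps_nth (BP_log oo BP_fps_to_BPQ two_series) N
      = fps_nth (BP_fps_to_BPQ two_series) N + S"
      unfolding S_def
      by (rule BP_log_compose_nth_split) (simp_all add: fps_map_nth G0 BPQ.hom_zero)
    then have "2 * fps_nth BP_log N = fps_nth (BP_fps_to_BPQ two_series) N + S"
      using two_series_spec by (simp only: fps_two_times_nth)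
    then have "BP_to_BPQ (fps_nth two_series N) = 2 * fps_nth BP_log N - S"
      by (simp add: fps_map_nth)
    then have "rescale (BP_to_BPQ (fps_nth two_series N)) = rescale (2 * fps_nth BP_log N - S)"
      by (rule arg_cong)
    also have "\<dots> = 2 * rescale (fps_nth BP_log N) - rescale S"
      by (simp only: rescale.hom_diff rescale.hom_mult rescale.hom_numeral)
    also have "rescale (fps_nth BP_log N) = BP_to_BPQ (\<mu> N)"
      by (simp only: BP_log_nth \<mu>_def rescale.hom_sum BPQ.hom_sum M)
    also have "rescale S = BP_to_BPQ (\<Sum>n=1..N. M n * fps_nth (\<gamma> ^ (2 ^ n)) N)"
      by (simp only: S_def rescale.hom_sum rescale.hom_mult \<gamma>_power BPQ.hom_sum BPQ.hom_mult M)
    finally have "BP_to_BPQ (fps_nth \<gamma> N)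
      = BP_to_BPQ (2 * \<mu> N - (\<Sum>n=1..N. M n * fps_nth (\<gamma> ^ (2 ^ n)) N))"
      by (simp only: \<gamma>_def fps_map_nth BP_to_BPQ_rescale BPQ.hom_diff BPQ.hom_mult BPQ.hom_numeral)
    then show ?thesis by (simp only: BP_to_BPQ_eq_iff)
  qed
  have four: "4 dvd fps_nth \<gamma> N - 2 * \<mu> N" for N
  proof (induction N rule: less_induct)
    case (less N)
    \<comment> \<open>The part of \<open>\<gamma>\<close> that has been treated already.\<close>
    define \<delta> where "\<delta> = Abs_fps (\<lambda>i. if i < N then fps_nth \<gamma> i else 0)"
    have "2 dvd fps_nth \<gamma> i" if "i < N" for i
    proof -
      from less[OF that] obtain c where "fps_nth \<gamma> i - 2 * \<mu> i = 4 * c" by (rule dvdE)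
      then have "fps_nth \<gamma> i = 2 * (\<mu> i + 2 * c)" by (simp add: algebra_simps)
      then show ?thesis by (simp only: dvd_triv_left)
    qed
    then have "2 dvd \<delta>" unfolding fps_two_dvd_iff by (simp add: \<delta>_def)
    then obtain \<epsilon> where \<epsilon>: "\<delta> = 2 * \<epsilon>" by (rule dvdE)
    have "4 dvd M n * fps_nth (\<gamma> ^ (2 ^ n)) N" if n: "n \<in> {1..N}" for n
    proof -
      have "(2::nat) ^ 1 \<le> 2 ^ n" using n by (intro power_increasing) auto
      then have two: "(2::nat) \<le> 2 ^ n" by simp
      then obtain e where e: "(2::nat) ^ n = 2 + e" by (metis le_Suc_ex)
      have "fps_nth (\<gamma> ^ (2 ^ n)) N = fps_nth (\<delta> ^ (2 ^ n)) N"
        by (rule fps_power_nth_cong_strict) (use \<gamma>0 two in \<open>auto simp: \<delta>_def\<close>)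
      also have "\<delta> ^ (2 ^ n) = 2 * (2 * (2 ^ e * \<epsilon> ^ (2 ^ n)))"
        unfolding \<epsilon> power_mult_distrib by (simp only: e power_add power2_eq_square mult.assoc)
      also have "fps_nth \<dots> N = 2 * (2 * fps_nth (2 ^ e * \<epsilon> ^ (2 ^ n)) N)"
        by (simp only: fps_two_times_nth)
      also have "\<dots> = 4 * fps_nth (2 ^ e * \<epsilon> ^ (2 ^ n)) N" by simp
      finally show ?thesis by (simp only: dvd_mult dvd_triv_left)
    qed
    then have "4 dvd (\<Sum>n=1..N. M n * fps_nth (\<gamma> ^ (2 ^ n)) N)" by (rule dvd_sum)
    then show ?case using rec[of N] by simp
  qed
  have v: "4 dvd 2 * M n - rescale (v_gen n)" for n
  proof (cases "n \<ge> 1")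
    case True
    from Mv[OF this] obtain c where "M n - v_gen n = 2 * c" by (rule dvdE)
    then have "2 * M n - rescale (v_gen n) = 4 * c"
      by (simp add: rescale_v_gen[OF True] right_diff_distrib[symmetric])
    then show ?thesis by simp
  next
    case False
    then have n: "n = 0" by simp
    have "BP_to_BPQ (M 0) = BP_to_BPQ 1"
      by (simp only: M log_coeff_0 rescale.hom_one BPQ.hom_one)
    then have "M 0 = 1" by (simp only: BP_to_BPQ_eq_iff)
    then show ?thesis by (simp add: n v_gen_def rescale.hom_numeral)
  qed
  have "rescale (two_coeff j - (\<Sum>n | j + 1 = 2 ^ n. v_gen n))
    = (fps_nth \<gamma> (j + 1) - 2 * \<mu> (j + 1)) + (\<Sum>n | j + 1 = 2 ^ n. 2 * M n - rescale (v_gen n))"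
    by (simp add: two_coeff_def \<gamma>_def fps_map_nth \<mu>_def rescale.hom_diff rescale.hom_sum
        sum_subtractf sum_distrib_left)
  moreover have "4 dvd (\<Sum>n | j + 1 = 2 ^ n. 2 * M n - rescale (v_gen n))"
    using v by (intro dvd_sum)
  ultimately show ?thesis using four[of "j + 1"] by (simp only: dvd_add)
qed

text \<open>Divisibility by \<open>4\<close> after rescaling puts \<open>c\<close> into the square of the ideal: a constant term is then divisible
by \<open>v\<^sub>0\<^sup>2\<close>, a coefficient of \<open>v\<^sub>m\<close> by \<open>v\<^sub>0\<close>, and every other monomial contains two variables.\<close>

lemma rescale_four_dvd_induct [consumes 1, case_names zero add gens]:
  assumes c: "4 dvd rescale (c :: BP)"
    and zero: "P 0" and add: "\<And>a b. P a \<Longrightarrow> P b \<Longrightarrow> P (a + b)"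
    and gens: "\<And>i j a. P (v_gen i * v_gen j * a)"
  shows "P c"
proof -
  have z2loc_cancel: "a = b" if "2 * a = 2 * b" for a b :: z2loc
  proof -
    have "rat_of_z2loc (2 * a) = rat_of_z2loc (2 * b)" using that by simp
    then have "rat_of_z2loc a = rat_of_z2loc b" by (simp add: z2loc.hom_mult z2loc.hom_numeral)
    then show ?thesis by (simp add: rat_of_z2loc_inject)
  qed
  obtain d where d: "rescale c = 4 * d" using c by (rule dvdE)
  have four_times: "Poly_Mapping.lookup (4 * d) E = 4 * Poly_Mapping.lookup d E" for E
  proof -
    have "4 * d = Poly_Mapping.map ((*) 4) d"
      unfolding mult_map_scale_conv_mult single_numeral ..
    then show ?thesis by (simp add: Poly_Mapping.map.rep_eq when_def)
  qed
  have split_var: "\<exists>m F. E = Poly_Mapping.single m 1 + F" if E: "E \<noteq> 0" for E :: "nat \<Rightarrow>\<^sub>0 nat"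
  proof -
    from E obtain m where m: "Poly_Mapping.lookup E m \<noteq> 0"
      by (metis lookup_zero poly_mapping_eqI)
    have "E = Poly_Mapping.single m 1 + (E - Poly_Mapping.single m 1)"
      by (rule poly_mapping_eqI) (use m in \<open>auto simp: lookup_add lookup_minus lookup_single when_def\<close>)
    then show ?thesis by blast
  qed
  have "P (Poly_Mapping.single E (Poly_Mapping.lookup c E))" for E
  proof -
    define e where "e = Poly_Mapping.lookup c E"
    have "Poly_Mapping.lookup (4 * d) E = 4 * Poly_Mapping.lookup d E"
      by (rule four_times)
    then have e: "2 ^ mono_deg E * e = 4 * Poly_Mapping.lookup d E"
      unfolding e_def lookup_rescale[symmetric] d .
    show ?thesis
    proof (cases "E = 0")
      case True
      then have "e = 4 * Poly_Mapping.lookup d E" using e by (simp add: mono_deg_0)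
      then have "Poly_Mapping.single E e = v_gen 0 * v_gen 0 * Poly_Mapping.single E (Poly_Mapping.lookup d E)"
        by (simp add: v_gen_def mult_single flip: single_numeral)
      then show ?thesis using gens e_def by simp
    next
      case False
      then obtain m F where E: "E = Poly_Mapping.single m 1 + F" using split_var by blast
      show ?thesis
      proof (cases "F = 0")
        case True
        then have "2 * e = 2 * (2 * Poly_Mapping.lookup d E)"
          using e by (simp add: E mono_deg_single)
        then have "e = 2 * Poly_Mapping.lookup d E" by (rule z2loc_cancel)
        then have "Poly_Mapping.single E e
          = v_gen (Suc m) * v_gen 0 * Poly_Mapping.single 0 (Poly_Mapping.lookup d E)"
          using True by (simp add: E v_gen_def mult_single flip: single_numeral)
        then show ?thesis using gens e_def by simp
      next
        case False
        then obtain m' F' where F: "F = Poly_Mapping.single m' 1 + F'" using split_var by blast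
        have "Poly_Mapping.single E e = v_gen (Suc m) * v_gen (Suc m') * Poly_Mapping.single F' e"
          by (simp add: E F v_gen_def mult_single add.assoc)
        then show ?thesis using gens e_def by simp
      qed
    qed
  qed
  then have "P (\<Sum>E\<in>A. Poly_Mapping.single E (Poly_Mapping.lookup c E))" for A
    by (induction A rule: infinite_finite_induct) (auto intro: zero add)
  then show ?thesis using poly_mapping_sum_single[of c] by metis
qed

section \<open>Dickson relations and alternants in characteristic two\<close>

lemma char_two_square_sum:
  fixes g :: "'i \<Rightarrow> 'r::comm_ring_1"
  assumes "\<And>r :: 'r. r + r = 0"
  shows "(\<Sum>i\<in>A. g i)\<^sup>2 = (\<Sum>i\<in>A. (g i)\<^sup>2)"
proof (induction A rule: infinite_finite_induct)
  case (insert a A)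
  have "(g a + sum g A)\<^sup>2 = (g a)\<^sup>2 + (sum g A)\<^sup>2 + (g a * sum g A + g a * sum g A)"
    by (simp add: power2_eq_square algebra_simps)
  then show ?case using insert assms by simp
qed simp_all

text \<open>Let \<open>f\<^sub>S(T) = T^(2^n) + \<Sum>\<^sub>j\<^sub><\<^sub>n c\<^sub>j T^(2^j)\<close> vanish at \<open>y\<^sub>m\<close> for all \<open>m \<in> S\<close>, \<open>n = card S\<close>. Then
\<open>f\<^sub>S(T)\<^sup>2 + f\<^sub>S(y\<^sub>a) f\<^sub>S(T)\<close> vanishes in addition at \<open>y\<^sub>a\<close>, and it is again a sum of terms with exponents \<open>2^j\<close>,
because squaring is additive in characteristic two.\<close>

lemma dickson_relation:
  fixes y :: "'m \<Rightarrow> 'r::comm_ring_1"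
  assumes char2: "\<And>r :: 'r. r + r = 0" and "finite S"
  shows "\<exists>c. \<forall>m\<in>S. y m ^ (2 ^ card S) = (\<Sum>j<card S. c j * y m ^ (2 ^ j))"
  using \<open>finite S\<close>
proof (induction S rule: finite_induct)
  case empty
  then show ?case by simp
next
  case (insert a S)
  define n where "n = card S"
  from insert obtain c where c: "\<And>m. m \<in> S \<Longrightarrow> y m ^ (2 ^ n) = (\<Sum>j<n. c j * y m ^ (2 ^ j))"
    unfolding n_def by blast
  define f where "f t = t ^ (2 ^ n) + (\<Sum>j<n. c j * t ^ (2 ^ j))" for t
  define e where "e = f (y a)"
  define c' where "c' j = (if j = 0 then 0 else (c (j - 1))\<^sup>2) + (if j < n then e * c j else e)" for j
  have f_square: "(f t)\<^sup>2 = t ^ (2 ^ Suc n) + (\<Sum>j<n. (c j)\<^sup>2 * t ^ (2 ^ Suc j))" for t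
  proof -
    have pow: "(t ^ (2 ^ j))\<^sup>2 = t ^ (2 ^ Suc j)" for j unfolding power_Suc2 power_mult ..
    define s where "s = (\<Sum>j<n. c j * t ^ (2 ^ j))"
    have "(f t)\<^sup>2 = (t ^ (2 ^ n))\<^sup>2 + s\<^sup>2 + (t ^ (2 ^ n) * s + t ^ (2 ^ n) * s)"
      by (simp add: f_def s_def power2_eq_square algebra_simps)
    also have "\<dots> = (t ^ (2 ^ n))\<^sup>2 + s\<^sup>2" by (simp only: char2 add_0_right)
    also have "s\<^sup>2 = (\<Sum>j<n. (c j)\<^sup>2 * (t ^ (2 ^ j))\<^sup>2)"
      unfolding s_def by (simp only: char_two_square_sum[OF char2] power_mult_distrib)
    finally show ?thesis by (simp only: pow)
  qed
  have "y m ^ (2 ^ Suc n) = (\<Sum>j<Suc n. c' j * y m ^ (2 ^ j))" if m: "m \<in> insert a S" for m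
  proof -
    define t where "t = y m"
    have "(f t)\<^sup>2 + e * f t = 0"
    proof (cases "m = a")
      case True
      then show ?thesis by (simp add: t_def e_def power2_eq_square char2)
    next
      case False
      then have "f t = 0" using m c[of m] by (simp add: f_def t_def char2)
      then show ?thesis by simp
    qed
    have "(\<Sum>j<Suc n. c' j * t ^ (2 ^ j))
      = (\<Sum>j<Suc n. (if j = 0 then 0 else (c (j - 1))\<^sup>2) * t ^ (2 ^ j))
        + (\<Sum>j<Suc n. (if j < n then e * c j else e) * t ^ (2 ^ j))"
      by (simp only: c'_def distrib_right sum.distrib)
    also have "(\<Sum>j<Suc n. (if j = 0 then 0 else (c (j - 1))\<^sup>2) * t ^ (2 ^ j))
      = (\<Sum>j<n. (c j)\<^sup>2 * t ^ (2 ^ Suc j))"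
      by (simp only: sum.lessThan_Suc_shift) simp
    also have "(\<Sum>j<Suc n. (if j < n then e * c j else e) * t ^ (2 ^ j)) = e * f t"
      by (simp add: f_def distrib_left sum_distrib_left mult.assoc add.commute)
    finally have "t ^ (2 ^ Suc n) + (\<Sum>j<Suc n. c' j * t ^ (2 ^ j)) = (f t)\<^sup>2 + e * f t"
      unfolding f_square by (simp only: add.assoc)
    then have "t ^ (2 ^ Suc n) + (\<Sum>j<Suc n. c' j * t ^ (2 ^ j)) = 0"
      using \<open>(f t)\<^sup>2 + e * f t = 0\<close> by simp
    then have "t ^ (2 ^ Suc n) = - (\<Sum>j<Suc n. c' j * t ^ (2 ^ j))"
      by (simp only: eq_neg_iff_add_eq_0)
    also have "\<dots> = (\<Sum>j<Suc n. c' j * t ^ (2 ^ j))"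
      using char2 by (simp only: neg_eq_iff_add_eq_0)
    finally show ?thesis unfolding t_def .
  qed
  moreover have "card (insert a S) = Suc n" using insert by (simp add: n_def)
  ultimately show ?case by (intro exI[of _ c']) simp
qed

text \<open>Squaring the relation for \<open>l\<close> raises every exponent \<open>2^j\<close> to \<open>2^(j+1)\<close>; the only one out of range is
\<open>2^(card S)\<close>, and it is reduced by \<open>dickson_relation\<close>.\<close>

lemma dickson_relation_higher:
  fixes y :: "'m \<Rightarrow> 'r::comm_ring_1"
  assumes char2: "\<And>r :: 'r. r + r = 0" and "finite S" and "card S \<le> l"
  shows "\<exists>c. \<forall>m\<in>S. y m ^ (2 ^ l) = (\<Sum>j<card S. c j * y m ^ (2 ^ j))"
  using \<open>card S \<le> l\<close>
proof (induction l rule: nat_induct_at_least)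
  case base
  then show ?case by (rule dickson_relation[OF char2 \<open>finite S\<close>])
next
  case (Suc l)
  from Suc obtain c where c: "\<And>m. m \<in> S \<Longrightarrow> y m ^ (2 ^ l) = (\<Sum>j<card S. c j * y m ^ (2 ^ j))" by blast
  from dickson_relation[OF char2 \<open>finite S\<close>] obtain b
    where b: "\<And>m. m \<in> S \<Longrightarrow> y m ^ (2 ^ card S) = (\<Sum>j<card S. b j * y m ^ (2 ^ j))" by blast
  show ?case
  proof (cases "card S")
    case 0
    then show ?thesis using \<open>finite S\<close> by simp
  next
    case (Suc n)
    define d where "d j = (if j = 0 then 0 else (c (j - 1))\<^sup>2) + (c n)\<^sup>2 * b j" for j
    have "y m ^ (2 ^ Suc l) = (\<Sum>j<card S. d j * y m ^ (2 ^ j))" if m: "m \<in> S" for m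
    proof -
      have pow: "(y m ^ (2 ^ j))\<^sup>2 = y m ^ (2 ^ Suc j)" for j unfolding power_Suc2 power_mult ..
      have "y m ^ (2 ^ Suc l) = (\<Sum>j<card S. c j * y m ^ (2 ^ j))\<^sup>2"
        unfolding pow[symmetric] c[OF m] ..
      also have "\<dots> = (\<Sum>j<Suc n. (c j)\<^sup>2 * y m ^ (2 ^ Suc j))"
        by (simp only: char_two_square_sum[OF char2] power_mult_distrib pow Suc)
      also have "\<dots> = (\<Sum>j<n. (c j)\<^sup>2 * y m ^ (2 ^ Suc j)) + (c n)\<^sup>2 * y m ^ (2 ^ card S)"
        by (simp only: sum.lessThan_Suc Suc)
      also have "(\<Sum>j<n. (c j)\<^sup>2 * y m ^ (2 ^ Suc j))
        = (\<Sum>j<card S. (if j = 0 then 0 else (c (j - 1))\<^sup>2) * y m ^ (2 ^ j))"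
        unfolding Suc by (simp only: sum.lessThan_Suc_shift) simp
      also have "(c n)\<^sup>2 * y m ^ (2 ^ card S) = (\<Sum>j<card S. (c n)\<^sup>2 * b j * y m ^ (2 ^ j))"
        by (simp only: b[OF m] sum_distrib_left mult.assoc)
      finally show ?thesis by (simp only: d_def distrib_right sum.distrib)
    qed
    then show ?thesis by blast
  qed
qed

definition numberings :: "('k::finite \<Rightarrow> nat) set" where
  "numberings = {\<sigma>. bij_betw \<sigma> UNIV {..<CARD('k)}}"

lemma finite_numberings: "finite (numberings :: ('k::finite \<Rightarrow> nat) set)"
proof (rule finite_subset)
  show "numberings \<subseteq> {\<sigma> :: 'k \<Rightarrow> nat. range \<sigma> \<subseteq> {..<CARD('k)}}"
    by (auto simp: numberings_def bij_betw_def)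
  have "{\<sigma> :: 'k \<Rightarrow> nat. range \<sigma> \<subseteq> {..<CARD('k)}} = {\<sigma>. \<forall>x. (x \<in> UNIV \<longrightarrow> \<sigma> x \<in> {..<CARD('k)}) \<and> (x \<notin> UNIV \<longrightarrow> \<sigma> x = 0)}"
    by auto
  then show "finite {\<sigma> :: 'k \<Rightarrow> nat. range \<sigma> \<subseteq> {..<CARD('k)}}"
    using finite_set_of_finite_funs[of "UNIV :: 'k set" "{..<CARD('k)}" 0] by simp
qed

text \<open>In characteristic two this sum without signs is the determinant of the matrix whose rows are
indexed by \<open>'k\<close> and whose \<open>i\<close>-th column has the entries \<open>a m (\<tau> i)\<close>.\<close>

definition alternant :: "('k::finite \<Rightarrow> nat \<Rightarrow> 'r::comm_ring_1) \<Rightarrow> (nat \<Rightarrow> nat) \<Rightarrow> 'r" where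
  "alternant a \<tau> = (\<Sum>\<sigma>\<in>numberings. \<Prod>m\<in>UNIV. a m (\<tau> (\<sigma> m)))"

definition cofactor :: "('k::finite \<Rightarrow> nat \<Rightarrow> 'r::comm_ring_1) \<Rightarrow> nat \<Rightarrow> 'k \<Rightarrow> 'r" where
  "cofactor a j m = (\<Sum>\<sigma> | \<sigma> \<in> numberings \<and> \<sigma> m = j. \<Prod>n\<in>UNIV - {m}. a n (\<sigma> n))"

text \<open>Expansion along column \<open>j\<close>: every bijection \<open>\<sigma>\<close> is counted at the one row \<open>m\<close> with \<open>\<sigma> m = j\<close>.\<close>

lemma cofactor_expansion:
  fixes a :: "'k::finite \<Rightarrow> nat \<Rightarrow> 'r::comm_ring_1"
  assumes "j < CARD('k)"
  shows "(\<Sum>m\<in>UNIV. cofactor a j m * a m l) = alternant a (id(j := l))"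
proof -
  have "(\<Sum>m\<in>UNIV. cofactor a j m * a m l)
    = (\<Sum>m\<in>UNIV. \<Sum>\<sigma> | \<sigma> \<in> numberings \<and> \<sigma> m = j. \<Prod>n\<in>UNIV. a n ((id(j := l)) (\<sigma> n)))"
  proof (rule sum.cong[OF refl])
    fix m :: 'k
    have "(\<Prod>n\<in>UNIV - {m}. a n (\<sigma> n)) * a m l = (\<Prod>n\<in>UNIV. a n ((id(j := l)) (\<sigma> n)))"
      if \<sigma>: "\<sigma> \<in> numberings" "\<sigma> m = j" for \<sigma>
    proof -
      have "inj \<sigma>" using \<sigma>(1) by (auto simp: numberings_def bij_betw_def)
      then have "\<sigma> n \<noteq> j" if "n \<noteq> m" for n using \<sigma>(2) that by (auto dest: injD)
      then have "(\<Prod>n\<in>UNIV - {m}. a n (\<sigma> n)) = (\<Prod>n\<in>UNIV - {m}. a n ((id(j := l)) (\<sigma> n)))"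
        by (intro prod.cong refl) simp
      then show ?thesis
        using \<sigma>(2) by (subst prod.remove[of UNIV m]) (simp_all add: mult.commute)
    qed
    then show "cofactor a j m * a m l
      = (\<Sum>\<sigma> | \<sigma> \<in> numberings \<and> \<sigma> m = j. \<Prod>n\<in>UNIV. a n ((id(j := l)) (\<sigma> n)))"
      unfolding cofactor_def sum_distrib_right by (intro sum.cong refl) blast
  qed
  also have "\<dots> = (\<Sum>\<sigma>\<in>numberings. \<Sum>m | m \<in> UNIV \<and> \<sigma> m = j. \<Prod>n\<in>UNIV. a n ((id(j := l)) (\<sigma> n)))"
    by (rule sum.swap_restrict) (simp_all add: finite_numberings)
  also have "\<dots> = alternant a (id(j := l))"
    unfolding alternant_def
  proof (rule sum.cong[OF refl])
    fix \<sigma> :: "'k \<Rightarrow> nat" assume \<sigma>: "\<sigma> \<in> numberings"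
    then have "j \<in> range \<sigma>" "inj \<sigma>" using assms by (auto simp: numberings_def bij_betw_def)
    then obtain m where m: "j = \<sigma> m" by (elim rangeE)
    then have "{m. m \<in> UNIV \<and> \<sigma> m = j} = {m}" using inj_eq[OF \<open>inj \<sigma>\<close>] by auto
    then show "(\<Sum>m | m \<in> UNIV \<and> \<sigma> m = j. \<Prod>n\<in>UNIV. a n ((id(j := l)) (\<sigma> n)))
      = (\<Prod>n\<in>UNIV. a n ((id(j := l)) (\<sigma> n)))" by simp
  qed
  finally show ?thesis .
qed

text \<open>Exchanging the numbers \<open>i\<close> and \<open>j\<close> is an involution on the bijections without fixed points. It preserves
the products, so they cancel in pairs. The pairs are separated by which of \<open>i\<close> and \<open>j\<close> comes first
in an arbitrary enumeration \<open>\<rho>\<close> of the rows.\<close>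

lemma alternant_repeated:
  fixes a :: "'k::finite \<Rightarrow> nat \<Rightarrow> 'r::comm_ring_1"
  assumes char2: "\<And>r :: 'r. r + r = 0"
    and "i < CARD('k)" "j < CARD('k)" "i \<noteq> j"
  shows "alternant a (id(j := i)) = 0"
proof -
  obtain \<rho> :: "'k \<Rightarrow> nat" where \<rho>: "inj \<rho>"
    using finite_imp_inj_to_nat_seg[of "UNIV :: 'k set"] by auto
  define t where "t = id(i := j, j := i)"
  have tt: "t (t n) = n" for n by (simp add: t_def)
  have bij_t: "bij_betw t {..<CARD('k)} {..<CARD('k)}"
    by (rule bij_betw_byWitness[of _ t]) (use assms in \<open>auto simp: t_def\<close>)
  have swap_in: "t \<circ> \<sigma> \<in> numberings" if "\<sigma> \<in> numberings" for \<sigma> :: "'k \<Rightarrow> nat"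
    using that bij_t by (auto simp: numberings_def intro: bij_betw_trans)
  define w where "w \<sigma> = (\<Prod>m\<in>UNIV. a m ((id(j := i)) (\<sigma> m)))" for \<sigma>
  have w_swap: "w (t \<circ> \<sigma>) = w \<sigma>" for \<sigma>
    unfolding w_def by (rule prod.cong) (auto simp: t_def)
  define pos where "pos \<sigma> n = \<rho> (inv \<sigma> n)" for \<sigma> :: "'k \<Rightarrow> nat" and n
  have pos_swap: "pos (t \<circ> \<sigma>) n = pos \<sigma> (t n)" if "\<sigma> \<in> numberings" "n < CARD('k)" for \<sigma> :: "'k \<Rightarrow> nat" and n
  proof -
    have \<sigma>: "bij_betw \<sigma> UNIV {..<CARD('k)}" using that by (simp add: numberings_def)
    have tn: "t n < CARD('k)" using bij_t that(2) by (auto simp: bij_betw_def)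
    then obtain m where m: "\<sigma> m = t n" using \<sigma> unfolding bij_betw_def by (metis imageE lessThan_iff)
    have "inj \<sigma>" using \<sigma> by (simp add: bij_betw_def)
    moreover have "inj (t \<circ> \<sigma>)" using swap_in[OF that(1)] by (simp add: numberings_def bij_betw_def)
    moreover have "(t \<circ> \<sigma>) m = n" using m tt by simp
    ultimately show ?thesis unfolding pos_def using m by (metis inv_f_f)
  qed
  have pos_neq: "pos \<sigma> i \<noteq> pos \<sigma> j" if "\<sigma> \<in> numberings" for \<sigma> :: "'k \<Rightarrow> nat"
  proof
    assume "pos \<sigma> i = pos \<sigma> j"
    then have eq: "inv \<sigma> i = inv \<sigma> j" using \<rho> by (simp add: pos_def inj_eq)
    have "i \<in> range \<sigma>" "j \<in> range \<sigma>" using that assms by (auto simp: numberings_def bij_betw_def)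
    then show False using eq assms(4) by (metis f_inv_into_f)
  qed
  define A B where "A = {\<sigma> :: 'k \<Rightarrow> nat. \<sigma> \<in> numberings \<and> pos \<sigma> i < pos \<sigma> j}"
    and "B = {\<sigma> :: 'k \<Rightarrow> nat. \<sigma> \<in> numberings \<and> pos \<sigma> j < pos \<sigma> i}"
  have fin: "finite A" "finite B" unfolding A_def B_def
    by (auto intro: finite_subset[OF _ finite_numberings])
  have split: "numberings = A \<union> B" "A \<inter> B = {}"
    unfolding A_def B_def using pos_neq by (auto simp: neq_iff)
  have ti: "t i = j" "t j = i" by (auto simp: t_def)
  have "sum w B = sum w A"
  proof (rule sum.reindex_bij_witness[of _ "\<lambda>\<sigma>. t \<circ> \<sigma>" "\<lambda>\<sigma>. t \<circ> \<sigma>"])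
    fix \<sigma> assume "\<sigma> \<in> B"
    then show "t \<circ> \<sigma> \<in> A"
      using swap_in pos_swap assms ti by (simp add: A_def B_def)
  next
    fix \<sigma> assume "\<sigma> \<in> A"
    then show "t \<circ> \<sigma> \<in> B"
      using swap_in pos_swap assms ti by (simp add: A_def B_def)
  qed (simp_all add: tt fun_eq_iff w_swap)
  then show ?thesis
    unfolding alternant_def w_def[symmetric]
    by (simp add: split sum.union_disjoint[OF fin split(2)] char2)
qed

text \<open>Determinants are linear in column \<open>j\<close>, and only the multiple of the \<open>j\<close>-th column itself does not
repeat another column.\<close>

lemma alternant_substitute:
  fixes a :: "'k::finite \<Rightarrow> nat \<Rightarrow> 'r::comm_ring_1"
  assumes char2: "\<And>r :: 'r. r + r = 0" and j: "j < CARD('k)"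
    and rel: "\<And>m. a m l = (\<Sum>i<CARD('k). c i * a m i)"
  shows "alternant a (id(j := l)) = c j * alternant a id"
proof -
  have "alternant a (id(j := l)) = (\<Sum>m\<in>UNIV. \<Sum>i<CARD('k). c i * (cofactor a j m * a m i))"
    unfolding cofactor_expansion[OF j, symmetric] rel sum_distrib_left
    by (simp only: mult.left_commute)
  also have "\<dots> = (\<Sum>i<CARD('k). c i * alternant a (id(j := i)))"
    unfolding cofactor_expansion[OF j, symmetric] sum_distrib_left by (rule sum.swap)
  also have "\<dots> = (\<Sum>i<CARD('k). if i = j then c j * alternant a id else 0)"
    by (rule sum.cong[OF refl]) (auto simp: alternant_repeated[OF char2 _ j] fun_upd_idem)
  finally show ?thesis using j by simp
qed

section \<open>The monomial symmetric polynomials as alternants\<close>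

lemma bit_poly_char_two: "(p :: 'a \<Rightarrow>\<^sub>0 bit) + p = 0"
proof (rule poly_mapping_eqI)
  fix k
  show "Poly_Mapping.lookup (p + p) k = Poly_Mapping.lookup 0 k"
    by (cases "Poly_Mapping.lookup p k") (simp_all add: lookup_add)
qed

definition var :: "'k \<Rightarrow> 'k F2poly" where
  "var m = Poly_Mapping.single (Poly_Mapping.single m 1) 1"

definition var_power :: "'k \<Rightarrow> nat \<Rightarrow> 'k F2poly" where
  "var_power m l = var m ^ (2 ^ l)"

lemma var_pow: "var m ^ n = Poly_Mapping.single (Poly_Mapping.single m n) 1"
  by (induction n) (simp_all add: var_def mult_single flip: single_add)

lemma prod_single_one:
  "(\<Prod>m\<in>A. Poly_Mapping.single (e m) (1::'b::comm_semiring_1)) = Poly_Mapping.single (\<Sum>m\<in>A. e m) 1"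
  by (induction A rule: infinite_finite_induct) (simp_all add: mult_single)

lemma lookup_sum_single_UNIV:
  "Poly_Mapping.lookup (\<Sum>m\<in>UNIV. Poly_Mapping.single (m::'k::finite) (e m)) n = e n"
  by (simp add: lookup_sum lookup_single when_def)

lemma image_mset_mset_set_eq_iff:
  fixes f :: "'k::finite \<Rightarrow> 'a"
  assumes "card S = CARD('k)" "finite S"
  shows "image_mset f (mset_set UNIV) = mset_set S \<longleftrightarrow> bij_betw f UNIV S"
proof
  assume *: "image_mset f (mset_set UNIV) = mset_set S"
  then have "set_mset (image_mset f (mset_set UNIV)) = set_mset (mset_set S)" by simp
  then have "range f = S" using assms by simp
  moreover have "inj f" using \<open>range f = S\<close> assms by (simp add: eq_card_imp_inj_on)
  ultimately show "bij_betw f UNIV S" by (simp add: bij_betw_def)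
next
  assume "bij_betw f UNIV S"
  then show "image_mset f (mset_set UNIV) = mset_set S"
    by (auto simp: bij_betw_def image_mset_mset_set)
qed

text \<open>If the exponents \<open>2^(\<tau> i)\<close> are pairwise distinct, the monomials in the symmetric polynomial are the
bijective assignments of these exponents to the variables.\<close>

lemma mono_sym_eq_alternant:
  assumes inj: "inj_on \<tau> {..<CARD('k)}"
    and ts: "mset ts = mset (map (\<lambda>i. 2 ^ \<tau> i) [0..<CARD('k)])"
  shows "(mono_sym ts :: 'k::finite F2poly) = alternant var_power \<tau>"
proof -
  define g where "g i = (2::nat) ^ \<tau> i" for i
  define S where "S = g ` {..<CARD('k)}"
  have inj_g: "inj_on g {..<CARD('k)}" using inj by (auto simp: g_def inj_on_def)
  have S: "finite S" "card S = CARD('k)" by (simp_all add: S_def card_image[OF inj_g])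
  have "mset ts = image_mset g (mset_set {..<CARD('k)})"
    by (simp add: ts g_def[abs_def] lessThan_atLeast0)
  then have mset_ts: "mset ts = mset_set S" by (simp add: S_def image_mset_mset_set[OF inj_g])
  have "length ts = CARD('k)" using mset_eq_length[OF ts] by simp
  then have "(mono_sym ts :: 'k F2poly)
    = (\<Sum>E | bij_betw (Poly_Mapping.lookup E) (UNIV :: 'k set) S. Poly_Mapping.single E 1)"
    unfolding mono_sym_def mset_ts
    by (simp add: image_mset_mset_set_eq_iff[OF S(2,1)])
  also have "\<dots> = (\<Sum>\<sigma>\<in>numberings. Poly_Mapping.single (\<Sum>m\<in>(UNIV :: 'k set). Poly_Mapping.single m (g (\<sigma> m))) 1)"
  proof (rule sum.reindex_bij_witness[of _
      "\<lambda>\<sigma>. \<Sum>m\<in>UNIV. Poly_Mapping.single m (g (\<sigma> m))"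
      "\<lambda>E m. inv_into {..<CARD('k)} g (Poly_Mapping.lookup E m)"])
    fix E :: "'k \<Rightarrow>\<^sub>0 nat" assume "E \<in> {E. bij_betw (Poly_Mapping.lookup E) UNIV S}"
    then have E: "bij_betw (Poly_Mapping.lookup E) UNIV S" by simp
    then have in_S: "Poly_Mapping.lookup E m \<in> g ` {..<CARD('k)}" for m
      by (auto simp: bij_betw_def S_def)
    then have g_inv: "g (inv_into {..<CARD('k)} g (Poly_Mapping.lookup E m)) = Poly_Mapping.lookup E m" for m
      by (rule f_inv_into_f)
    show "(\<Sum>m\<in>UNIV. Poly_Mapping.single m (g (inv_into {..<CARD('k)} g (Poly_Mapping.lookup E m)))) = E"
      by (rule poly_mapping_eqI) (simp add: lookup_sum_single_UNIV g_inv)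
    then show "Poly_Mapping.single (\<Sum>m\<in>UNIV. Poly_Mapping.single m
        (g (inv_into {..<CARD('k)} g (Poly_Mapping.lookup E m)))) 1 = Poly_Mapping.single E (1::bit)"
      by simp
    have "bij_betw (inv_into {..<CARD('k)} g \<circ> Poly_Mapping.lookup E) UNIV {..<CARD('k)}"
      by (rule bij_betw_trans[OF E]) (simp add: S_def bij_betw_inv_into inj_g inj_on_imp_bij_betw)
    then show "(\<lambda>m. inv_into {..<CARD('k)} g (Poly_Mapping.lookup E m)) \<in> numberings"
      by (simp add: numberings_def comp_def)
  next
    fix \<sigma> :: "'k \<Rightarrow> nat" assume "\<sigma> \<in> numberings"
    then have \<sigma>: "bij_betw \<sigma> UNIV {..<CARD('k)}" by (simp add: numberings_def)
    then have "bij_betw (g \<circ> \<sigma>) UNIV S"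
      by (rule bij_betw_trans) (simp add: S_def inj_g inj_on_imp_bij_betw)
    then show "(\<Sum>m\<in>UNIV. Poly_Mapping.single m (g (\<sigma> m))) \<in> {E. bij_betw (Poly_Mapping.lookup E) UNIV S}"
      by (simp add: lookup_sum_single_UNIV[abs_def] comp_def)
    show "(\<lambda>m. inv_into {..<CARD('k)} g (Poly_Mapping.lookup
        (\<Sum>m\<in>UNIV. Poly_Mapping.single m (g (\<sigma> m))) m)) = \<sigma>"
    proof
      fix m
      have "\<sigma> m \<in> {..<CARD('k)}" using \<sigma> by (auto simp: bij_betw_def)
      then show "inv_into {..<CARD('k)} g (Poly_Mapping.lookup
        (\<Sum>m\<in>UNIV. Poly_Mapping.single m (g (\<sigma> m))) m) = \<sigma> m"
        by (simp add: lookup_sum_single_UNIV inv_into_f_f[OF inj_g])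
    qed
  qed
  also have "\<dots> = alternant var_power \<tau>"
    by (simp add: alternant_def var_power_def var_pow prod_single_one g_def)
  finally show ?thesis .
qed

lemma p_denominator_eq_alternant: "(p_denominator :: 'k::finite F2poly) = alternant var_power id"
  unfolding p_denominator_def by (rule mono_sym_eq_alternant) simp_all

lemma p_numerator_eq_alternant:
  assumes "j < CARD('k)" "l \<ge> CARD('k)"
  shows "(p_numerator l j :: 'k::finite F2poly) = alternant var_power (id(j := l))"
  unfolding p_numerator_def
proof (rule mono_sym_eq_alternant)
  show "inj_on (id(j := l)) {..<CARD('k)}" using assms by (auto simp: inj_on_def)
  define A where "A = mset_set ({0..<CARD('k)} - {j})"
  have "mset [0..<CARD('k)] = add_mset j A"
    unfolding A_def using assms by (simp add: mset_set.remove)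
  moreover have "{i \<in> {0..<CARD('k)}. i \<noteq> j} = {0..<CARD('k)} - {j}" by auto
  then have "mset (filter (\<lambda>i. i \<noteq> j) [0..<CARD('k)]) = A"
    by (simp add: A_def filter_mset_mset_set)
  moreover have "\<forall>i\<in>#A. i \<noteq> j" by (simp add: A_def)
  ultimately show "mset (map (\<lambda>i. 2 ^ i) (filter (\<lambda>i. i \<noteq> j) [0..<CARD('k)]) @ [2 ^ l])
    = mset (map (\<lambda>i. 2 ^ (id(j := l)) i) [0..<CARD('k)])"
    by (auto simp del: mset_upt mset_filter intro!: image_mset_cong)
qed

lemma p_denominator_nonzero: "(p_denominator :: 'k::finite F2poly) \<noteq> 0"
proof -
  let ?ts = "map (\<lambda>i. 2 ^ i) [0..<CARD('k)] :: nat list"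
  let ?A = "{E :: 'k \<Rightarrow>\<^sub>0 nat. image_mset (Poly_Mapping.lookup E) (mset_set UNIV)
            = mset ?ts + replicate_mset (CARD('k) - length ?ts) 0}"
  obtain \<sigma> :: "'k \<Rightarrow> nat" where \<sigma>: "bij_betw \<sigma> UNIV {0..<CARD('k)}"
    using ex_bij_betw_finite_nat[of "UNIV :: 'k set"] by auto
  define E0 where "E0 = (\<Sum>m\<in>UNIV. Poly_Mapping.single m ((2::nat) ^ \<sigma> m))"
  have "Poly_Mapping.lookup E0 = (\<lambda>i. 2 ^ i) \<circ> \<sigma>"
    by (simp add: E0_def lookup_sum_single_UNIV[abs_def] comp_def)
  then have "image_mset (Poly_Mapping.lookup E0) (mset_set UNIV)
    = image_mset (\<lambda>i. 2 ^ i) (image_mset \<sigma> (mset_set UNIV))"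
    by (simp add: image_mset.compositionality)
  also have "image_mset \<sigma> (mset_set UNIV) = mset_set {0..<CARD('k)}"
    using \<sigma> by (simp add: image_mset_mset_set_eq_iff)
  finally have E0: "E0 \<in> ?A" by simp
  have "finite ?A"
  proof (rule finite_subset)
    show "?A \<subseteq> Abs_poly_mapping ` {f. \<forall>x. (x \<in> UNIV \<longrightarrow> f x \<in> set ?ts) \<and> (x \<notin> UNIV \<longrightarrow> f x = 0)}"
    proof
      fix E assume "E \<in> ?A"
      then have *: "image_mset (Poly_Mapping.lookup E) (mset_set UNIV) = mset ?ts" by simp
      then have "set_mset (image_mset (Poly_Mapping.lookup E) (mset_set UNIV)) = set_mset (mset ?ts)"
        by (rule arg_cong)
      then have "range (Poly_Mapping.lookup E) = set ?ts" by simp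
      then have "Poly_Mapping.lookup E m \<in> set ?ts" for m by blast
      then show "E \<in> Abs_poly_mapping ` {f. \<forall>x. (x \<in> UNIV \<longrightarrow> f x \<in> set ?ts) \<and> (x \<notin> UNIV \<longrightarrow> f x = 0)}"
        by (intro image_eqI[of _ _ "Poly_Mapping.lookup E"]) (simp_all add: Poly_Mapping.lookup_inverse)
    qed
    show "finite (Abs_poly_mapping ` {f. \<forall>x. (x \<in> (UNIV :: 'k set) \<longrightarrow> f x \<in> set ?ts) \<and> (x \<notin> UNIV \<longrightarrow> f x = 0)})"
      by (rule finite_imageI, rule finite_set_of_finite_funs) simp_all
  qed
  then have "Poly_Mapping.lookup (p_denominator :: 'k F2poly) E0 = (\<Sum>E\<in>?A. 1 when E = E0)"
    unfolding p_denominator_def mono_sym_def by (simp only: lookup_sum lookup_single)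
  also have "\<dots> = 1" using \<open>finite ?A\<close> E0 by (simp add: when_def)
  finally show ?thesis by auto
qed

section \<open>Symmetry\<close>

lemma mono_sym_symmetric: "symmetric_poly (mono_sym ts :: 'k::finite F2poly)"
  unfolding symmetric_poly_def
proof (intro allI impI)
  fix \<pi> :: "'k \<Rightarrow> 'k" and E :: "'k \<Rightarrow>\<^sub>0 nat" assume \<pi>: "bij \<pi>"
  let ?A = "{E :: 'k \<Rightarrow>\<^sub>0 nat. image_mset (Poly_Mapping.lookup E) (mset_set UNIV)
            = mset ts + replicate_mset (CARD('k) - length ts) 0}"
  have "image_mset (Poly_Mapping.lookup (Poly_Mapping.map_key \<pi> E)) (mset_set UNIV)
    = image_mset (Poly_Mapping.lookup E) (image_mset \<pi> (mset_set UNIV))"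
    by (simp add: map_key.rep_eq[OF bij_is_inj[OF \<pi>]] image_mset.compositionality)
  also have "image_mset \<pi> (mset_set UNIV) = mset_set UNIV"
    using \<pi> by (simp add: image_mset_mset_set_eq_iff)
  finally have iff: "Poly_Mapping.map_key \<pi> E \<in> ?A \<longleftrightarrow> E \<in> ?A" by simp
  have lookup: "Poly_Mapping.lookup (mono_sym ts) F = (if finite ?A \<and> F \<in> ?A then 1 else 0)"
    for F :: "'k \<Rightarrow>\<^sub>0 nat"
  proof (cases "finite ?A")
    case True
    have "Poly_Mapping.lookup (mono_sym ts) F = (\<Sum>E\<in>?A. 1 when E = F)"
      unfolding mono_sym_def by (simp only: lookup_sum lookup_single)
    then show ?thesis using True by (simp add: when_def)
  next
    case False
    then show ?thesis unfolding mono_sym_def by simp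
  qed
  show "Poly_Mapping.lookup (mono_sym ts) (Poly_Mapping.map_key \<pi> E)
    = Poly_Mapping.lookup (mono_sym ts) E"
    unfolding lookup using iff by simp
qed

definition rename_vars :: "('k \<Rightarrow> 'k) \<Rightarrow> 'k F2poly \<Rightarrow> 'k F2poly" where
  "rename_vars \<pi> = monomial_ext (\<lambda>E c. Poly_Mapping.single (Poly_Mapping.map_key \<pi> E) c)"

lemma ring_morphism_rename_vars: "inj \<pi> \<Longrightarrow> ring_morphism (rename_vars \<pi>)"
  unfolding rename_vars_def
  by (rule ring_morphism_monomial_ext)
    (simp_all only: single_add mult_single map_key_plus map_key_zero single_one)

lemma inj_map_key:
  assumes "bij \<pi>"
  shows "inj (Poly_Mapping.map_key \<pi> :: ('a \<Rightarrow>\<^sub>0 'c::zero) \<Rightarrow> 'a \<Rightarrow>\<^sub>0 'c)"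
proof (rule injI)
  fix E F :: "'a \<Rightarrow>\<^sub>0 'c" assume eq: "Poly_Mapping.map_key \<pi> E = Poly_Mapping.map_key \<pi> F"
  show "E = F"
  proof (rule poly_mapping_eqI)
    fix i
    obtain n where i: "i = \<pi> n" using bij_is_surj[OF assms] by (elim surjE)
    have "Poly_Mapping.lookup (Poly_Mapping.map_key \<pi> E) n = Poly_Mapping.lookup (Poly_Mapping.map_key \<pi> F) n"
      by (simp only: eq)
    then show "Poly_Mapping.lookup E i = Poly_Mapping.lookup F i"
      by (simp add: i map_key.rep_eq[OF bij_is_inj[OF assms]])
  qed
qed

lemma lookup_rename_vars:
  assumes "bij \<pi>"
  shows "Poly_Mapping.lookup (rename_vars \<pi> p) (Poly_Mapping.map_key \<pi> E) = Poly_Mapping.lookup p E"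
proof -
  interpret ring_morphism "rename_vars \<pi>"
    using assms by (intro ring_morphism_rename_vars bij_is_inj)
  show ?thesis
  proof (induction p rule: poly_mapping_additive_induct)
    case (single k c)
    show ?case
      by (simp add: rename_vars_def monomial_ext_single lookup_single when_def
          inj_eq[OF inj_map_key[OF assms]])
  qed (simp_all add: hom_zero hom_add lookup_add)
qed

lemma symmetric_poly_iff_rename_vars:
  "symmetric_poly p \<longleftrightarrow> (\<forall>\<pi>. bij \<pi> \<longrightarrow> rename_vars \<pi> p = p)"
proof
  assume sym: "symmetric_poly p"
  show "\<forall>\<pi>. bij \<pi> \<longrightarrow> rename_vars \<pi> p = p"
  proof (intro allI impI poly_mapping_eqI)
    fix \<pi> :: "'a \<Rightarrow> 'a" and E :: "'a \<Rightarrow>\<^sub>0 nat" assume \<pi>: "bij \<pi>"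
    define F where "F = Poly_Mapping.map_key (inv \<pi>) E"
    have E: "E = Poly_Mapping.map_key \<pi> F"
      unfolding F_def using \<pi> by (intro poly_mapping_eqI)
        (simp add: map_key.rep_eq bij_is_inj bij_imp_bij_inv inv_f_f)
    show "Poly_Mapping.lookup (rename_vars \<pi> p) E = Poly_Mapping.lookup p E"
      unfolding E lookup_rename_vars[OF \<pi>]
      using sym \<pi> by (simp add: symmetric_poly_def)
  qed
next
  assume *: "\<forall>\<pi>. bij \<pi> \<longrightarrow> rename_vars \<pi> p = p"
  show "symmetric_poly p"
    unfolding symmetric_poly_def
  proof (intro allI impI)
    fix \<pi> :: "'a \<Rightarrow> 'a" and E assume \<pi>: "bij \<pi>"
    show "Poly_Mapping.lookup p (Poly_Mapping.map_key \<pi> E) = Poly_Mapping.lookup p E"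
      using lookup_rename_vars[OF \<pi>, of p E] * \<pi> by simp
  qed
qed

lemma symmetric_poly_cancel:
  fixes p d :: "'k::{finite,linorder} F2poly"
  assumes "symmetric_poly (p * d)" "symmetric_poly d" "d \<noteq> 0"
  shows "symmetric_poly p"
  unfolding symmetric_poly_iff_rename_vars
proof (intro allI impI)
  fix \<pi> :: "'k \<Rightarrow> 'k" assume \<pi>: "bij \<pi>"
  interpret ring_morphism "rename_vars \<pi>"
    using \<pi> by (intro ring_morphism_rename_vars bij_is_inj)
  have inv: "rename_vars \<pi> (p * d) = p * d" "rename_vars \<pi> d = d"
    using assms(1,2) \<pi> unfolding symmetric_poly_iff_rename_vars by blast+
  have "rename_vars \<pi> p * d = p * d"
    using hom_mult[of p d] unfolding inv by (rule sym)
  then show "rename_vars \<pi> p = p" using mult_right_cancel[OF assms(3)] by blast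
qed

text \<open>Take \<open>p = c\<^sub>j\<close>, where \<open>x\<^sub>m^(2^l) = \<Sum>\<^sub>i\<^sub><\<^sub>k c\<^sub>i x\<^sub>m^(2^i)\<close> for all variables simultaneously.\<close>

lemma p_ratio_polynomial:
  assumes "j < CARD('k)" "l \<ge> CARD('k)"
  shows "\<exists>p :: 'k::{finite,linorder} F2poly.
    p_numerator l j = p * p_denominator \<and> symmetric_poly p"
proof -
  have "\<exists>c. \<forall>m\<in>(UNIV :: 'k set). var m ^ (2 ^ l) = (\<Sum>i<CARD('k). c i * var m ^ (2 ^ i))"
    by (rule dickson_relation_higher) (use assms in \<open>simp_all add: bit_poly_char_two\<close>)
  then obtain c where c: "\<And>m :: 'k. var m ^ (2 ^ l) = (\<Sum>i<CARD('k). c i * var m ^ (2 ^ i))" by blast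
  have eq: "p_numerator l j = c j * (p_denominator :: 'k F2poly)"
    unfolding p_denominator_eq_alternant p_numerator_eq_alternant[OF assms]
    by (rule alternant_substitute) (simp_all add: bit_poly_char_two assms c var_power_def)
  have "symmetric_poly (p_numerator l j :: 'k F2poly)"
    unfolding p_numerator_def by (rule mono_sym_symmetric)
  moreover have "symmetric_poly (p_denominator :: 'k F2poly)"
    unfolding p_denominator_def by (rule mono_sym_symmetric)
  ultimately have "symmetric_poly (c j)"
    unfolding eq by (rule symmetric_poly_cancel) (rule p_denominator_nonzero)
  with eq show ?thesis by blast
qed

section \<open>The action of polynomials on formal sums of index tuples\<close>

text \<open>The coefficient \<open>c\<close> acting as a scalar on \<open>x\<close>; it is additive in \<open>c\<close> when \<open>x + x = 0\<close>. In this form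
the double sum in \<open>poly_act\<close> is an instance of \<open>monomial_ext\<close>.\<close>

definition bit_ext :: "'a \<Rightarrow> bit \<Rightarrow> 'a::zero" where
  "bit_ext x c = (if c = 0 then 0 else x)"

lemma bit_ext_add: "x + x = (0::'a::monoid_add) \<Longrightarrow> bit_ext x (c + d) = bit_ext x c + bit_ext x d"
  by (cases c; cases d) (simp_all add: bit_ext_def)

lemma poly_act_eq_monomial_ext:
  "poly_act p w = monomial_ext (\<lambda>E. bit_ext (monomial_ext
     (\<lambda>I. bit_ext (basis_elem (\<lambda>m. I m - Poly_Mapping.lookup E m))) w)) p"
  unfolding poly_act_def monomial_ext_def
  by (intro sum.cong refl) (simp_all add: bit_ext_def in_keys_iff)

lemma poly_act_add_left: "poly_act (p + q) w = poly_act p w + poly_act q w"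
  unfolding poly_act_eq_monomial_ext
  by (rule monomial_ext_add) (simp_all only: bit_ext_add bit_poly_char_two, simp add: bit_ext_def)

lemma monomial_ext_bit_ext_add:
  "monomial_ext (\<lambda>E. bit_ext (f E + g E :: 'c::comm_monoid_add)) p
    = monomial_ext (\<lambda>E. bit_ext (f E)) p + monomial_ext (\<lambda>E. bit_ext (g E)) p"
  unfolding monomial_ext_def sum.distrib[symmetric]
  by (intro sum.cong refl) (simp add: bit_ext_def)

lemma poly_act_add_right: "poly_act p (u + w) = poly_act p u + poly_act p w"
proof -
  have *: "monomial_ext (\<lambda>I. bit_ext (basis_elem (\<lambda>m. I m - Poly_Mapping.lookup E m))) (u + w)
    = monomial_ext (\<lambda>I. bit_ext (basis_elem (\<lambda>m. I m - Poly_Mapping.lookup E m))) u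
      + monomial_ext (\<lambda>I. bit_ext (basis_elem (\<lambda>m. I m - Poly_Mapping.lookup E m))) w" for E
    by (rule monomial_ext_add) (simp_all only: bit_ext_add bit_poly_char_two, simp add: bit_ext_def)
  show ?thesis
    unfolding poly_act_eq_monomial_ext * by (rule monomial_ext_bit_ext_add)
qed

lemma poly_act_zero_left: "poly_act 0 w = 0" and poly_act_zero_right: "poly_act p 0 = 0"
  by (simp_all add: poly_act_def)

lemma poly_act_sum_left: "poly_act (sum p A) w = (\<Sum>a\<in>A. poly_act (p a) w)"
  by (induction A rule: infinite_finite_induct)
    (simp_all add: poly_act_zero_left poly_act_add_left)

lemma poly_act_sum_right: "poly_act p (sum w A) = (\<Sum>a\<in>A. poly_act p (w a))"
  by (induction A rule: infinite_finite_induct)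
    (simp_all add: poly_act_zero_right poly_act_add_right)

lemma poly_act_single:
  "poly_act (Poly_Mapping.single E 1) (Poly_Mapping.single I 1)
     = basis_elem (\<lambda>m. I m - Poly_Mapping.lookup E m)"
  by (simp add: poly_act_def)

lemma poly_act_single_basis_elem:
  "poly_act (Poly_Mapping.single E 1) (basis_elem I) = basis_elem (\<lambda>m. I m - Poly_Mapping.lookup E m)"
proof (cases "\<forall>m. I m \<ge> 1")
  case True
  then show ?thesis by (simp add: basis_elem_def[of I] poly_act_single)
next
  case False
  then have "basis_elem I = 0" by (auto simp: basis_elem_def)
  moreover have "\<not> (\<forall>m. I m - Poly_Mapping.lookup E m \<ge> 1)"
    using False by (meson diff_le_self le_trans)
  then have "basis_elem (\<lambda>m. I m - Poly_Mapping.lookup E m) = 0" by (auto simp: basis_elem_def)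
  ultimately show ?thesis by (simp add: poly_act_zero_right)
qed

text \<open>On single monomials both sides subtract both exponents. Truncated subtraction does no harm: an entry that
has become \<open>0\<close> stays \<open>0\<close>.\<close>

lemma poly_act_mult: "poly_act (p * q) w = poly_act p (poly_act q w)"
proof (induction p rule: poly_mapping_additive_induct)
  case zero
  then show ?case by (simp add: poly_act_zero_left)
next
  case (add p p')
  then show ?case by (simp add: distrib_right poly_act_add_left)
next
  case p: (single E c)
  show ?case
  proof (induction q rule: poly_mapping_additive_induct)
    case zero
    then show ?case by (simp add: poly_act_zero_left poly_act_zero_right)
  next
    case (add q q')
    then show ?case by (simp add: distrib_left poly_act_add_left poly_act_add_right)
  next
    case q: (single F d)
    show ?case
    proof (induction w rule: poly_mapping_additive_induct)
      case zero
      then show ?case by (simp add: poly_act_zero_right)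
    next
      case (add w w')
      then show ?case by (simp add: poly_act_add_right)
    next
      case w: (single I e)
      show ?case
        by (cases c; cases d; cases e)
          (simp_all add: poly_act_zero_left poly_act_zero_right mult_single poly_act_single
            poly_act_single_basis_elem lookup_add add.commute)
    qed
  qed
qed

lemma wf_lexicographic_functions:
  "wf {(f, g :: 'k::{finite,linorder} \<Rightarrow> nat). \<exists>m. f m < g m \<and> (\<forall>n<m. f n = g n)}"
proof (rule wf_subset)
  define xs where "xs = sorted_list_of_set (UNIV :: 'k set)"
  have xs: "sorted_wrt (<) xs" "set xs = UNIV" by (simp_all add: xs_def)
  show "wf (inv_image (lex less_than) (\<lambda>f :: 'k \<Rightarrow> nat. map f xs))"
    by (intro wf_inv_image wf_lex wf_less_than)
  show "{(f, g). \<exists>m. f m < g m \<and> (\<forall>n<m. f n = g n)}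
    \<subseteq> inv_image (lex less_than) (\<lambda>f :: 'k \<Rightarrow> nat. map f xs)"
  proof safe
    fix f g :: "'k \<Rightarrow> nat" and m
    assume less: "f m < g m" and eq: "\<forall>n<m. f n = g n"
    obtain ys zs where split: "xs = ys @ m # zs" using xs(2) by (metis UNIV_I split_list)
    have "\<forall>n\<in>set ys. n < m" using xs(1) by (simp add: split sorted_wrt_append)
    then have "map f ys = map g ys" using eq by simp
    then show "(f, g) \<in> inv_image (lex less_than) (\<lambda>f. map f xs)"
      using less by (auto simp: split lex_conv in_inv_image intro!: exI[of _ "map g ys"])
  qed
qed

text \<open>Let \<open>E\<close> be the least exponent of \<open>p\<close> in the lexicographic order and \<open>J = I + E\<close>. Then \<open>p\<close> sends \<open>z\<^sub>J\<close> to
\<open>z\<^sub>I\<close> plus terms \<open>z\<^sub>J\<^sub>-\<^sub>F\<close> with \<open>F > E\<close>. At the first entry where \<open>F\<close> differs from \<open>E\<close>, the tuple \<open>J - F\<close> is smaller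
than \<open>I\<close>, so by well-founded induction these terms are in the image too.\<close>

lemma poly_act_surjective:
  fixes p :: "'k::{finite,linorder} F2poly"
  assumes "p \<noteq> 0"
  shows "\<exists>w. poly_act p w = basis_elem I"
proof (induction I rule: wf_induct_rule[OF wf_lexicographic_functions])
  case (1 I)
  define E where "E = Min (Poly_Mapping.keys p)"
  have keys: "finite (Poly_Mapping.keys p)" "Poly_Mapping.keys p \<noteq> {}" using assms by auto
  have E: "E \<in> Poly_Mapping.keys p" unfolding E_def by (rule Min_in[OF keys])
  define J where "J m = I m + Poly_Mapping.lookup E m" for m
  \<comment> \<open>Tuples with an entry \<open>0\<close> give \<open>0\<close>; this covers the case in which the subtraction is truncated.\<close>
  have "\<exists>w. poly_act p w = basis_elem (\<lambda>m. J m - Poly_Mapping.lookup F m)"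
    if F: "F \<in> Poly_Mapping.keys p - {E}" for F
  proof (cases "\<forall>m. J m - Poly_Mapping.lookup F m \<ge> 1")
    case False
    then have "basis_elem (\<lambda>m. J m - Poly_Mapping.lookup F m) = 0" by (auto simp: basis_elem_def)
    then show ?thesis by (intro exI[of _ 0]) (simp add: poly_act_zero_right)
  next
    case True
    have "E \<le> F" "E \<noteq> F" using F Min_le[OF keys(1), of F] unfolding E_def by blast+
    then have "E < F" by (rule le_neq_trans)
    then obtain m where m: "Poly_Mapping.lookup E m < Poly_Mapping.lookup F m"
      "\<And>n. n < m \<Longrightarrow> Poly_Mapping.lookup E n = Poly_Mapping.lookup F n"
      by (auto simp: less_poly_mapping.rep_eq less_fun_def)
    have "J m - Poly_Mapping.lookup F m < I m"
      using m(1) True[rule_format, of m] by (simp add: J_def)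
    moreover have "\<forall>n<m. J n - Poly_Mapping.lookup F n = I n" using m(2) by (simp add: J_def)
    ultimately show ?thesis by (intro 1) blast
  qed
  then have "\<forall>F\<in>Poly_Mapping.keys p - {E}. \<exists>w. poly_act p w = basis_elem (\<lambda>m. J m - Poly_Mapping.lookup F m)"
    by blast
  from bchoice[OF this] obtain w where w: "\<And>F. F \<in> Poly_Mapping.keys p - {E} \<Longrightarrow>
      poly_act p (w F) = basis_elem (\<lambda>m. J m - Poly_Mapping.lookup F m)"
    by blast
  define s where "s = (\<Sum>F\<in>Poly_Mapping.keys p - {E}. basis_elem (\<lambda>m. J m - Poly_Mapping.lookup F m))"
  have "poly_act p (basis_elem J)
    = poly_act (\<Sum>F\<in>Poly_Mapping.keys p. Poly_Mapping.single F (Poly_Mapping.lookup p F)) (basis_elem J)"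
    using poly_mapping_sum_single[of p] by simp
  also have "\<dots> = (\<Sum>F\<in>Poly_Mapping.keys p. basis_elem (\<lambda>m. J m - Poly_Mapping.lookup F m))"
    unfolding poly_act_sum_left
    by (intro sum.cong refl) (simp add: in_keys_iff poly_act_single_basis_elem)
  also have "\<dots> = basis_elem I + s"
    unfolding s_def by (subst sum.remove[OF keys(1) E]) (simp add: J_def)
  finally have "poly_act p (basis_elem J + (\<Sum>F\<in>Poly_Mapping.keys p - {E}. w F)) = basis_elem I + s + s"
    by (simp add: poly_act_add_right poly_act_sum_right w s_def)
  also have "\<dots> = basis_elem I" by (simp only: add.assoc bit_poly_char_two add_0_right)
  finally show ?case by blast
qed

section \<open>The filtration\<close>

interpretation Q: module "Q_scale :: BP \<Rightarrow> 'k::finite Q \<Rightarrow> 'k Q"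
  by (rule module_Q_scale)

lemma subspace_Filt: "Q.subspace (Filt s :: 'k::finite Q set)"
  by (cases s) (simp_all add: Q.subspace_UNIV Q.subspace_span)

lemmas Filt_zero = Q.subspace_0[OF subspace_Filt]
  and Filt_add = Q.subspace_add[OF subspace_Filt]
  and Filt_diff = Q.subspace_diff[OF subspace_Filt]
  and Filt_neg = Q.subspace_neg[OF subspace_Filt]
  and Filt_scale = Q.subspace_scale[OF subspace_Filt]
  and Filt_sum = Q.subspace_sum[OF subspace_Filt]

lemma v_gen_Filt: "x \<in> Filt s \<Longrightarrow> v_gen i \<bullet> x \<in> Filt (Suc s)"
  by (auto intro!: Q.span_base)

lemma v_monomial_Filt:
  "x \<in> Filt t \<Longrightarrow> prod_mset (image_mset v_gen T) \<bullet> x \<in> Filt (size T + t)"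
proof (induction T)
  case empty
  then show ?case by simp
next
  case (add i T)
  then have "v_gen i \<bullet> (prod_mset (image_mset v_gen T) \<bullet> x) \<in> Filt (Suc (size T + t))"
    by (intro v_gen_Filt)
  then show ?case by (simp only: image_mset_add_mset prod_mset.add_mset size_add_mset add_Suc Q.scale_scale)
qed

lemma double_Filt: "x \<in> Filt s \<Longrightarrow> x + x \<in> Filt (Suc s)"
proof -
  assume x: "x \<in> Filt s"
  have "v_gen 0 \<bullet> x = x + x"
    by (simp only: v_gen_def nat.case one_add_one[symmetric] Q.scale_left_distrib Q.scale_one)
  then show ?thesis using v_gen_Filt[OF x, of 0] by simp
qed

text \<open>The first hypothesis says that \<open>c\<close> lies in the square of the ideal, by \<open>rescale_four_dvd_induct\<close>.\<close>

lemma square_ideal_Filt: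
  assumes "4 dvd rescale c" "x \<in> Filt s"
  shows "c \<bullet> x \<in> Filt (s + 2)"
  using assms(1)
proof (induction c rule: rescale_four_dvd_induct)
  case zero
  then show ?case by (simp add: Filt_zero del: Filt.simps)
next
  case (add a b)
  then show ?case by (simp add: Q.scale_left_distrib Filt_add del: Filt.simps)
next
  case (gens i j a)
  have "v_gen i \<bullet> v_gen j \<bullet> a \<bullet> x \<in> Filt (Suc (Suc s))"
    by (intro v_gen_Filt Filt_scale assms)
  then show ?case by (simp add: mult.assoc del: Filt.simps)
qed

section \<open>Relations among the tensors\<close>

lemma z_gen_0: "z_gen 0 = 0"
proof -
  interpret F: module "free_scale :: BP \<Rightarrow> (nat \<Rightarrow>\<^sub>0 BP) \<Rightarrow> _" by (rule module_free_scale)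
  have "congruent_mod BZ2_relators (Poly_Mapping.single 0 1) 0"
    unfolding congruent_mod_def by (auto intro: F.span_base simp: BZ2_relators_def)
  then show ?thesis
    unfolding z_gen_def zero_BP_BZ2_def by (simp add: BP_BZ2.abs_eq_iff)
qed

lemma free_scale_single: "free_scale r (Poly_Mapping.single i c) = Poly_Mapping.single i (r * c)"
  by (rule poly_mapping_eqI) (simp add: lookup_single when_def)

interpretation BZ2: module BZ2_scale
  by (rule module_BZ2_scale)

lemma z_gen_relation: "(\<Sum>j\<le>n. BZ2_scale (two_coeff j) (z_gen (n - j))) = 0"
proof -
  interpret F: module "free_scale :: BP \<Rightarrow> (nat \<Rightarrow>\<^sub>0 BP) \<Rightarrow> _" by (rule module_free_scale)
  have abs_sum: "(\<Sum>j\<in>A. abs_BP_BZ2 (g j)) = abs_BP_BZ2 (\<Sum>j\<in>A. g j)" for A :: "nat set" and g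
    by (induction A rule: infinite_finite_induct) (simp_all add: zero_BP_BZ2_def plus_BP_BZ2.abs_eq)
  have "(\<Sum>j\<le>n. BZ2_scale (two_coeff j) (z_gen (n - j)))
    = abs_BP_BZ2 (\<Sum>j\<le>n. Poly_Mapping.single (n - j) (two_coeff j))"
    by (simp add: z_gen_def BZ2_scale.abs_eq free_scale_single abs_sum)
  also have "\<dots> = abs_BP_BZ2 0"
    unfolding BP_BZ2.abs_eq_iff congruent_mod_def
    by (auto intro: F.span_base simp: BZ2_relators_def)
  finally show ?thesis by (simp add: zero_BP_BZ2_def)
qed

lemma tensor_add:
  "tensor (f(m := x + y)) = tensor (f(m := x)) + (tensor (f(m := y)) :: 'k::finite Q)"
proof -
  interpret F: module "free_scale :: BP \<Rightarrow> (('k \<Rightarrow> BP_BZ2) \<Rightarrow>\<^sub>0 BP) \<Rightarrow> _" by (rule module_free_scale)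
  have "Poly_Mapping.single (f(m := x + y)) 1
        - Poly_Mapping.single (f(m := x)) 1 - Poly_Mapping.single (f(m := y)) 1
      \<in> (multilinear_relators :: (('k \<Rightarrow> BP_BZ2) \<Rightarrow>\<^sub>0 BP) set)"
    unfolding multilinear_relators_def by blast
  then show ?thesis
    unfolding tensor_def plus_Q.abs_eq Q.abs_eq_iff congruent_mod_def
    by (auto intro: F.span_base simp: diff_diff_eq)
qed

lemma tensor_scale:
  "tensor (f(m := BZ2_scale r x)) = r \<bullet> (tensor (f(m := x)) :: 'k::finite Q)"
proof -
  interpret F: module "free_scale :: BP \<Rightarrow> (('k \<Rightarrow> BP_BZ2) \<Rightarrow>\<^sub>0 BP) \<Rightarrow> _" by (rule module_free_scale)
  have "Poly_Mapping.single (f(m := BZ2_scale r x)) 1 - Poly_Mapping.single (f(m := x)) r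
      \<in> (multilinear_relators :: (('k \<Rightarrow> BP_BZ2) \<Rightarrow>\<^sub>0 BP) set)"
    unfolding multilinear_relators_def by blast
  then show ?thesis
    unfolding tensor_def Q_scale.abs_eq free_scale_single Q.abs_eq_iff congruent_mod_def
    by (auto intro: F.span_base)
qed

lemma tensor_zero: "tensor (f(m := 0)) = (0 :: 'k::finite Q)"
  using tensor_scale[of f m 0 0] by simp

lemma tensor_sum:
  "tensor (f(m := sum g A)) = (\<Sum>a\<in>A. tensor (f(m := g a)) :: 'k::finite Q)"
  by (induction A rule: infinite_finite_induct)
    (simp_all only: sum.infinite sum.empty sum.insert tensor_zero tensor_add not_False_eq_True)

lemma zI_upd: "zI (I(m := i)) = tensor ((\<lambda>n. z_gen (I n))(m := z_gen i))"
  unfolding zI_def by (rule arg_cong[of _ _ tensor]) auto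

lemma zI_zero: "I m = 0 \<Longrightarrow> zI I = 0"
proof -
  assume "I m = 0"
  then have "I = I(m := 0)" by (simp only: fun_upd_idem)
  then have "zI I = zI (I(m := 0))" by (rule arg_cong)
  then show ?thesis by (simp only: zI_upd z_gen_0 tensor_zero)
qed

lemma zI_relation: "(\<Sum>j\<le>n. two_coeff j \<bullet> zI (I(m := n - j))) = 0"
proof -
  have "(\<Sum>j\<le>n. two_coeff j \<bullet> zI (I(m := n - j)))
    = tensor ((\<lambda>n. z_gen (I n))(m := \<Sum>j\<le>n. BZ2_scale (two_coeff j) (z_gen (n - j))))"
    by (simp only: zI_upd tensor_sum tensor_scale)
  then show ?thesis by (simp add: z_gen_relation tensor_zero)
qed

text \<open>The relation of index \<open>n = I m - 1\<close> in factor \<open>m\<close>, with the coefficients reduced modulo the square of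
the ideal: \<open>v\<^sub>l\<close> is the coefficient at \<open>z\<close> with index \<open>n - (2^l - 1) = I m - 2^l\<close>. The bound \<open>l < I m\<close> is
generous, because \<open>l < 2^l\<close>.\<close>

lemma zI_relation_mod_Filt_2:
  "(\<Sum>l<I m. v_gen l \<bullet> zI (I(m := I m - 2 ^ l))) \<in> Filt 2"
proof (cases "I m")
  case 0
  then show ?thesis by (simp add: Filt_zero del: Filt.simps)
next
  case (Suc n)
  define \<mu> where "\<mu> j = (\<Sum>l | j + 1 = 2 ^ l. v_gen l)" for j :: nat
  have "(\<Sum>j\<le>n. (two_coeff j - \<mu> j) \<bullet> zI (I(m := n - j))) \<in> Filt (0 + 2)"
    by (intro Filt_sum square_ideal_Filt) (simp_all only: \<mu>_def rescale_two_coeff Filt.simps UNIV_I)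
  then have "- (\<Sum>j\<le>n. (two_coeff j - \<mu> j) \<bullet> zI (I(m := n - j))) \<in> Filt 2"
    by (simp only: add_0 Filt_neg)
  also have "- (\<Sum>j\<le>n. (two_coeff j - \<mu> j) \<bullet> zI (I(m := n - j)))
    = (\<Sum>j\<le>n. \<mu> j \<bullet> zI (I(m := n - j)))"
    by (simp only: Q.scale_left_diff_distrib sum_subtractf zI_relation diff_0 minus_minus)
  also have "\<dots> = (\<Sum>j\<in>{..n}. \<Sum>l | l \<in> {..<Suc n} \<and> j + 1 = 2 ^ l. v_gen l \<bullet> zI (I(m := n - j)))"
  proof (rule sum.cong[OF refl])
    fix j assume j: "j \<in> {..n}"
    have "l < Suc n" if "j + 1 = 2 ^ l" for l
      using less_exp[of l] that j by (simp only: atMost_iff)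
    then have "{l. j + 1 = 2 ^ l} = {l. l \<in> {..<Suc n} \<and> j + 1 = 2 ^ l}" by blast
    then show "\<mu> j \<bullet> zI (I(m := n - j))
      = (\<Sum>l | l \<in> {..<Suc n} \<and> j + 1 = 2 ^ l. v_gen l \<bullet> zI (I(m := n - j)))"
      by (simp only: \<mu>_def Q.scale_sum_left)
  qed
  also have "\<dots> = (\<Sum>l\<in>{..<Suc n}. \<Sum>j | j \<in> {..n} \<and> j + 1 = 2 ^ l. v_gen l \<bullet> zI (I(m := n - j)))"
    by (rule sum.swap_restrict) simp_all
  also have "\<dots> = (\<Sum>l<Suc n. v_gen l \<bullet> zI (I(m := Suc n - 2 ^ l)))"
  proof (rule sum.cong[OF refl])
    fix l
    show "(\<Sum>j | j \<in> {..n} \<and> j + 1 = 2 ^ l. v_gen l \<bullet> zI (I(m := n - j)))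
      = v_gen l \<bullet> zI (I(m := Suc n - 2 ^ l))"
    proof (cases "2 ^ l \<le> Suc n")
      case True
      then have "{j. j \<in> {..n} \<and> j + 1 = 2 ^ l} = {2 ^ l - 1}" by auto
      moreover have "n - (2 ^ l - 1) = Suc n - 2 ^ l" by simp
      ultimately show ?thesis by simp
    next
      case False
      then have "{j. j \<in> {..n} \<and> j + 1 = 2 ^ l} = {}" by auto
      moreover have "zI (I(m := Suc n - 2 ^ l)) = 0" by (rule zI_zero[of _ m]) (use False in simp)
      ultimately show ?thesis by (simp only: sum.empty Q.scale_zero_right)
    qed
  qed
  finally show ?thesis by (simp only: Suc)
qed

section \<open>Linear relations in the associated graded module\<close>

lemma realize_eq_sum:
  assumes "finite A" "Poly_Mapping.keys w \<subseteq> A"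
  shows "realize w = (\<Sum>I\<in>A. if Poly_Mapping.lookup w I = 0 then 0 else zI I)"
  unfolding realize_def
  by (rule sum.mono_neutral_cong_left) (use assms in \<open>auto simp: in_keys_iff\<close>)

lemma realize_0: "realize 0 = 0"
  by (simp add: realize_def)

text \<open>Index tuples that occur in both arguments disappear from the sum in characteristic two; they
contribute \<open>- 2 z\<^sub>I\<close>, and \<open>2 = v\<^sub>0\<close>.\<close>

lemma realize_add:
  fixes u w :: "('k::finite \<Rightarrow> nat) \<Rightarrow>\<^sub>0 bit"
  shows "realize (u + w) - (realize u + realize w) \<in> Filt 1"
proof -
  define A where "A = Poly_Mapping.keys u \<union> Poly_Mapping.keys w"
  have A: "finite A" "Poly_Mapping.keys u \<subseteq> A" "Poly_Mapping.keys w \<subseteq> A"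
    "Poly_Mapping.keys (u + w) \<subseteq> A"
    using keys_add[of u w] by (auto simp: A_def)
  have "realize (u + w) - (realize u + realize w) = (\<Sum>I\<in>A.
      (if Poly_Mapping.lookup (u + w) I = 0 then 0 else zI I)
      - ((if Poly_Mapping.lookup u I = 0 then 0 else zI I)
        + (if Poly_Mapping.lookup w I = 0 then 0 else zI I)))"
    by (simp only: realize_eq_sum[OF A(1,2)] realize_eq_sum[OF A(1,3)] realize_eq_sum[OF A(1,4)]
        sum_subtractf sum.distrib)
  also have "\<dots> \<in> Filt 1"
  proof (rule Filt_sum)
    fix I :: "'k \<Rightarrow> nat"
    have "zI I + zI I \<in> Filt (Suc 0)" by (rule double_Filt) simp
    from Filt_neg[OF this] have "- zI I - zI I \<in> Filt (Suc 0)" by (simp del: Filt.simps)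
    then show "(if Poly_Mapping.lookup (u + w) I = 0 then 0 else zI I)
      - ((if Poly_Mapping.lookup u I = 0 then 0 else zI I)
        + (if Poly_Mapping.lookup w I = 0 then 0 else zI I)) \<in> Filt 1"
      by (cases "Poly_Mapping.lookup u I"; cases "Poly_Mapping.lookup w I")
        (simp_all add: lookup_add Filt_zero del: Filt.simps)
  qed
  finally show ?thesis .
qed

lemma realize_basis_elem: "realize (basis_elem I) = zI I"
proof (cases "\<forall>m. I m \<ge> 1")
  case True
  then show ?thesis by (simp add: basis_elem_def realize_def)
next
  case False
  then obtain m where "I m = 0" by (auto simp: not_le)
  then have "zI I = 0" by (rule zI_zero)
  moreover have "basis_elem I = 0" using False by (auto simp: basis_elem_def)
  ultimately show ?thesis by (simp add: realize_0)
qed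

text \<open>The relation \<open>\<Sum>\<^sub>l v\<^sub>l u\<^sub>l = 0\<close> in \<open>F\<^sub>1/F\<^sub>2\<close>, for a finitely supported family \<open>u\<close> of formal sums of index
tuples.\<close>

definition gr_relation :: "(nat \<Rightarrow> (('k::finite \<Rightarrow> nat) \<Rightarrow>\<^sub>0 bit)) \<Rightarrow> bool" where
  "gr_relation u \<longleftrightarrow> (\<exists>B. (\<forall>l\<ge>B. u l = 0) \<and> (\<Sum>l<B. v_gen l \<bullet> realize (u l)) \<in> Filt 2)"

lemma gr_relation_bound:
  assumes "gr_relation u" "\<forall>l\<ge>B. u l = 0"
  shows "(\<Sum>l<B. v_gen l \<bullet> realize (u l)) \<in> Filt 2"
proof -
  from assms(1) obtain C where C: "\<forall>l\<ge>C. u l = 0" "(\<Sum>l<C. v_gen l \<bullet> realize (u l)) \<in> Filt 2"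
    unfolding gr_relation_def by blast
  have ext: "(\<Sum>l<N. v_gen l \<bullet> realize (u l)) = (\<Sum>l<max B C. v_gen l \<bullet> realize (u l))"
    if "\<forall>l\<ge>N. u l = 0" "N \<le> max B C" for N
    by (rule sum.mono_neutral_left) (use that in \<open>auto simp: realize_0\<close>)
  show ?thesis using C ext[of B] ext[of C] assms(2) by simp
qed

lemma gr_relation_zero: "gr_relation (\<lambda>_. 0)"
  unfolding gr_relation_def by (simp add: realize_0 Filt_zero del: Filt.simps)

lemma gr_relation_add:
  assumes "gr_relation u" "gr_relation w"
  shows "gr_relation (\<lambda>l. u l + w l)"
proof -
  from assms obtain B C where "\<forall>l\<ge>B. u l = 0" "\<forall>l\<ge>C. w l = 0"
    unfolding gr_relation_def by blast
  then have N: "\<forall>l\<ge>max B C. u l = 0" "\<forall>l\<ge>max B C. w l = 0" by simp_all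
  define N where "N = max B C"
  have "(\<Sum>l<N. v_gen l \<bullet> realize (u l)) + (\<Sum>l<N. v_gen l \<bullet> realize (w l))
      + (\<Sum>l<N. v_gen l \<bullet> (realize (u l + w l) - (realize (u l) + realize (w l)))) \<in> Filt 2"
    unfolding N_def
  proof (intro Filt_add gr_relation_bound assms N Filt_sum)
    fix l
    show "v_gen l \<bullet> (realize (u l + w l) - (realize (u l) + realize (w l))) \<in> Filt 2"
      using v_gen_Filt[OF realize_add, of l "u l" "w l"] by (simp add: numeral_2_eq_2 del: Filt.simps)
  qed
  moreover have "(\<Sum>l<N. v_gen l \<bullet> realize (u l)) + (\<Sum>l<N. v_gen l \<bullet> realize (w l))
      + (\<Sum>l<N. v_gen l \<bullet> (realize (u l + w l) - (realize (u l) + realize (w l))))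
    = (\<Sum>l<N. v_gen l \<bullet> realize (u l + w l))"
    by (simp only: sum.distrib[symmetric] Q.scale_right_distrib[symmetric]) simp
  ultimately show ?thesis
    unfolding gr_relation_def using N by (intro exI[of _ N]) (simp add: N_def)
qed

lemma gr_relation_sum:
  "(\<And>a. a \<in> A \<Longrightarrow> gr_relation (u a)) \<Longrightarrow> gr_relation (\<lambda>l. \<Sum>a\<in>A. u a l)"
  by (induction A rule: infinite_finite_induct) (simp_all add: gr_relation_zero gr_relation_add)

lemma gr_relation_var_power: "gr_relation (\<lambda>l. poly_act (var_power m l) w)"
proof (induction w rule: poly_mapping_additive_induct)
  case zero
  then show ?case by (simp add: poly_act_zero_right gr_relation_zero)
next
  case (add u w)
  then show ?case by (simp add: poly_act_add_right gr_relation_add)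
next
  case (single I c)
  show ?case
  proof (cases c)
    case zero
    then show ?thesis by (simp add: poly_act_zero_right gr_relation_zero)
  next
    case one
    have act: "poly_act (var_power m l) (Poly_Mapping.single I c) = basis_elem (I(m := I m - 2 ^ l))" for l
    proof -
      have "(\<lambda>n. I n - Poly_Mapping.lookup (Poly_Mapping.single m (2 ^ l)) n) = I(m := I m - 2 ^ l)"
        by (auto simp: lookup_single when_def)
      then show ?thesis by (simp add: one var_power_def var_pow poly_act_single)
    qed
    have "basis_elem (I(m := I m - 2 ^ l)) = 0" if "l \<ge> I m" for l
    proof -
      have "I m - 2 ^ l = 0" using that less_exp[of l] by (simp only: diff_is_0_eq)
      then have "\<not> (I(m := I m - 2 ^ l)) m \<ge> 1" by simp
      then show ?thesis unfolding basis_elem_def by meson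
    qed
    moreover have "(\<Sum>l<I m. v_gen l \<bullet> realize (basis_elem (I(m := I m - 2 ^ l)))) \<in> Filt 2"
      unfolding realize_basis_elem by (rule zI_relation_mod_Filt_2)
    ultimately show ?thesis unfolding gr_relation_def act by blast
  qed
qed

text \<open>Cramer's rule. Choose \<open>w\<close> with \<open>D w = z\<^sub>I\<close>, apply the relation of the row \<open>m\<close> to the cofactor of \<open>(m, j)\<close> times \<open>w\<close>, and
add over \<open>m\<close>. The coefficient of \<open>v\<^sub>l\<close> is then the determinant with column \<open>j\<close> replaced, applied to \<open>w\<close>.\<close>

lemma gr_relation_v_action:
  fixes p :: "nat \<Rightarrow> 'k::{finite,linorder} F2poly"
  assumes j: "j < CARD('k)"
    and p: "\<And>l. l \<ge> CARD('k) \<Longrightarrow> p_numerator l j = p l * p_denominator"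
  shows "gr_relation (\<lambda>l. if l < CARD('k) then if l = j then basis_elem I else 0
    else poly_act (p l) (basis_elem I))"
proof -
  obtain w where w: "poly_act p_denominator w = basis_elem I"
    using poly_act_surjective[OF p_denominator_nonzero] by blast
  have "gr_relation (\<lambda>l. \<Sum>m\<in>UNIV. poly_act (var_power m l) (poly_act (cofactor var_power j m) w))"
    by (rule gr_relation_sum) (rule gr_relation_var_power)
  also have "(\<lambda>l. \<Sum>m\<in>UNIV. poly_act (var_power m l) (poly_act (cofactor var_power j m) w))
    = (\<lambda>l. poly_act (alternant var_power (id(j := l))) w)"
    by (simp only: poly_act_mult[symmetric] poly_act_sum_left[symmetric]
        cofactor_expansion[OF j, symmetric] mult.commute)
  also have "\<dots> = (\<lambda>l. if l < CARD('k) then if l = j then basis_elem I else 0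
    else poly_act (p l) (basis_elem I))"
  proof
    fix l
    consider "l = j" | "l < CARD('k)" "l \<noteq> j" | "l \<ge> CARD('k)" by linarith
    then show "poly_act (alternant var_power (id(j := l))) w
      = (if l < CARD('k) then if l = j then basis_elem I else 0 else poly_act (p l) (basis_elem I))"
    proof cases
      case 1
      then show ?thesis using j w by (simp add: fun_upd_idem p_denominator_eq_alternant)
    next
      case 2
      then have "alternant var_power (id(j := l)) = (0 :: 'k F2poly)"
        using j by (intro alternant_repeated bit_poly_char_two)
      then show ?thesis using 2 by (simp add: poly_act_zero_left)
    next
      case 3
      then have "alternant var_power (id(j := l)) = p l * (p_denominator :: 'k F2poly)"
        using p_numerator_eq_alternant[OF j 3] p[OF 3] by simp
      then show ?thesis using 3 by (simp add: poly_act_mult w)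
    qed
  qed
  finally show ?thesis .
qed

section \<open>The action on the associated graded groups\<close>

lemma gr_class_eq_iff: "gr_class s x = gr_class s y \<longleftrightarrow> x - y \<in> Filt (Suc s)"
proof
  assume "gr_class s x = gr_class s y"
  moreover have "x \<in> gr_class s x" by (simp add: gr_class_def Filt_zero del: Filt.simps)
  ultimately show "x - y \<in> Filt (Suc s)" by (simp add: gr_class_def del: Filt.simps)
next
  assume *: "x - y \<in> Filt (Suc s)"
  have "z - x \<in> Filt (Suc s) \<longleftrightarrow> z - y \<in> Filt (Suc s)" for z
    using Filt_add[OF _ *, of "z - x"] Filt_diff[OF _ *, of "z - y"] by (auto simp del: Filt.simps)
  then show "gr_class s x = gr_class s y" by (simp add: gr_class_def del: Filt.simps)
qed

lemma gr_class_add: "gr_class s x + gr_class s y = gr_class s (x + y)"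
proof (intro set_eqI iffI)
  fix z assume "z \<in> gr_class s x + gr_class s y"
  then obtain a b where "z = a + b" "a - x \<in> Filt (Suc s)" "b - y \<in> Filt (Suc s)"
    by (auto simp: gr_class_def elim!: set_plus_elim simp del: Filt.simps)
  then show "z \<in> gr_class s (x + y)"
    using Filt_add[of "a - x" "Suc s" "b - y"] by (simp add: gr_class_def algebra_simps del: Filt.simps)
next
  fix z assume "z \<in> gr_class s (x + y)"
  then have "x \<in> gr_class s x" "z - x \<in> gr_class s y"
    by (simp_all add: gr_class_def Filt_zero algebra_simps del: Filt.simps)
  from set_plus_intro[OF this] show "z \<in> gr_class s x + gr_class s y" by simp
qed

lemma v_action_gr_class: "v_action s j (gr_class s x) = gr_class (Suc s) (v_gen j \<bullet> x)"
proof (intro set_eqI iffI)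
  fix z assume "z \<in> v_action s j (gr_class s x)"
  then obtain a b where z: "z = v_gen j \<bullet> a + b" "a - x \<in> Filt (Suc s)" "b \<in> Filt (Suc (Suc s))"
    by (auto simp: v_action_def gr_class_def simp del: Filt.simps)
  have "z - v_gen j \<bullet> x = v_gen j \<bullet> (a - x) + b"
    by (simp add: z(1) Q.scale_right_diff_distrib)
  also have "\<dots> \<in> Filt (Suc (Suc s))" by (intro Filt_add v_gen_Filt z)
  finally show "z \<in> gr_class (Suc s) (v_gen j \<bullet> x)" by (simp add: gr_class_def del: Filt.simps)
next
  fix z assume "z \<in> gr_class (Suc s) (v_gen j \<bullet> x)"
  then have "z = v_gen j \<bullet> x + (z - v_gen j \<bullet> x)" "z - v_gen j \<bullet> x \<in> Filt (s + 2)"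
    by (simp_all add: gr_class_def del: Filt.simps)
  moreover have "x \<in> gr_class s x" by (simp add: gr_class_def Filt_zero del: Filt.simps)
  ultimately show "z \<in> v_action s j (gr_class s x)" unfolding v_action_def by blast
qed

text \<open>Everything reduces to \<open>s = 0\<close>, where \<open>gr_relation_v_action\<close> gives \<open>v\<^sub>j z\<^sub>I + R \<in> F\<^sub>2\<close> with
\<open>R = \<Sum>\<^sub>l\<^sub>\<ge>\<^sub>k v\<^sub>l (p\<^sub>l z\<^sub>I)\<close>: a monomial of degree \<open>s\<close> maps \<open>F\<^sub>2\<close> into \<open>F\<^sub>s\<^sub>+\<^sub>2\<close>. The sign of \<open>R\<close> may be changed
since \<open>2 R = v\<^sub>0 R \<in> F\<^sub>2\<close>.\<close>

lemma is_multiplication_v_action: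
  fixes p :: "nat \<Rightarrow> 'k::{finite,linorder} F2poly"
  assumes j: "j < CARD('k)"
    and p: "\<And>l. l \<ge> CARD('k) \<Longrightarrow> p_numerator l j = p l * p_denominator"
  shows "is_multiplication s p (v_action s j :: 'k Q set \<Rightarrow> 'k Q set)"
  unfolding is_multiplication_def
proof (intro conjI ballI allI impI)
  fix C :: "'k Q set" assume "C \<in> gr s"
  then obtain x where x: "C = gr_class s x" "x \<in> Filt s" by (auto simp: gr_def)
  then show "v_action s j C \<in> gr (s + 1)"
    using v_gen_Filt[OF x(2), of j] by (simp add: v_action_gr_class gr_def del: Filt.simps)
  fix D :: "'k Q set" assume "D \<in> gr s"
  then obtain y where y: "D = gr_class s y" by (auto simp: gr_def)
  show "v_action s j (C + D) = v_action s j C + v_action s j D"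
    by (simp add: x y gr_class_add v_action_gr_class Q.scale_right_distrib)
next
  fix T :: "nat multiset" and I :: "'k \<Rightarrow> nat"
  assume TI: "size T = s \<and> set_mset T \<subseteq> {CARD('k)..} \<and> (\<forall>m. I m \<ge> 1)"
  define k where "k = CARD('k)"
  define w where "w = basis_elem I"
  define V where "V = prod_mset (image_mset v_gen T)"
  define u where "u l = (if l < k then if l = j then w else 0 else poly_act (p l) w)" for l
  define S where "S = {l. l \<ge> k \<and> poly_act (p l) w \<noteq> 0}"
  have rel: "gr_relation u"
    unfolding u_def w_def k_def by (rule gr_relation_v_action[OF j p])
  then obtain B0 where B0: "\<forall>l\<ge>B0. u l = 0" unfolding gr_relation_def by blast
  define B where "B = max k B0"
  have B: "\<forall>l\<ge>B. u l = 0" "k \<le> B" using B0 by (simp_all add: B_def)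
  have S_sub: "S \<subseteq> {k..<B}"
  proof
    fix l assume l: "l \<in> S"
    then have "u l \<noteq> 0" by (simp add: S_def u_def)
    then have "l < B" using B(1) by (meson not_le)
    then show "l \<in> {k..<B}" using l by (simp add: S_def)
  qed
  then show "finite {l. l \<ge> CARD('k) \<and> poly_act (p l) (basis_elem I) \<noteq> 0}"
    unfolding S_def k_def w_def by (rule finite_subset) simp
  define R where "R = (\<Sum>l\<in>S. v_gen l \<bullet> realize (poly_act (p l) w))"
  have "(\<Sum>l<B. v_gen l \<bullet> realize (u l))
    = (\<Sum>l\<in>{..<k}. v_gen l \<bullet> realize (u l)) + (\<Sum>l\<in>{k..<B}. v_gen l \<bullet> realize (u l))"
    using B(2) sum.atLeastLessThan_concat[of 0 k B "\<lambda>l. v_gen l \<bullet> realize (u l)"]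
    by (simp add: lessThan_atLeast0)
  also have "(\<Sum>l\<in>{..<k}. v_gen l \<bullet> realize (u l)) = (\<Sum>l\<in>{..<k}. if l = j then v_gen j \<bullet> zI I else 0)"
    by (rule sum.cong[OF refl]) (simp add: u_def w_def realize_0 realize_basis_elem)
  also have "\<dots> = v_gen j \<bullet> zI I" using j by (simp add: k_def)
  also have "(\<Sum>l\<in>{k..<B}. v_gen l \<bullet> realize (u l)) = R"
    unfolding R_def
    by (rule sum.mono_neutral_cong_right) (use S_sub in \<open>auto simp: S_def u_def realize_0\<close>)
  finally have sum_Filt: "v_gen j \<bullet> zI I + R \<in> Filt 2"
    using gr_relation_bound[OF rel B(1)] by simp
  have "R \<in> Filt (Suc 0)"
    unfolding R_def by (intro Filt_sum v_gen_Filt) simp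
  from double_Filt[OF this] have "R + R \<in> Filt 2" by (simp add: numeral_2_eq_2 del: Filt.simps)
  with sum_Filt have "(v_gen j \<bullet> zI I + R) - (R + R) \<in> Filt 2" by (rule Filt_diff)
  then have "V \<bullet> (v_gen j \<bullet> zI I - R) \<in> Filt (size T + 2)"
    unfolding V_def by (intro v_monomial_Filt) (simp del: Filt.simps)
  moreover have "V \<bullet> (v_gen j \<bullet> zI I - R)
    = v_gen j \<bullet> V \<bullet> zI I - (\<Sum>l\<in>S. (v_gen l * V) \<bullet> realize (poly_act (p l) w))"
    by (simp add: R_def Q.scale_right_diff_distrib Q.scale_sum_right mult.commute)
  ultimately have "v_gen j \<bullet> V \<bullet> zI I - (\<Sum>l\<in>S. (v_gen l * V) \<bullet> realize (poly_act (p l) w))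
      \<in> Filt (Suc (s + 1))"
    using TI by (simp del: Filt.simps)
  then show "v_action s j (gr_class s (prod_mset (image_mset v_gen T) \<bullet> zI I)) =
      gr_class (s + 1) (\<Sum>l | l \<ge> CARD('k) \<and> poly_act (p l) (basis_elem I) \<noteq> 0.
        (v_gen l * prod_mset (image_mset v_gen T)) \<bullet> realize (poly_act (p l) (basis_elem I)))"
    unfolding v_action_gr_class Suc_eq_plus1[symmetric] gr_class_eq_iff
    by (simp add: V_def S_def w_def k_def del: Filt.simps)
qed

theorem theorem1p1:
  shows "(p_denominator :: 'k::{finite,linorder} F2poly) \<noteq> 0 \<and>
    (\<exists>p :: nat \<Rightarrow> nat \<Rightarrow> 'k F2poly.
       (\<forall>j<CARD('k). \<forall>l\<ge>CARD('k).
          (p_ratio l j :: 'k F2poly fract) = Fract (p l j) 1 \<and> symmetric_poly (p l j)) \<and>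
       (\<forall>j<CARD('k). \<forall>s.
          is_multiplication s (\<lambda>l. p l j) (v_action s j :: 'k Q set \<Rightarrow> 'k Q set)))"
proof -
  define p :: "nat \<Rightarrow> nat \<Rightarrow> 'k F2poly" where
    "p l j = (SOME q. p_numerator l j = q * p_denominator \<and> symmetric_poly q)" for l j
  have p: "p_numerator l j = p l j * p_denominator \<and> symmetric_poly (p l j)"
    if "j < CARD('k)" "l \<ge> CARD('k)" for l j
    unfolding p_def by (rule someI_ex) (rule p_ratio_polynomial[OF that])
  show ?thesis
  proof (intro conjI exI[of _ p] allI impI)
    show "(p_denominator :: 'k F2poly) \<noteq> 0" by (rule p_denominator_nonzero)
  next
    fix j l assume jl: "j < CARD('k)" "l \<ge> CARD('k)"
    show "(p_ratio l j :: 'k F2poly fract) = Fract (p l j) 1"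
      unfolding p_ratio_def
      by (subst Fraction_Field.eq_fract(1)) (use p[OF jl] p_denominator_nonzero in simp_all)
    show "symmetric_poly (p l j)" using p[OF jl] by (rule conjunct2)
  next
    fix j s assume j: "j < CARD('k)"
    show "is_multiplication s (\<lambda>l. p l j) (v_action s j :: 'k Q set \<Rightarrow> 'k Q set)"
    proof (rule is_multiplication_v_action[OF j])
      fix l assume "l \<ge> CARD('k)"
      from p[OF j this] show "p_numerator l j = p l j * p_denominator" by (rule conjunct1)
    qed
  qed
qed
end
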